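(* Let $J\neq F_n^\infty$ be a WOT-closed two-sided ideal of $F_n^\infty$ and let $T:=[T_1,\ldots,T_n]$, $T_i\in B(\mathcal H)$, be a completely non-coisometric row contraction such that $\varphi(T_1,\ldots,T_n)=0$ for all $\varphi\in J$. Put $\Delta_{J,T}:=(I-\Theta_{J,T}^*\Theta_{J,T})^{1/2}$, where $\Theta_{J,T}$ is the constrained characteristic function of $T$. Then $T$ is unitarily equivalent to the $J$-constrained row contraction $\mathbb T:=[\mathbb T_1,\ldots,\mathbb T_n]$ on the Hilbert space $$\mathbb H_{J,T}:=\left[(\mathcal N_J\otimes\mathcal D_T)\oplus\overline{\Delta_{J,T}(\mathcal N_J\otimes\mathcal D_{T^*})}\right]\ominus\left\{\Theta_{J,T}f\oplus\Delta_{J,T}f:\ f\in\mathcal N_J\otimes\mathcal D_{T^*}\right\},$$ where each operator $\mathbb T_i$, $i=1,\ldots,n$, is uniquely defined by the relation $$\left(P_{\mathcal N_J\otimes\mathcal D_T}|_{\mathbb H_{J,T}}\right)\mathbb T_i^*x=(B_i^*\otimes I_{\mathcal D_T})\left(P_{\mathcal N_J\otimes\mathcal D_T}|_{\mathbb H_{J,T}}\right)x,\qquad x\in\mathbb H_{J,T}.$$ Here $P_{\mathcal N_J\otimes\mathcal D_T}$ is the orthogonal projection of $(\mathcal N_J\otimes\mathcal D_T)\oplus\overline{\Delta_{J,T}(\mathcal N_J\otimes\mathcal D_{T^*})}$ onto the subspace $\mathcal N_J\otimes\mathcal D_T$, the operator $P_{\mathcal N_J\otimes\mathcal D_T}|_{\mathbb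 H_{J,T}}$ is one-to-one, and $B_1,\ldots,B_n$ are the constrained left creation operators determined by $J$. Moreover, $T$ is a pure row contraction if and only if $\Theta_{J,T}$ is an inner multi-analytic operator with respect to $B_1,\ldots,B_n$. In this case, $T$ is unitarily equivalent to the row contraction $$\left[P_{\mathbb H}(B_1\otimes I_{\mathcal D_T})|_{\mathbb H},\ldots,P_{\mathbb H}(B_n\otimes I_{\mathcal D_T})|_{\mathbb H}\right],$$ where $P_{\mathbb H}$ is the orthogonal projection of $\mathcal N_J\otimes\mathcal D_T$ onto the Hilbert space $\mathbb H:=(\mathcal N_J\otimes\mathcal D_T)\ominus\Theta_{J,T}(\mathcal N_J\otimes\mathcal D_{T^*})$.
   Context: Fock space. $n\in\{1,2,\ldots\}$; $H_n$ is an $n$-dimensional complex Hilbert space with orthonormal basis $e_1,\ldots,e_n$; $F^2(H_n):=\bigoplus_{k\ge0}H_n^{\otimes k}$ is the full Fock space, with $H_n^{\otimes0}:=\mathbb C1$. The left creation operators are $S_i\varphi:=e_i\otimes\varphi$ and the right creation operators are $R_i\varphi:=\varphi\otimes e_i$. $\mathbb F_n^+$ is the unital free semigroup on generators $g_1,\ldots,g_n$ with identity $g_0$; for $\alpha=g_{i_1}\cdots g_{i_k}$, $|\alpha|:=k$, $T_\alpha:=T_{i_1}\cdots T_{i_k}$, $e_\alpha:=e_{i_1}\otimes\cdots\otimes e_{i_k}$, with $|g_0|=0$, $T_{g_0}=I$, $e_{g_0}=1$. $F_n^\infty$ (the noncommutative analytic Toeplitz algebra) is the WOT-closed algebra generated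 by $S_1,\ldots,S_n$ and the identity; each $f\in F_n^\infty$ has a formal Fourier series $\sum_\alpha a_\alpha S_\alpha$, where $f(1)=\sum_\alpha a_\alpha e_\alpha$. Row contractions. $T=[T_1,\ldots,T_n]$, $T_i\in B(\mathcal H)$ ($\mathcal H$ a Hilbert space), is a row contraction if $\sum_iT_iT_i^*\le I$. It is pure if $\text{SOT-}\lim_{k\to\infty}\sum_{|\alpha|=k}T_\alpha T_\alpha^*=0$. It is completely non-coisometric (c.n.c.) if there is no $h\in\mathcal H$, $h\ne0$, with $\sum_{|\alpha|=k}\|T_\alpha^*h\|^2=\|h\|^2$ for all $k=1,2,\ldots$. For $T$ c.n.c. and $f=\sum a_\alpha S_\alpha\in F_n^\infty$, the limit $f(T_1,\ldots,T_n):=\text{SOT-}\lim_{r\to1^-}\sum_{k=0}^\infty\sum_{|\alpha|=k}r^{|\alpha|}a_\alpha T_\alpha$ exists ($F_n^\infty$-functional calculus; $f\mapsto f(T_1,\ldots,T_n)$ is a WOT-continuous completely contractive homomorphism). A c.n.c. row contraction $T$ is $J$-constrained if $\varphi(T_1,\ldots,T_n)=0$ for all $\varphi\in J$. Row contractions $T$ on $\mathcal H$ and $T'$ on $\mathcal H'$ are (unitarily) equivalent if there is a unitary $U:\mathcal H\to\mathcal H'$ with $UT_i=T_i'U$ for all $i$. Constrained shifts. For a WOT-closed two-sided ideal $J\ne F_n^\infty$ of $F_n^\infty$: $\mathcal M_J:=\overline{JF^2(H_n)}$, $\mathcal N_J:=F^2(H_n)\ominus\mathcal M_J$, $B_i:=P_{\mathcal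 N_J}S_i|_{\mathcal N_J}$ (constrained left creation operators), $W_i:=P_{\mathcal N_J}R_i|_{\mathcal N_J}$ (constrained right creation operators). A bounded operator $M:\mathcal N_J\otimes\mathcal K\to\mathcal N_J\otimes\mathcal K'$ is multi-analytic with respect to $B_1,\ldots,B_n$ if $M(B_i\otimes I_{\mathcal K})=(B_i\otimes I_{\mathcal K'})M$ for all $i$; it is inner if in addition it is a partial isometry. Defects. $\Delta_T:=(I_{\mathcal H}-\sum_iT_iT_i^* )^{1/2}\in B(\mathcal H)$, $\Delta_{T^*}:=(I-T^*T)^{1/2}\in B(\mathcal H^{(n)})$, where $\mathcal H^{(n)}$ is the direct sum of $n$ copies of $\mathcal H$ and $T:\mathcal H^{(n)}\to\mathcal H$ is the row operator; $\mathcal D_T:=\overline{\Delta_T\mathcal H}$, $\mathcal D_{T^*}:=\overline{\Delta_{T^*}\mathcal H^{(n)}}$. Constrained characteristic function. $\Theta_{J,T}:\mathcal N_J\otimes\mathcal D_{T^*}\to\mathcal N_J\otimes\mathcal D_T$ is the multi-analytic operator (with respect to $B_1,\ldots,B_n$) with formal Fourier representation $$-I_{\mathcal N_J}\otimes T+(I_{\mathcal N_J}\otimes\Delta_T)\Big(I_{\mathcal N_J\otimes\mathcal H}-\sum_{i=1}^nW_i\otimes T_i^*\Big)^{-1}[W_1\otimes I_{\mathcal H},\ldots,W_n\otimes I_{\mathcal H}](I_{\mathcal N_J}\otimes\Delta_{T^*}).$$ Precisely, let $\Theta_T:F^2(H_n)\otimes\mathcal D_{T^*}\to F^2(H_n)\otimes\mathcal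 D_T$ be the characteristic function of $T$, i.e. the (contractive) operator satisfying $\Theta_T(S_i\otimes I)=(S_i\otimes I)\Theta_T$ for all $i$ whose formal Fourier representation is the same expression with $\mathcal N_J$ replaced by $F^2(H_n)$ and $W_i$ by $R_i$ (the inverse being expanded as a Neumann series); equivalently, $\Theta_T(1\otimes x)=-1\otimes Tx+\sum_{i=1}^n\sum_{\beta\in\mathbb F_n^+}e_i\otimes e_\beta\otimes\Delta_TT_\beta^*P_i\Delta_{T^*}x$ for $x\in\mathcal D_{T^*}$, where $P_i:\mathcal H^{(n)}\to\mathcal H$ is the $i$-th coordinate projection. Then $\Theta_{J,T}=P_{\mathcal N_J\otimes\mathcal D_T}\Theta_T|_{\mathcal N_J\otimes\mathcal D_{T^*}}$. *)

theory Defs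
  imports "HOL-Analysis.Analysis"
begin

section \<open>Complex Hilbert spaces\<close>

text \<open>
  The inner product is linear in the first argument.  The real structure
  (\<^const>\<open>scaleR\<close>, \<^const>\<open>inner\<close>, \<^const>\<open>norm\<close>, topology) is the one induced by the complex structure.
\<close>

class complex_inner = real_inner +
  fixes scaleC :: "complex \<Rightarrow> 'a \<Rightarrow> 'a" (infixr "*\<^sub>C" 75)
    and cinner :: "'a \<Rightarrow> 'a \<Rightarrow> complex"
  assumes scaleC_add_right: "c *\<^sub>C (x + y) = c *\<^sub>C x + c *\<^sub>C y"
    and scaleC_add_left: "(c + d) *\<^sub>C x = c *\<^sub>C x + d *\<^sub>C x"
    and scaleC_scaleC: "c *\<^sub>C (d *\<^sub>C x) = (c * d) *\<^sub>C x"
    and scaleR_scaleC: "r *\<^sub>R x = of_real r *\<^sub>C x"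
    and cinner_add_left: "cinner (x + y) z = cinner x z + cinner y z"
    and cinner_scaleC_left: "cinner (c *\<^sub>C x) y = c * cinner x y"
    and cinner_commute: "cinner x y = cnj (cinner y x)"
    and inner_cinner: "inner x y = Re (cinner x y)"

class chilbert = complex_inner + complete_space

subclass (in chilbert) banach ..

lemma scaleC_one: "1 *\<^sub>C (x :: 'a::complex_inner) = x"
  using scaleR_scaleC[of 1 x] by simp

global_interpretation complex_vector:
  vector_space "scaleC :: complex \<Rightarrow> 'a \<Rightarrow> 'a::complex_inner"
  by unfold_locales (auto simp: scaleC_add_right scaleC_add_left scaleC_scaleC scaleC_one)

lemma cinner_add_right: "cinner (x :: 'a::complex_inner) (y + z) = cinner x y + cinner x z"
  by (metis cinner_add_left cinner_commute complex_cnj_add)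

lemma cinner_scaleC_right: "cinner (x :: 'a::complex_inner) (c *\<^sub>C y) = cnj c * cinner x y"
  by (metis cinner_scaleC_left cinner_commute complex_cnj_mult)

lemma cinner_zero_left [simp]: "cinner (0 :: 'a::complex_inner) y = 0"
  using cinner_add_left[of "0::'a" 0 y] by simp

lemma cinner_zero_right [simp]: "cinner (x :: 'a::complex_inner) 0 = 0"
  using cinner_add_right[of x 0 0] by simp

lemma cinner_diff_left: "cinner (x - y) (z :: 'a::complex_inner) = cinner x z - cinner y z"
  using cinner_add_left[of "x - y" y z] by simp

lemma cinner_self: "cinner (x :: 'a::complex_inner) x = of_real ((norm x)\<^sup>2)"
proof -
  have "Im (cinner x x) = 0"
    using cinner_commute[of x x] by (metis Reals_cnj_iff complex_is_Real_iff)
  moreover have "Re (cinner x x) = (norm x)\<^sup>2"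
    by (simp add: power2_norm_eq_inner inner_cinner)
  ultimately show ?thesis
    by (simp add: complex_eq_iff)
qed

lemma norm_scaleC: "norm (c *\<^sub>C (x :: 'a::complex_inner)) = cmod c * norm x"
proof -
  have "complex_of_real ((norm (c *\<^sub>C x))\<^sup>2) = (c * cnj c) * of_real ((norm x)\<^sup>2)"
    unfolding cinner_self[symmetric] by (simp add: cinner_scaleC_left cinner_scaleC_right)
  also have "\<dots> = of_real ((cmod c * norm x)\<^sup>2)"
    by (simp add: complex_norm_square[symmetric] power_mult_distrib)
  finally have "(norm (c *\<^sub>C x))\<^sup>2 = (cmod c * norm x)\<^sup>2"
    using of_real_eq_iff by blast
  then show ?thesis
    by (simp add: power2_eq_iff_nonneg)
qed

lemma cmod_cinner_le: "cmod (cinner x (y :: 'a::complex_inner)) \<le> norm x * norm y"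
proof (cases "cinner x y = 0")
  case False
  define c where "c = cnj (sgn (cinner x y))"
  have c: "cmod c = 1" "c * cinner x y = of_real (cmod (cinner x y))"
  proof -
    show "cmod c = 1"
      using False by (simp add: c_def norm_sgn)
    show "c * cinner x y = of_real (cmod (cinner x y))"
      using False unfolding c_def sgn_eq
      by (simp add: field_simps complex_norm_square[symmetric] power2_eq_square)
  qed
  have "cmod (cinner x y) = Re (cinner (c *\<^sub>C x) y)"
    by (simp add: cinner_scaleC_left c)
  also have "\<dots> \<le> norm (c *\<^sub>C x) * norm y"
    unfolding inner_cinner[symmetric] by (rule norm_cauchy_schwarz)
  finally show ?thesis
    by (simp add: norm_scaleC c)
qed auto

instantiation complex :: chilbert
begin

definition "scaleC_complex (c :: complex) (x :: complex) = c * x"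
definition "cinner_complex (x :: complex) (y :: complex) = x * cnj y"

instance
  by standard (auto simp: scaleC_complex_def cinner_complex_def algebra_simps inner_complex_def
    scaleR_conv_of_real)

end

instantiation prod :: (complex_inner, complex_inner) complex_inner
begin

definition "scaleC_prod c x = (c *\<^sub>C fst x, c *\<^sub>C snd x)"
definition "cinner_prod x y = cinner (fst x) (fst y) + cinner (snd x) (snd y)"

instance
proof
  fix x y z :: "'a \<times> 'b"
  show "cinner x y = cnj (cinner y x)"
    by (simp add: cinner_prod_def cinner_commute[of "fst x"] cinner_commute[of "snd x"])
qed (auto simp: scaleC_prod_def cinner_prod_def scaleC_add_right scaleC_add_left scaleC_scaleC
    scaleR_prod_def scaleR_scaleC cinner_add_left cinner_scaleC_left inner_prod_def inner_cinner
    algebra_simps)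

end

instance prod :: (chilbert, chilbert) chilbert ..

instantiation vec :: (complex_inner, finite) complex_inner
begin

definition "scaleC_vec c x = (\<chi> i. c *\<^sub>C (x $ i))"
definition "cinner_vec x y = (\<Sum>i\<in>UNIV. cinner (x $ i) (y $ i))"

instance
proof
  fix x y z :: "'a ^ 'b"
  show "cinner x y = cnj (cinner y x)"
    by (simp add: cinner_vec_def cinner_commute[of "x $ _"])
qed (auto simp: scaleC_vec_def cinner_vec_def scaleC_add_right scaleC_add_left scaleC_scaleC
    scaleR_scaleC cinner_add_left cinner_scaleC_left inner_vec_def inner_cinner vec_eq_iff
    sum.distrib sum_distrib_left)

end

instance vec :: (chilbert, finite) chilbert ..


section \<open>Hilbert direct sums of copies of a Hilbert space\<close>

text \<open>
  \<open>('i, 'a) ell2\<close> is the Hilbert direct sum of copies of the Hilbert space \<^typ>\<open>'a\<close> indexed by \<^typ>\<open>'i\<close>,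
  i.e. the space of square summable families.
\<close>

typedef (overloaded) ('i, 'a) ell2 =
  "{f :: 'i \<Rightarrow> 'a::complex_inner. (\<lambda>i. (norm (f i))\<^sup>2) summable_on UNIV}"
  morphisms ell2_coeff Abs_ell2
  by (rule exI[of _ "\<lambda>_. 0"]) simp

lemma ell2_eqI: "(\<And>i. ell2_coeff x i = ell2_coeff y i) \<Longrightarrow> x = y"
  using ell2_coeff_inject by blast

lemma ell2_summable: "(\<lambda>i. (norm (ell2_coeff x i))\<^sup>2) summable_on UNIV"
  using ell2_coeff[of x] by simp

lemma ell2_coeff_Abs:
  "(\<lambda>i. (norm (f i))\<^sup>2) summable_on UNIV \<Longrightarrow> ell2_coeff (Abs_ell2 f) = f"
  by (simp add: Abs_ell2_inverse)

lemma square_summable_add: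
  fixes f g :: "'i \<Rightarrow> 'a::complex_inner"
  assumes "(\<lambda>i. (norm (f i))\<^sup>2) summable_on UNIV" "(\<lambda>i. (norm (g i))\<^sup>2) summable_on UNIV"
  shows "(\<lambda>i. (norm (f i + g i))\<^sup>2) summable_on UNIV"
proof (rule summable_on_comparison_test)
  show "(\<lambda>i. 2 * (norm (f i))\<^sup>2 + 2 * (norm (g i))\<^sup>2) summable_on UNIV"
    by (intro summable_on_add summable_on_cmult_right assms)
  fix i
  have "(norm (f i + g i))\<^sup>2 \<le> (norm (f i) + norm (g i))\<^sup>2"
    by (intro power_mono norm_triangle_ineq) auto
  also have "\<dots> \<le> 2 * (norm (f i))\<^sup>2 + 2 * (norm (g i))\<^sup>2"
    using sum_squares_bound[of "norm (f i)" "norm (g i)"] by (simp add: power2_sum)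
  finally show "(norm (f i + g i))\<^sup>2 \<le> 2 * (norm (f i))\<^sup>2 + 2 * (norm (g i))\<^sup>2" .
qed auto

lemma square_summable_scaleC:
  fixes f :: "'i \<Rightarrow> 'a::complex_inner"
  assumes "(\<lambda>i. (norm (f i))\<^sup>2) summable_on UNIV"
  shows "(\<lambda>i. (norm (c *\<^sub>C f i))\<^sup>2) summable_on UNIV"
  using summable_on_cmult_right[OF assms, of "(cmod c)\<^sup>2"]
  by (simp add: norm_scaleC power_mult_distrib)

lemma ell2_cinner_summable:
  "(\<lambda>i. cinner (ell2_coeff x i) (ell2_coeff y i)) summable_on UNIV"
proof -
  have "(\<lambda>i. (norm (ell2_coeff x i))\<^sup>2 + (norm (ell2_coeff y i))\<^sup>2) summable_on UNIV"
    by (intro summable_on_add ell2_summable)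
  then have "(\<lambda>i. cmod (cinner (ell2_coeff x i) (ell2_coeff y i))) summable_on UNIV"
  proof (rule summable_on_comparison_test)
    fix i
    have "0 \<le> norm (ell2_coeff x i) * norm (ell2_coeff y i)"
      by simp
    then show "cmod (cinner (ell2_coeff x i) (ell2_coeff y i))
        \<le> (norm (ell2_coeff x i))\<^sup>2 + (norm (ell2_coeff y i))\<^sup>2"
      using cmod_cinner_le[of "ell2_coeff x i" "ell2_coeff y i"]
        sum_squares_bound[of "norm (ell2_coeff x i)" "norm (ell2_coeff y i)"] by linarith
  qed auto
  then show ?thesis
    by (rule abs_summable_summable)
qed

instantiation ell2 :: (type, complex_inner) complex_inner
begin

definition "zero_ell2 = Abs_ell2 (\<lambda>_. 0)"
definition "plus_ell2 x y = Abs_ell2 (\<lambda>i. ell2_coeff x i + ell2_coeff y i)"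
definition "scaleC_ell2 c x = Abs_ell2 (\<lambda>i. c *\<^sub>C ell2_coeff x i)"
definition "scaleR_ell2 r x = complex_of_real r *\<^sub>C (x :: ('a, 'b) ell2)"
definition "uminus_ell2 x = (-1) *\<^sub>C (x :: ('a, 'b) ell2)"
definition "minus_ell2 x y = x + - (y :: ('a, 'b) ell2)"
definition "cinner_ell2 x y = (\<Sum>\<^sub>\<infinity>i. cinner (ell2_coeff x i) (ell2_coeff y i))"
definition "inner_ell2 x y = Re (cinner x (y :: ('a, 'b) ell2))"
definition "norm_ell2 x = sqrt (inner x (x :: ('a, 'b) ell2))"
definition "dist_ell2 x y = norm (x - y :: ('a, 'b) ell2)"
definition "sgn_ell2 x = inverse (norm x) *\<^sub>R (x :: ('a, 'b) ell2)"
definition [code del]: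
  "(uniformity :: (('a, 'b) ell2 \<times> ('a, 'b) ell2) filter)
    = (INF e\<in>{0 <..}. principal {(x, y). dist x y < e})"
definition [code del]:
  "open (U :: ('a, 'b) ell2 set)
    \<longleftrightarrow> (\<forall>x\<in>U. eventually (\<lambda>(x', y). x' = x \<longrightarrow> y \<in> U) uniformity)"

lemma ell2_coeff_zero [simp]: "ell2_coeff 0 i = 0"
  by (simp add: zero_ell2_def ell2_coeff_Abs)

lemma ell2_coeff_plus [simp]: "ell2_coeff (x + y) i = ell2_coeff x i + ell2_coeff y i"
  by (simp add: plus_ell2_def ell2_coeff_Abs square_summable_add ell2_summable)

lemma ell2_coeff_scaleC [simp]: "ell2_coeff (c *\<^sub>C x) i = c *\<^sub>C ell2_coeff x i"
  by (simp add: scaleC_ell2_def ell2_coeff_Abs square_summable_scaleC ell2_summable)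

lemma ell2_coeff_uminus [simp]: "ell2_coeff (- x) i = - ell2_coeff x i"
  by (simp add: uminus_ell2_def)

lemma ell2_coeff_minus [simp]: "ell2_coeff (x - y) i = ell2_coeff x i - ell2_coeff y i"
  by (simp add: minus_ell2_def)

lemma ell2_coeff_scaleR [simp]: "ell2_coeff (r *\<^sub>R x) i = r *\<^sub>R ell2_coeff x i"
  by (simp add: scaleR_ell2_def scaleR_scaleC)

lemma ell2_cinner_add_left: "cinner (x + y) z = cinner x z + cinner y (z :: ('a, 'b) ell2)"
  by (simp add: cinner_ell2_def cinner_add_left infsum_add ell2_cinner_summable)

lemma ell2_cinner_scaleC_left: "cinner (c *\<^sub>C x) z = c * cinner x (z :: ('a, 'b) ell2)"
  by (simp add: cinner_ell2_def cinner_scaleC_left infsum_cmult_right')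

lemma ell2_cinner_commute: "cinner x y = cnj (cinner y (x :: ('a, 'b) ell2))"
  unfolding cinner_ell2_def infsum_cnj[symmetric] cinner_commute[symmetric] ..

lemma ell2_inner_self: "inner x x = (\<Sum>\<^sub>\<infinity>i. (norm (ell2_coeff x i))\<^sup>2)"
  unfolding inner_ell2_def cinner_ell2_def
  by (subst infsum_Re[OF ell2_cinner_summable, symmetric]) (simp add: cinner_self)

instance
proof
  fix x y z :: "('a, 'b) ell2" and c d :: complex and r s :: real
  show "x + y + z = x + (y + z)" "x + y = y + x" "0 + x = x" "- x + x = 0" "x - y = x + - y"
    by (rule ell2_eqI; simp add: algebra_simps)+
  show "r *\<^sub>R (x + y) = r *\<^sub>R x + r *\<^sub>R y" "(r + s) *\<^sub>R x = r *\<^sub>R x + s *\<^sub>R x"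
    "r *\<^sub>R s *\<^sub>R x = (r * s) *\<^sub>R x" "1 *\<^sub>R x = x"
    by (rule ell2_eqI; simp add: algebra_simps)+
  show "c *\<^sub>C (x + y) = c *\<^sub>C x + c *\<^sub>C y" "(c + d) *\<^sub>C x = c *\<^sub>C x + d *\<^sub>C x"
    "c *\<^sub>C d *\<^sub>C x = (c * d) *\<^sub>C x" "r *\<^sub>R x = of_real r *\<^sub>C x"
    by (rule ell2_eqI; simp add: scaleC_add_right scaleC_add_left scaleC_scaleC scaleR_scaleC)+
  show "cinner (x + y) z = cinner x z + cinner y z" "cinner (c *\<^sub>C x) y = c * cinner x y"
    "cinner x y = cnj (cinner y x)" "inner x y = Re (cinner x y)"
    by (fact ell2_cinner_add_left ell2_cinner_scaleC_left ell2_cinner_commute inner_ell2_def)+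
  show "inner x y = inner y x"
    unfolding inner_ell2_def by (subst ell2_cinner_commute) simp
  show "inner (x + y) z = inner x z + inner y z"
    by (simp add: inner_ell2_def ell2_cinner_add_left)
  show "inner (r *\<^sub>R x) y = r * inner x y"
    by (simp add: inner_ell2_def scaleR_ell2_def ell2_cinner_scaleC_left)
  show "0 \<le> inner x x"
    by (simp add: ell2_inner_self infsum_nonneg)
  show "inner x x = 0 \<longleftrightarrow> x = 0"
  proof
    assume "inner x x = 0"
    then have "(norm (ell2_coeff x i))\<^sup>2 = 0" for i
      using nonneg_infsum_le_0D[OF _ ell2_summable[of x], of i] by (simp add: ell2_inner_self)
    then show "x = 0"
      by (intro ell2_eqI) simp
  qed (simp add: ell2_inner_self)
  show "norm x = sqrt (inner x x)" "dist x y = norm (x - y)" "sgn x = inverse (norm x) *\<^sub>R x"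
    by (fact norm_ell2_def dist_ell2_def sgn_ell2_def)+
qed (fact uniformity_ell2_def open_ell2_def)+

end

lemma norm_ell2_square: "(norm x)\<^sup>2 = (\<Sum>\<^sub>\<infinity>i. (norm (ell2_coeff x i))\<^sup>2)"
  by (simp add: power2_norm_eq_inner ell2_inner_self)

lemma sum_norm_ell2_coeff_le:
  assumes "finite A" shows "(\<Sum>i\<in>A. (norm (ell2_coeff x i))\<^sup>2) \<le> (norm x)\<^sup>2"
  unfolding norm_ell2_square by (rule finite_sum_le_infsum[OF ell2_summable assms]) auto

lemma norm_ell2_coeff_le: "norm (ell2_coeff x i) \<le> norm x"
  using sum_norm_ell2_coeff_le[of "{i}" x] by (simp add: power2_le_iff_abs_le)

lemma square_sum_bounded_ell2:
  fixes f :: "'i \<Rightarrow> 'a::complex_inner"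
  assumes "\<And>A. finite A \<Longrightarrow> (\<Sum>i\<in>A. (norm (f i))\<^sup>2) \<le> e\<^sup>2" and "0 \<le> e"
  shows "\<exists>x. ell2_coeff x = f \<and> norm x \<le> e"
proof -
  have s: "(\<lambda>i. (norm (f i))\<^sup>2) summable_on UNIV"
    by (rule nonneg_bdd_above_summable_on) (auto intro!: bdd_aboveI[of _ "e\<^sup>2"] assms)
  have "(norm (Abs_ell2 f))\<^sup>2 \<le> e\<^sup>2"
    unfolding norm_ell2_square ell2_coeff_Abs[OF s]
    by (rule infsum_le_finite_sums[OF s]) (auto intro: assms)
  then show ?thesis
    using s assms(2) by (intro exI[of _ "Abs_ell2 f"]) (simp add: ell2_coeff_Abs power2_le_iff_abs_le)
qed

instance ell2 :: (type, chilbert) chilbert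
proof
  fix X :: "nat \<Rightarrow> ('a, 'b) ell2"
  assume X: "Cauchy X"
  have "Cauchy (\<lambda>n. ell2_coeff (X n) i)" for i
  proof (rule CauchyI)
    fix e :: real assume "0 < e"
    then obtain M where "\<forall>m\<ge>M. \<forall>n\<ge>M. norm (X m - X n) < e"
      using CauchyD[OF X] by blast
    then show "\<exists>M. \<forall>m\<ge>M. \<forall>n\<ge>M. norm (ell2_coeff (X m) i - ell2_coeff (X n) i) < e"
      by (metis ell2_coeff_minus norm_ell2_coeff_le order_le_less_trans)
  qed
  then have "\<forall>i. \<exists>l. (\<lambda>n. ell2_coeff (X n) i) \<longlonglongrightarrow> l"
    using Cauchy_convergent convergent_def by blast
  then obtain g where g: "\<And>i. (\<lambda>n. ell2_coeff (X n) i) \<longlonglongrightarrow> g i"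
    by metis
  have ex: "\<exists>M. \<forall>m\<ge>M. \<exists>x. ell2_coeff x = (\<lambda>i. ell2_coeff (X m) i - g i) \<and> norm x \<le> e"
    if e: "0 < e" for e
  proof -
    obtain M where M: "\<And>m n. m \<ge> M \<Longrightarrow> n \<ge> M \<Longrightarrow> norm (X m - X n) < e"
      using CauchyD[OF X e] by blast
    show ?thesis
    proof (rule exI[of _ M], intro allI impI square_sum_bounded_ell2)
      fix m A assume m: "M \<le> m" and A: "finite (A :: 'a set)"
      have "(\<lambda>n. \<Sum>i\<in>A. (norm (ell2_coeff (X m) i - ell2_coeff (X n) i))\<^sup>2)
          \<longlonglongrightarrow> (\<Sum>i\<in>A. (norm (ell2_coeff (X m) i - g i))\<^sup>2)"
        by (intro tendsto_intros g)
      moreover have "(\<Sum>i\<in>A. (norm (ell2_coeff (X m) i - ell2_coeff (X n) i))\<^sup>2) \<le> e\<^sup>2"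
        if "M \<le> n" for n
      proof -
        have "(\<Sum>i\<in>A. (norm (ell2_coeff (X m - X n) i))\<^sup>2) \<le> (norm (X m - X n))\<^sup>2"
          by (rule sum_norm_ell2_coeff_le[OF A])
        also have "\<dots> \<le> e\<^sup>2"
          using M[OF m that] by (intro power_mono) auto
        finally show ?thesis by simp
      qed
      ultimately show "(\<Sum>i\<in>A. (norm (ell2_coeff (X m) i - g i))\<^sup>2) \<le> e\<^sup>2"
        by (meson LIMSEQ_le_const2)
    qed (use e in simp)
  qed
  obtain m x where x: "ell2_coeff x = (\<lambda>i. ell2_coeff (X m) i - g i)"
    using ex[of 1] by auto
  define l where "l = X m - x"
  have l: "ell2_coeff l i = g i" for i
    by (simp add: l_def x)
  have "X \<longlonglongrightarrow> l"
  proof (rule LIMSEQ_I)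
    fix e :: real assume "0 < e"
    then obtain M where M: "\<And>m. m \<ge> M \<Longrightarrow>
        \<exists>x. ell2_coeff x = (\<lambda>i. ell2_coeff (X m) i - g i) \<and> norm x \<le> e / 2"
      using ex[of "e / 2"] by auto
    have "norm (X n - l) < e" if "n \<ge> M" for n
    proof -
      obtain y where y: "ell2_coeff y = (\<lambda>i. ell2_coeff (X n) i - g i)" "norm y \<le> e / 2"
        using M \<open>n \<ge> M\<close> by blast
      have "X n - l = y"
        by (rule ell2_eqI) (simp add: y l)
      then show ?thesis
        using y \<open>0 < e\<close> by simp
    qed
    then show "\<exists>M. \<forall>n\<ge>M. norm (X n - l) < e"
      by blast
  qed
  then show "convergent X"
    by (auto simp: convergent_def)
qed


section \<open>Operators between closed subspaces\<close>

text \<open>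
  Hilbert spaces that arise as closed subspaces are represented by their carrier sets, whole spaces
  by \<^const>\<open>UNIV\<close>.  An operator from \<open>X\<close> to \<open>Y\<close> is a function on the ambient type of which only the
  values on \<open>X\<close> matter; operators selected by \<open>SOME\<close> below are unique on their domain.
\<close>

definition bounded_op :: "'a::complex_inner set \<Rightarrow> 'b::complex_inner set \<Rightarrow> ('a \<Rightarrow> 'b) \<Rightarrow> bool" where
  "bounded_op X Y A \<longleftrightarrow>
     (\<forall>x\<in>X. A x \<in> Y) \<and>
     (\<forall>x\<in>X. \<forall>y\<in>X. A (x + y) = A x + A y) \<and>
     (\<forall>c. \<forall>x\<in>X. A (c *\<^sub>C x) = c *\<^sub>C A x) \<and>
     (\<exists>K. \<forall>x\<in>X. norm (A x) \<le> K * norm x)"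

definition adj ::
  "'a::complex_inner set \<Rightarrow> 'b::complex_inner set \<Rightarrow> ('a \<Rightarrow> 'b) \<Rightarrow> ('b \<Rightarrow> 'a)" where
  "adj X Y A =
     (SOME B. bounded_op Y X B \<and> (\<forall>x\<in>X. \<forall>y\<in>Y. cinner (A x) y = cinner x (B y)))"

definition positive_op :: "'a::complex_inner set \<Rightarrow> ('a \<Rightarrow> 'a) \<Rightarrow> bool" where
  "positive_op X A \<longleftrightarrow> bounded_op X X A \<and> (\<forall>x\<in>X. cinner (A x) x \<in> \<real>\<^sub>\<ge>\<^sub>0)"

definition op_sqrt :: "'a::complex_inner set \<Rightarrow> ('a \<Rightarrow> 'a) \<Rightarrow> ('a \<Rightarrow> 'a)" where
  "op_sqrt X A = (SOME B. positive_op X B \<and> (\<forall>x\<in>X. B (B x) = A x))"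

definition ominus :: "'a::complex_inner set \<Rightarrow> 'a set \<Rightarrow> 'a set" (infixl "\<ominus>\<^sub>H" 65) where
  "X \<ominus>\<^sub>H Y = {x\<in>X. \<forall>y\<in>Y. cinner x y = 0}"

definition proj :: "'a::complex_inner set \<Rightarrow> 'a \<Rightarrow> 'a" where
  "proj X x = (SOME y. y \<in> X \<and> (\<forall>z\<in>X. cinner (x - y) z = 0))"

text \<open>In an orthogonal direct sum, the projection onto the first summand is \<^const>\<open>fst\<close>.\<close>

lemma proj_Times_zero:
  assumes "complex_vector.subspace X" "x \<in> X"
  shows "proj (X \<times> {0}) (x, y) = (x, 0)"
  unfolding proj_def
proof (rule some_equality)
  fix w assume w: "w \<in> X \<times> {0} \<and> (\<forall>z\<in>X \<times> {0}. cinner ((x, y) - w) z = 0)"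
  then obtain u where u: "w = (u, 0)" "u \<in> X" by auto
  have "(x - u, 0) \<in> X \<times> {0}"
    using complex_vector.subspace_diff[OF assms u(2)] by simp
  then have "cinner ((x, y) - w) (x - u, 0) = 0"
    using w by blast
  then have "cinner (x - u) (x - u) = 0"
    by (simp add: u cinner_prod_def)
  then show "w = (x, 0)"
    by (simp add: u cinner_self)
qed (use assms in \<open>auto simp: cinner_prod_def\<close>)

definition unitary_op :: "'a::complex_inner set \<Rightarrow> 'b::complex_inner set \<Rightarrow> ('a \<Rightarrow> 'b) \<Rightarrow> bool" where
  "unitary_op X Y U \<longleftrightarrow> bounded_op X Y U \<and> U ` X = Y \<and>
     (\<forall>x\<in>X. \<forall>y\<in>X. cinner (U x) (U y) = cinner x y)"

definition partial_isometry ::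
  "'a::complex_inner set \<Rightarrow> 'b::complex_inner set \<Rightarrow> ('a \<Rightarrow> 'b) \<Rightarrow> bool" where
  "partial_isometry X Y A \<longleftrightarrow> bounded_op X Y A \<and>
     (\<forall>x\<in>X \<ominus>\<^sub>H {z\<in>X. A z = 0}. norm (A x) = norm x)"


section \<open>The full Fock space\<close>

text \<open>
  The index set \<open>{1, \<dots>, n}\<close> is a finite type \<^typ>\<open>'n\<close> and words are lists over it.  As the
  \<open>e\<^sub>\<alpha>\<close> with \<open>\<alpha>\<close> of length \<open>k\<close> form an orthonormal basis of the \<open>k\<close>-th tensor power of \<open>H\<^sub>n\<close>,
  the Hilbert tensor product of \<open>F\<^sup>2(H\<^sub>n)\<close> with \<open>\<K>\<close> is the space of square summable
  \<open>\<K>\<close>-valued families indexed by words; \<open>F\<^sup>2(H\<^sub>n)\<close> itself is the case \<open>\<K> = \<complex>\<close>.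
\<close>

type_synonym ('n, 'a) fock = "('n list, 'a) ell2"

definition fock_basis :: "'n list \<Rightarrow> ('n, complex) fock" where
  "fock_basis \<alpha> = Abs_ell2 (\<lambda>\<beta>. if \<beta> = \<alpha> then 1 else 0)"

definition left_creation :: "'n \<Rightarrow> ('n, complex) fock \<Rightarrow> ('n, complex) fock" where
  "left_creation i \<phi> = Abs_ell2 (\<lambda>\<alpha>. case \<alpha> of [] \<Rightarrow> 0 | j # \<beta> \<Rightarrow> if j = i then ell2_coeff \<phi> \<beta> else 0)"

definition tensor :: "('n, complex) fock \<Rightarrow> 'a::complex_inner \<Rightarrow> ('n, 'a) fock" (infixr "\<otimes>\<^sub>t" 70) where
  "x \<otimes>\<^sub>t h = Abs_ell2 (\<lambda>\<alpha>. ell2_coeff x \<alpha> *\<^sub>C h)"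

lemma ell2_coeff_fock_basis: "ell2_coeff (fock_basis \<alpha>) \<beta> = (if \<beta> = \<alpha> then 1 else 0)"
proof -
  have "(\<lambda>\<beta>. (norm (if \<beta> = \<alpha> then 1 else 0 :: complex))\<^sup>2) summable_on UNIV"
    by (rule finite_nonzero_values_imp_summable_on) (rule finite_subset[of _ "{\<alpha>}"], auto)
  then show ?thesis
    by (simp add: fock_basis_def ell2_coeff_Abs)
qed

lemma ell2_coeff_left_creation:
  "ell2_coeff (left_creation i \<phi>) \<alpha> =
     (case \<alpha> of [] \<Rightarrow> 0 | j # \<beta> \<Rightarrow> if j = i then ell2_coeff \<phi> \<beta> else 0)"
proof -
  define f where
    "f = (\<lambda>\<alpha>. case \<alpha> of [] \<Rightarrow> 0 | j # \<beta> \<Rightarrow> if j = i then ell2_coeff \<phi> \<beta> else 0)"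
  have "(\<lambda>\<alpha>. (norm (f \<alpha>))\<^sup>2) summable_on range ((#) i)"
    by (subst summable_on_reindex) (auto simp: o_def f_def ell2_summable)
  then have "(\<lambda>\<alpha>. (norm (f \<alpha>))\<^sup>2) summable_on UNIV"
    by (rule summable_on_cong_neutral[THEN iffD1, rotated -1])
      (auto simp: f_def image_iff split: list.splits)
  then show ?thesis
    by (simp add: left_creation_def ell2_coeff_Abs flip: f_def)
qed

lemma left_creation_fock_basis: "left_creation i (fock_basis \<alpha>) = fock_basis (i # \<alpha>)"
  by (rule ell2_eqI) (auto simp: ell2_coeff_left_creation ell2_coeff_fock_basis split: list.splits)

lemma ell2_coeff_tensor: "ell2_coeff (x \<otimes>\<^sub>t h) \<alpha> = ell2_coeff x \<alpha> *\<^sub>C h"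
proof -
  have "(\<lambda>\<alpha>. (norm (ell2_coeff x \<alpha> *\<^sub>C h))\<^sup>2) summable_on UNIV"
    using summable_on_cmult_left[OF ell2_summable[of x], of "(norm h)\<^sup>2"]
    by (simp add: norm_scaleC power_mult_distrib)
  then show ?thesis
    by (simp add: tensor_def ell2_coeff_Abs)
qed

text \<open>
  The next two facts characterise the Hilbert space tensor product of \<open>F\<^sup>2(H\<^sub>n)\<close> with a Hilbert space.
\<close>

lemma cinner_tensor: "cinner (x \<otimes>\<^sub>t h) (y \<otimes>\<^sub>t k) = cinner x y * cinner h k"
proof -
  have "cinner (x \<otimes>\<^sub>t h) (y \<otimes>\<^sub>t k)
      = (\<Sum>\<^sub>\<infinity>\<alpha>. ell2_coeff x \<alpha> * cnj (ell2_coeff y \<alpha>) * cinner h k)"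
    by (simp add: cinner_ell2_def ell2_coeff_tensor cinner_scaleC_left cinner_scaleC_right ac_simps)
  also have "\<dots> = cinner x y * cinner h k"
    by (simp add: cinner_ell2_def cinner_complex_def infsum_cmult_left')
  finally show ?thesis .
qed

text \<open>For subspaces \<open>N\<close> and \<open>K\<close>, the tensor product is the closed span of the elementary tensors.\<close>

definition tensor_space ::
  "('n, complex) fock set \<Rightarrow> 'a::complex_inner set \<Rightarrow> ('n, 'a) fock set" (infixr "\<otimes>\<^sub>s" 70) where
  "N \<otimes>\<^sub>s K = closure (complex_vector.span {x \<otimes>\<^sub>t h |x h. x \<in> N \<and> h \<in> K})"

lemma tensor_space_UNIV: "(UNIV :: ('n, complex) fock set) \<otimes>\<^sub>s (UNIV :: 'a::complex_inner set) = UNIV"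
proof -
  have "z \<in> UNIV \<otimes>\<^sub>s UNIV" for z :: "('n, 'a) fock"
    unfolding tensor_space_def closure_approachable
  proof (intro allI impI)
    fix e :: real assume e: "0 < e"
    let ?f = "\<lambda>\<alpha>. (norm (ell2_coeff z \<alpha>))\<^sup>2"
    have sum: "(?f has_sum (norm z)\<^sup>2) UNIV"
      using has_sum_infsum[OF ell2_summable[of z]] by (simp add: norm_ell2_square)
    obtain A where A: "finite A" "dist (sum ?f A) ((norm z)\<^sup>2) \<le> e\<^sup>2 / 2"
      using has_sum_finite_approximation[OF sum, of "e\<^sup>2 / 2"] e by auto
    define y where "y = (\<Sum>\<alpha>\<in>A. fock_basis \<alpha> \<otimes>\<^sub>t ell2_coeff z \<alpha>)"
    have coeff_sum: "ell2_coeff (sum u A) \<beta> = (\<Sum>\<alpha>\<in>A. ell2_coeff (u \<alpha>) \<beta>)"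
      for u :: "'n list \<Rightarrow> ('n, 'a) fock" and \<beta>
      by (induction A rule: infinite_finite_induct) auto
    have y: "ell2_coeff y \<beta> = (if \<beta> \<in> A then ell2_coeff z \<beta> else 0)" for \<beta>
    proof -
      have "ell2_coeff y \<beta> = (\<Sum>\<alpha>\<in>A. if \<beta> = \<alpha> then ell2_coeff z \<alpha> else 0)"
        unfolding y_def coeff_sum
        by (intro sum.cong) (auto simp: ell2_coeff_tensor ell2_coeff_fock_basis scaleC_one)
      then show ?thesis
        using A(1) by simp
    qed
    have "(?f has_sum (sum ?f A)) A"
      using A(1) by simp
    with sum have "(?f has_sum ((norm z)\<^sup>2 - sum ?f A)) (UNIV - A)"
      by (intro has_sum_Diff) auto
    then have "((\<lambda>\<beta>. (norm (ell2_coeff (y - z) \<beta>))\<^sup>2) has_sum ((norm z)\<^sup>2 - sum ?f A)) UNIV"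
      by (rule has_sum_cong_neutral[THEN iffD1, rotated -1]) (auto simp: y)
    then have "(norm (y - z))\<^sup>2 = (norm z)\<^sup>2 - sum ?f A"
      by (simp add: norm_ell2_square infsumI)
    also have "\<dots> < e\<^sup>2"
      using A(2) e by (simp add: dist_real_def abs_le_iff) (smt (verit) zero_less_power)
    finally have "dist y z < e"
      using e by (simp add: dist_norm power2_less_imp_less)
    moreover have "y \<in> complex_vector.span {x \<otimes>\<^sub>t h |x h. x \<in> UNIV \<and> h \<in> UNIV}"
      unfolding y_def by (intro complex_vector.span_sum complex_vector.span_base) auto
    ultimately show "\<exists>y\<in>complex_vector.span {x \<otimes>\<^sub>t h |x h. x \<in> UNIV \<and> h \<in> UNIV}. dist y z < e"
      by blast
  qed
  then show ?thesis by auto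
qed

text \<open>The operator \<open>A \<otimes> I\<close> on \<open>N \<otimes> K\<close>, for an operator \<open>A\<close> on \<open>N\<close>.\<close>

definition ampliation ::
  "('n, complex) fock set \<Rightarrow> 'a::complex_inner set \<Rightarrow> (('n, complex) fock \<Rightarrow> ('n, complex) fock)
    \<Rightarrow> ('n, 'a) fock \<Rightarrow> ('n, 'a) fock" where
  "ampliation N K A =
     (SOME M. bounded_op (N \<otimes>\<^sub>s K) (N \<otimes>\<^sub>s K) M \<and> (\<forall>x\<in>N. \<forall>h\<in>K. M (x \<otimes>\<^sub>t h) = A x \<otimes>\<^sub>t h))"


section \<open>The noncommutative analytic Toeplitz algebra and its ideals\<close>

definition wot :: "('a::complex_inner \<Rightarrow> 'a) topology" where
  "wot = pullback_topology {A. bounded_op UNIV UNIV A} (\<lambda>A (x, y). cinner (A x) y) euclidean"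

definition unital_operator_algebra :: "('a::complex_inner \<Rightarrow> 'a) set \<Rightarrow> bool" where
  "unital_operator_algebra \<A> \<longleftrightarrow>
     (\<forall>A\<in>\<A>. bounded_op UNIV UNIV A) \<and> id \<in> \<A> \<and>
     (\<forall>A\<in>\<A>. \<forall>B\<in>\<A>. (\<lambda>x. A x + B x) \<in> \<A> \<and> A \<circ> B \<in> \<A>) \<and>
     (\<forall>c. \<forall>A\<in>\<A>. (\<lambda>x. c *\<^sub>C A x) \<in> \<A>)"

definition nc_toeplitz :: "(('n, complex) fock \<Rightarrow> ('n, complex) fock) set" where
  "nc_toeplitz =
     \<Inter> {\<A>. unital_operator_algebra \<A> \<and> range left_creation \<subseteq> \<A> \<and> closedin wot \<A>}"

definition wot_closed_ideal :: "(('n, complex) fock \<Rightarrow> ('n, complex) fock) set \<Rightarrow> bool" where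
  "wot_closed_ideal J \<longleftrightarrow>
     J \<subseteq> nc_toeplitz \<and> closedin wot J \<and> (\<lambda>_. 0) \<in> J \<and>
     (\<forall>\<phi>\<in>J. \<forall>\<psi>\<in>J. (\<lambda>x. \<phi> x + \<psi> x) \<in> J) \<and> (\<forall>c. \<forall>\<phi>\<in>J. (\<lambda>x. c *\<^sub>C \<phi> x) \<in> J) \<and>
     (\<forall>\<phi>\<in>J. \<forall>A\<in>nc_toeplitz. A \<circ> \<phi> \<in> J \<and> \<phi> \<circ> A \<in> J)"

definition fourier_coeff :: "(('n, complex) fock \<Rightarrow> ('n, complex) fock) \<Rightarrow> 'n list \<Rightarrow> complex" where
  "fourier_coeff f \<alpha> = ell2_coeff (f (fock_basis [])) \<alpha>"

definition M_space :: "(('n, complex) fock \<Rightarrow> ('n, complex) fock) set \<Rightarrow> ('n, complex) fock set" where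
  "M_space J = closure (complex_vector.span {\<phi> f |\<phi> f. \<phi> \<in> J})"

definition N_space :: "(('n, complex) fock \<Rightarrow> ('n, complex) fock) set \<Rightarrow> ('n, complex) fock set" where
  "N_space J = UNIV \<ominus>\<^sub>H M_space J"

definition constrained_creation ::
  "(('n, complex) fock \<Rightarrow> ('n, complex) fock) set \<Rightarrow> 'n \<Rightarrow> ('n, complex) fock \<Rightarrow> ('n, complex) fock" where
  "constrained_creation J i x = proj (N_space J) (left_creation i x)"


section \<open>Row contractions\<close>

primrec word_op :: "('n \<Rightarrow> 'a \<Rightarrow> 'a) \<Rightarrow> 'n list \<Rightarrow> 'a \<Rightarrow> 'a" where
  "word_op T [] = id"
| "word_op T (i # \<alpha>) = T i \<circ> word_op T \<alpha>"

definition row_contraction :: "'a::complex_inner set \<Rightarrow> ('n::finite \<Rightarrow> 'a \<Rightarrow> 'a) \<Rightarrow> bool" where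
  "row_contraction X T \<longleftrightarrow> (\<forall>i. bounded_op X X (T i)) \<and>
     positive_op X (\<lambda>x. x - (\<Sum>i\<in>UNIV. T i (adj X X (T i) x)))"

definition pure :: "'a::complex_inner set \<Rightarrow> ('n::finite \<Rightarrow> 'a \<Rightarrow> 'a) \<Rightarrow> bool" where
  "pure X T \<longleftrightarrow>
     (\<forall>x\<in>X. (\<lambda>k. \<Sum>\<alpha> | length \<alpha> = k. word_op T \<alpha> (adj X X (word_op T \<alpha>) x)) \<longlonglongrightarrow> 0)"

definition cnc :: "'a::complex_inner set \<Rightarrow> ('n::finite \<Rightarrow> 'a \<Rightarrow> 'a) \<Rightarrow> bool" where
  "cnc X T \<longleftrightarrow>
     \<not> (\<exists>h\<in>X. h \<noteq> 0 \<and>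
          (\<forall>k\<ge>1. (\<Sum>\<alpha> | length \<alpha> = k. (norm (adj X X (word_op T \<alpha>) h))\<^sup>2) = (norm h)\<^sup>2))"

text \<open>\<open>has_fcalc X T f A\<close> says that the limit \<open>f(T\<^sub>1, \<dots>, T\<^sub>n)\<close> in the strong operator topology exists and equals \<open>A\<close>.\<close>

definition has_fcalc ::
  "'a::complex_inner set \<Rightarrow> ('n::finite \<Rightarrow> 'a \<Rightarrow> 'a) \<Rightarrow> (('n, complex) fock \<Rightarrow> ('n, complex) fock)
    \<Rightarrow> ('a \<Rightarrow> 'a) \<Rightarrow> bool" where
  "has_fcalc X T f A \<longleftrightarrow>
     (\<forall>x\<in>X. ((\<lambda>r. \<Sum>k. \<Sum>\<alpha> | length \<alpha> = k.
                 (of_real (r ^ length \<alpha>) * fourier_coeff f \<alpha>) *\<^sub>C word_op T \<alpha> x)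
               \<longlongrightarrow> A x) (at_left (1 :: real)))"

definition constrained_row_contraction ::
  "(('n, complex) fock \<Rightarrow> ('n, complex) fock) set \<Rightarrow> 'a::complex_inner set
    \<Rightarrow> ('n::finite \<Rightarrow> 'a \<Rightarrow> 'a) \<Rightarrow> bool" where
  "constrained_row_contraction J X T \<longleftrightarrow>
     row_contraction X T \<and> cnc X T \<and> (\<forall>\<phi>\<in>J. has_fcalc X T \<phi> (\<lambda>_. 0))"

definition unitarily_equivalent ::
  "'a::complex_inner set \<Rightarrow> ('n \<Rightarrow> 'a \<Rightarrow> 'a) \<Rightarrow> 'b::complex_inner set \<Rightarrow> ('n \<Rightarrow> 'b \<Rightarrow> 'b) \<Rightarrow> bool" where
  "unitarily_equivalent X T Y T' \<longleftrightarrow>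
     (\<exists>U. unitary_op X Y U \<and> (\<forall>i. \<forall>x\<in>X. U (T i x) = T' i (U x)))"

definition row_op :: "('n::finite \<Rightarrow> 'a::complex_inner \<Rightarrow> 'a) \<Rightarrow> 'a ^ 'n \<Rightarrow> 'a" where
  "row_op T v = (\<Sum>i\<in>UNIV. T i (v $ i))"

definition Delta :: "('n::finite \<Rightarrow> 'a::complex_inner \<Rightarrow> 'a) \<Rightarrow> 'a \<Rightarrow> 'a" where
  "Delta T = op_sqrt UNIV (\<lambda>h. h - (\<Sum>i\<in>UNIV. T i (adj UNIV UNIV (T i) h)))"

definition Delta_star :: "('n::finite \<Rightarrow> 'a::complex_inner \<Rightarrow> 'a) \<Rightarrow> 'a ^ 'n \<Rightarrow> 'a ^ 'n" where
  "Delta_star T = op_sqrt UNIV (\<lambda>v. v - adj UNIV UNIV (row_op T) (row_op T v))"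

definition defect :: "('n::finite \<Rightarrow> 'a::complex_inner \<Rightarrow> 'a) \<Rightarrow> 'a set" where
  "defect T = closure (range (Delta T))"

definition defect_star :: "('n::finite \<Rightarrow> 'a::complex_inner \<Rightarrow> 'a) \<Rightarrow> ('a ^ 'n) set" where
  "defect_star T = closure (range (Delta_star T))"


section \<open>Characteristic functions\<close>

text \<open>
  The formula for \<open>\<Theta>\<^sub>T(1 \<otimes> x)\<close> is the Neumann expansion of the formal Fourier representation applied
  to \<open>1 \<otimes> x\<close>; together with the intertwining relation it determines \<open>\<Theta>\<^sub>T\<close>.
\<close>

definition char_fun ::
  "('n::finite \<Rightarrow> 'a::complex_inner \<Rightarrow> 'a) \<Rightarrow> ('n, 'a ^ 'n) fock \<Rightarrow> ('n, 'a) fock" where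
  "char_fun T =
     (SOME \<Theta>. bounded_op (UNIV \<otimes>\<^sub>s defect_star T) (UNIV \<otimes>\<^sub>s defect T) \<Theta> \<and>
        (\<forall>i. \<forall>f\<in>UNIV \<otimes>\<^sub>s defect_star T.
           \<Theta> (ampliation UNIV (defect_star T) (left_creation i) f)
             = ampliation UNIV (defect T) (left_creation i) (\<Theta> f)) \<and>
        (\<forall>x\<in>defect_star T.
           \<Theta> (fock_basis [] \<otimes>\<^sub>t x) =
             - (fock_basis [] \<otimes>\<^sub>t row_op T x)
             + (\<Sum>i\<in>UNIV. \<Sum>\<^sub>\<infinity>\<beta>. fock_basis (i # \<beta>) \<otimes>\<^sub>t
                  Delta T (adj UNIV UNIV (word_op T \<beta>) (Delta_star T x $ i)))))"

definition constrained_char_fun ::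
  "(('n::finite, complex) fock \<Rightarrow> ('n, complex) fock) set \<Rightarrow> ('n \<Rightarrow> 'a::complex_inner \<Rightarrow> 'a)
    \<Rightarrow> ('n, 'a ^ 'n) fock \<Rightarrow> ('n, 'a) fock" where
  "constrained_char_fun J T f = proj (N_space J \<otimes>\<^sub>s defect T) (char_fun T f)"

definition constrained_Delta ::
  "(('n::finite, complex) fock \<Rightarrow> ('n, complex) fock) set \<Rightarrow> ('n \<Rightarrow> 'a::complex_inner \<Rightarrow> 'a)
    \<Rightarrow> ('n, 'a ^ 'n) fock \<Rightarrow> ('n, 'a ^ 'n) fock" where
  "constrained_Delta J T =
     op_sqrt (N_space J \<otimes>\<^sub>s defect_star T)
       (\<lambda>f. f - adj (N_space J \<otimes>\<^sub>s defect_star T) (N_space J \<otimes>\<^sub>s defect T) (constrained_char_fun J T)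
                  (constrained_char_fun J T f))"

definition multi_analytic ::
  "(('n, complex) fock \<Rightarrow> ('n, complex) fock) set \<Rightarrow> 'a::complex_inner set \<Rightarrow> 'b::complex_inner set
    \<Rightarrow> (('n, 'a) fock \<Rightarrow> ('n, 'b) fock) \<Rightarrow> bool" where
  "multi_analytic J K K' M \<longleftrightarrow>
     bounded_op (N_space J \<otimes>\<^sub>s K) (N_space J \<otimes>\<^sub>s K') M \<and>
     (\<forall>i. \<forall>f\<in>N_space J \<otimes>\<^sub>s K.
        M (ampliation (N_space J) K (constrained_creation J i) f)
          = ampliation (N_space J) K' (constrained_creation J i) (M f))"

definition inner_multi_analytic ::
  "(('n, complex) fock \<Rightarrow> ('n, complex) fock) set \<Rightarrow> 'a::complex_inner set \<Rightarrow> 'b::complex_inner set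
    \<Rightarrow> (('n, 'a) fock \<Rightarrow> ('n, 'b) fock) \<Rightarrow> bool" where
  "inner_multi_analytic J K K' M \<longleftrightarrow>
     multi_analytic J K K' M \<and> partial_isometry (N_space J \<otimes>\<^sub>s K) (N_space J \<otimes>\<^sub>s K') M"


section \<open>Model spaces\<close>

definition model_space ::
  "(('n::finite, complex) fock \<Rightarrow> ('n, complex) fock) set \<Rightarrow> ('n \<Rightarrow> 'a::complex_inner \<Rightarrow> 'a)
    \<Rightarrow> (('n, 'a) fock \<times> ('n, 'a ^ 'n) fock) set" where
  "model_space J T =
     ((N_space J \<otimes>\<^sub>s defect T) \<times> closure (constrained_Delta J T ` (N_space J \<otimes>\<^sub>s defect_star T)))
     \<ominus>\<^sub>H {(constrained_char_fun J T f, constrained_Delta J T f) |f. f \<in> N_space J \<otimes>\<^sub>s defect_star T}"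

definition pure_model_space ::
  "(('n::finite, complex) fock \<Rightarrow> ('n, complex) fock) set \<Rightarrow> ('n \<Rightarrow> 'a::complex_inner \<Rightarrow> 'a)
    \<Rightarrow> ('n, 'a) fock set" where
  "pure_model_space J T =
     (N_space J \<otimes>\<^sub>s defect T) \<ominus>\<^sub>H (constrained_char_fun J T ` (N_space J \<otimes>\<^sub>s defect_star T))"

text \<open>
  The relation which determines \<open>\<T>\<^sub>i\<close>; the projection onto the first summand of the direct sum is
  \<^const>\<open>fst\<close>, cf. \<open>proj_Times_zero\<close>.
\<close>

definition model_relation ::
  "(('n::finite, complex) fock \<Rightarrow> ('n, complex) fock) set \<Rightarrow> ('n \<Rightarrow> 'a::complex_inner \<Rightarrow> 'a) \<Rightarrow> 'n
    \<Rightarrow> (('n, 'a) fock \<times> ('n, 'a ^ 'n) fock \<Rightarrow> ('n, 'a) fock \<times> ('n, 'a ^ 'n) fock) \<Rightarrow> bool" where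
  "model_relation J T i A \<longleftrightarrow>
     (\<forall>x\<in>model_space J T.
        fst (adj (model_space J T) (model_space J T) A x)
          = ampliation (N_space J) (defect T)
              (adj (N_space J) (N_space J) (constrained_creation J i)) (fst x))"

end

theory Submission
  imports Defs
begin

text \<open>
  Let \<open>K h = \<Sum>\<^sub>\<alpha> e\<^sub>\<alpha> \<otimes> \<Delta>\<^sub>T T\<^sub>\<alpha>\<^sup>* h\<close> be the Poisson kernel of \<open>T\<close>.  Since the operator matrix with rows
  \<open>(T\<^sup>*, \<Delta>\<^sub>T\<^sub>*)\<close> and \<open>(\<Delta>\<^sub>T, -T)\<close> is unitary, an energy balance along the words gives
  \<open>K K\<^sup>* + \<Theta>\<^sub>T \<Theta>\<^sub>T\<^sup>* = I\<close>.  The functional calculus places the range of \<open>K\<close> in \<open>N\<^sub>J \<otimes> D\<^sub>T\<close>, and as \<open>J\<close> is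
  an ideal, \<open>\<Theta>\<^sub>T\<^sup>*\<close> maps \<open>N\<^sub>J \<otimes> D\<^sub>T\<close> into \<open>N\<^sub>J \<otimes> D\<^sub>T\<^sub>*\<close>; hence \<open>K K\<^sup>* + \<Theta> \<Theta>\<^sup>* = I\<close> on \<open>N\<^sub>J \<otimes> D\<^sub>T\<close> for the
  constrained characteristic function \<open>\<Theta>\<close>.  The operator \<open>g \<mapsto> (g - \<Theta> \<Theta>\<^sup>* g) \<oplus> (- \<Delta> \<Theta>\<^sup>* g)\<close> is the
  compression of \<open>g \<mapsto> g \<oplus> 0\<close> to the model space and has the same Gram matrix as \<open>K\<^sup>*\<close>.  Both have dense
  range, because \<open>T\<close> is completely non-coisometric, i.e. \<open>K\<close> is injective, and the resulting unitary
  \<open>U\<close> satisfies \<open>fst (U h) = K h\<close>.  Finally \<open>T\<close> is pure iff \<open>K\<close> is isometric iff \<open>K K\<^sup>*\<close> is a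
  projection iff \<open>\<Theta>\<close> is a partial isometry, and then the range of \<open>K\<close> is the complement of the range
  of \<open>\<Theta>\<close>.
\<close>

section \<open>Hilbert spaces\<close>

text \<open>The identities along words are telescoped norm balances, and the remainder at level
  \<open>N\<close> decides what survives. For the kernel it is the sum of the squared norms of
  \<open>Tw \<alpha> h\<close> over words of length \<open>N\<close>, which converges but need not
  vanish; its vanishing is purity. For the adjoints it is dominated by the tail of the convergent
  series for the squared norm of \<open>y\<close> and always vanishes. Hence the exact identity is
  proved for \<open>Ka\<close> and \<open>Ca\<close>, while \<open>char_op\<close> is only shown to
  be contractive; complex quadratic forms determine operators, so it becomes an operator identity.
  Square roots and the characteristic function are chosen by \<open>SOME\<close>. The former need a
  uniqueness proof and a construction that respects intertwining, whence an explicit iteration; the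
  latter needs an explicit candidate, supplied by a state recursion. Both sides of the ideal matter:
  multiplication by S_i on the left makes the complement of \<open>M\<close> invariant under the
  backward shifts, multiplication by S_\<alpha> on the right carries information at the vacuum
  vector to every basis vector.\<close>

lemma bounded_bilinear_cinner:
  "bounded_bilinear (cinner :: 'a::complex_inner \<Rightarrow> 'a \<Rightarrow> complex)"
proof
  fix r :: real and x y :: 'a
  show "cinner (r *\<^sub>R x) y = r *\<^sub>R cinner x y" "cinner x (r *\<^sub>R y) = r *\<^sub>R cinner x y"
    by (simp_all add: scaleR_scaleC cinner_scaleC_left cinner_scaleC_right scaleR_conv_of_real scaleC_complex_def)
  show "\<exists>K. \<forall>a b :: 'a. norm (cinner a b) \<le> norm a * norm b * K"
    by (rule exI[of _ 1]) (simp add: cmod_cinner_le)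
qed (simp_all add: cinner_add_left cinner_add_right)

interpretation cinner: bounded_bilinear "cinner :: 'a::complex_inner \<Rightarrow> 'a \<Rightarrow> complex"
  by (rule bounded_bilinear_cinner)

lemma bounded_bilinear_scaleC:
  "bounded_bilinear (scaleC :: complex \<Rightarrow> 'a \<Rightarrow> 'a::complex_inner)"
proof
  fix r :: real and c :: complex and x :: 'a
  show "(r *\<^sub>R c) *\<^sub>C x = r *\<^sub>R c *\<^sub>C x" "c *\<^sub>C r *\<^sub>R x = r *\<^sub>R c *\<^sub>C x"
    by (simp_all add: scaleR_scaleC scaleC_scaleC scaleR_conv_of_real scaleC_complex_def mult.commute)
  show "\<exists>K. \<forall>a. \<forall>b :: 'a. norm (a *\<^sub>C b) \<le> norm a * norm b * K"
    by (rule exI[of _ 1]) (simp add: norm_scaleC)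
qed (simp_all add: scaleC_add_left scaleC_add_right)

interpretation scaleC: bounded_bilinear "scaleC :: complex \<Rightarrow> 'a \<Rightarrow> 'a::complex_inner"
  by (rule bounded_bilinear_scaleC)

lemma Re_cinner_self: "Re (cinner x x) = (norm (x :: 'a::complex_inner))\<^sup>2"
  by (simp add: cinner_self)

lemma norm_diff_square:
  "(norm (x - y :: 'a::complex_inner))\<^sup>2 = (norm x)\<^sup>2 - 2 * Re (cinner x y) + (norm y)\<^sup>2"
  by (simp add: power2_norm_eq_inner inner_diff_left inner_diff_right inner_commute[of y x] inner_cinner[of x y])

lemma norm_add_square:
  "(norm (x + y :: 'a::complex_inner))\<^sup>2 = (norm x)\<^sup>2 + 2 * Re (cinner x y) + (norm y)\<^sup>2"
  by (simp add: power2_norm_eq_inner inner_add_left inner_add_right inner_commute[of y x] inner_cinner[of x y])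

definition hilbert_subspace :: "'a::chilbert set \<Rightarrow> bool" where
  "hilbert_subspace X \<longleftrightarrow> complex_vector.subspace X \<and> closed X"

lemma hilbert_UNIV [simp]: "hilbert_subspace UNIV"
  by (simp add: hilbert_subspace_def)

context
  fixes X :: "'a::chilbert set"
  assumes X: "hilbert_subspace X"
begin

lemma hilbert_0: "0 \<in> X"
  using X complex_vector.subspace_0 by (auto simp: hilbert_subspace_def)

lemma hilbert_add: "x \<in> X \<Longrightarrow> y \<in> X \<Longrightarrow> x + y \<in> X"
  using X complex_vector.subspace_add by (auto simp: hilbert_subspace_def)

lemma hilbert_diff: "x \<in> X \<Longrightarrow> y \<in> X \<Longrightarrow> x - y \<in> X"
  using X complex_vector.subspace_diff by (auto simp: hilbert_subspace_def)

lemma hilbert_neg: "x \<in> X \<Longrightarrow> - x \<in> X"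
  using X complex_vector.subspace_neg by (auto simp: hilbert_subspace_def)

lemma hilbert_scaleC: "x \<in> X \<Longrightarrow> c *\<^sub>C x \<in> X"
  using X complex_vector.subspace_scale by (auto simp: hilbert_subspace_def)

lemma hilbert_scaleR: "x \<in> X \<Longrightarrow> r *\<^sub>R x \<in> X"
  by (simp add: scaleR_scaleC hilbert_scaleC)

lemma hilbert_sum: "(\<And>i. i \<in> I \<Longrightarrow> f i \<in> X) \<Longrightarrow> sum f I \<in> X"
  using X complex_vector.subspace_sum by (auto simp: hilbert_subspace_def)

lemma hilbert_limit:
  "f \<longlonglongrightarrow> l \<Longrightarrow> (\<And>n. f n \<in> X) \<Longrightarrow> l \<in> X" for f :: "nat \<Rightarrow> 'a"
  using X closed_sequentially by (auto simp: hilbert_subspace_def)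

end

lemmas hilbert_intros =
  hilbert_0 hilbert_add hilbert_diff hilbert_neg
  hilbert_scaleC hilbert_scaleR hilbert_sum

lemma closure_subspace:
  fixes S :: "'a::complex_inner set"
  assumes "complex_vector.subspace S"
  shows "complex_vector.subspace (closure S)"
proof (rule complex_vector.subspaceI)
  show "0 \<in> closure S"
    using complex_vector.subspace_0[OF assms] closure_subset by blast
next
  fix x y assume "x \<in> closure S" "y \<in> closure S"
  then obtain a b where "\<forall>n. a n \<in> S" "a \<longlonglongrightarrow> x" "\<forall>n. b n \<in> S" "b \<longlonglongrightarrow> y"
    unfolding closure_sequential by blast
  then show "x + y \<in> closure S"
    unfolding closure_sequential using complex_vector.subspace_add[OF assms]
    by (intro exI[of _ "\<lambda>n. a n + b n"]) (simp add: tendsto_add)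
next
  fix c x assume "x \<in> closure S"
  then obtain a where "\<forall>n. a n \<in> S" "a \<longlonglongrightarrow> x"
    unfolding closure_sequential by blast
  then show "c *\<^sub>C x \<in> closure S"
    unfolding closure_sequential using complex_vector.subspace_scale[OF assms]
    by (intro exI[of _ "\<lambda>n. c *\<^sub>C a n"]) (simp add: scaleC.tendsto)
qed

lemma hilbert_closure:
  "complex_vector.subspace S \<Longrightarrow> hilbert_subspace (closure S)"
  by (simp add: hilbert_subspace_def closure_subspace)

lemma subspace_ominus:
  "complex_vector.subspace X \<Longrightarrow> complex_vector.subspace (X \<ominus>\<^sub>H Y)"
  by (auto simp: complex_vector.subspace_def ominus_def cinner_add_left cinner_scaleC_left)

lemma hilbert_ominus:
  assumes "hilbert_subspace X" shows "hilbert_subspace (X \<ominus>\<^sub>H Y)"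
proof -
  have "X \<ominus>\<^sub>H Y = X \<inter> (\<Inter>y\<in>Y. {x. cinner x y = 0})"
    by (auto simp: ominus_def)
  moreover have "closed {x. cinner x y = 0}" for y :: 'a
    by (intro closed_Collect_eq continuous_intros cinner.continuous_on)
  ultimately have "closed (X \<ominus>\<^sub>H Y)"
    using assms by (auto simp: hilbert_subspace_def intro!: closed_Int closed_INT)
  then show ?thesis
    using assms subspace_ominus by (auto simp: hilbert_subspace_def)
qed

lemma hilbert_Times:
  assumes "hilbert_subspace X" "hilbert_subspace Y" shows "hilbert_subspace (X \<times> Y)"
  using assms unfolding hilbert_subspace_def
  by (auto simp: complex_vector.subspace_def closed_Times scaleC_prod_def zero_prod_def)

lemma cinner_eq_0_closure:
  fixes S :: "'a::complex_inner set"
  assumes "\<And>x. x \<in> S \<Longrightarrow> cinner x y = 0" "x \<in> closure S"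
  shows "cinner x y = 0"
proof -
  have "closed {x. cinner x y = 0}"
    by (intro closed_Collect_eq continuous_intros cinner.continuous_on)
  then have "closure S \<subseteq> {x. cinner x y = 0}"
    by (intro closure_minimal) (use assms in auto)
  then show ?thesis using assms by auto
qed

lemma cinner_eq_0_closure_span:
  fixes S :: "'a::complex_inner set"
  assumes "\<And>x. x \<in> S \<Longrightarrow> cinner x y = 0" "x \<in> closure (complex_vector.span S)"
  shows "cinner x y = 0"
proof (rule cinner_eq_0_closure[OF _ assms(2)])
  fix z assume "z \<in> complex_vector.span S"
  then show "cinner z y = 0"
    by (induction rule: complex_vector.span_induct_alt)
      (auto simp: cinner_add_left cinner_scaleC_left assms(1))
qed

lemma cinner_commute_0: "cinner x y = 0 \<longleftrightarrow> cinner y (x :: 'a::complex_inner) = 0"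
  by (simp add: cinner_commute[of x y])

lemma cinner_flip:
  "cinner x y = cinner z w \<Longrightarrow> cinner y (x :: 'a::complex_inner) = cinner w (z :: 'b::complex_inner)"
  by (simp add: cinner_commute[of y x] cinner_commute[of w z])

subsection \<open>Bounded operators between closed subspaces\<close>

lemma bounded_opI:
  assumes "\<And>x. x \<in> X \<Longrightarrow> A x \<in> Y" "\<And>x y. x \<in> X \<Longrightarrow> y \<in> X \<Longrightarrow> A (x + y) = A x + A y"
    "\<And>c x. x \<in> X \<Longrightarrow> A (c *\<^sub>C x) = c *\<^sub>C A x" "\<And>x. x \<in> X \<Longrightarrow> norm (A x) \<le> K * norm x"
  shows "bounded_op X Y A"
  using assms unfolding bounded_op_def by blast

lemma bounded_op_mem: "bounded_op X Y A \<Longrightarrow> x \<in> X \<Longrightarrow> A x \<in> Y"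
  and bounded_op_add: "bounded_op X Y A \<Longrightarrow> x \<in> X \<Longrightarrow> y \<in> X \<Longrightarrow> A (x + y) = A x + A y"
  and bounded_op_scaleC: "bounded_op X Y A \<Longrightarrow> x \<in> X \<Longrightarrow> A (c *\<^sub>C x) = c *\<^sub>C A x"
  by (auto simp: bounded_op_def)

lemma bounded_op_bound:
  assumes "bounded_op X Y A" obtains K where "0 \<le> K" "\<And>x. x \<in> X \<Longrightarrow> norm (A x) \<le> K * norm x"
proof -
  obtain K where K: "\<forall>x\<in>X. norm (A x) \<le> K * norm x"
    using assms by (auto simp: bounded_op_def)
  have "norm (A x) \<le> max K 0 * norm x" if "x \<in> X" for x
    using K that by (meson max.cobounded1 mult_right_mono norm_ge_zero order_trans)
  then show ?thesis by (intro that[of "max K 0"]) auto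
qed

context
  fixes X :: "'a::chilbert set" and Y :: "'b::complex_inner set" and A
  assumes X: "hilbert_subspace X" and A: "bounded_op X Y A"
begin

lemma bounded_op_zero: "A 0 = 0"
  using bounded_op_scaleC[OF A hilbert_0[OF X], of 0] by simp

lemma bounded_op_diff: "x \<in> X \<Longrightarrow> y \<in> X \<Longrightarrow> A (x - y) = A x - A y"
  using bounded_op_add[OF A, of "x - y" y] hilbert_diff[OF X] by simp

lemma bounded_op_scaleR: "x \<in> X \<Longrightarrow> A (r *\<^sub>R x) = r *\<^sub>R A x"
  by (simp add: scaleR_scaleC bounded_op_scaleC[OF A])

lemma bounded_op_sum: "(\<And>i. i \<in> I \<Longrightarrow> f i \<in> X) \<Longrightarrow> A (sum f I) = (\<Sum>i\<in>I. A (f i))"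
  by (induction I rule: infinite_finite_induct)
    (auto simp: bounded_op_zero bounded_op_add[OF A] hilbert_sum[OF X])

lemma bounded_op_tendsto:
  assumes "f \<longlonglongrightarrow> l" "\<And>n. f n \<in> X"
  shows "(\<lambda>n. A (f n)) \<longlonglongrightarrow> A l"
proof -
  obtain K where K: "0 \<le> K" "\<And>x. x \<in> X \<Longrightarrow> norm (A x) \<le> K * norm x"
    using bounded_op_bound[OF A] by blast
  have l: "l \<in> X" using hilbert_limit[OF X] assms by blast
  have 1: "(\<lambda>n. K * norm (f n - l)) \<longlonglongrightarrow> K * 0"
    using assms(1) LIM_zero tendsto_norm_zero by (intro tendsto_mult tendsto_const) blast
  have 2: "norm (A (f n) - A l) \<le> K * norm (f n - l)" for n
    using K(2)[of "f n - l"] assms(2) l by (simp add: bounded_op_diff hilbert_diff[OF X])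
  have "(\<lambda>n. A (f n) - A l) \<longlonglongrightarrow> 0"
    using Lim_null_comparison[OF always_eventually[OF allI[OF 2]]] 1 by simp
  then show ?thesis using LIM_zero_iff by blast
qed

end

lemma bounded_op_eq_closure_span:
  fixes X :: "'a::chilbert set"
  assumes X: "hilbert_subspace X" and A: "bounded_op X Y A" and B: "bounded_op X Z B"
    and S: "S \<subseteq> X" "X \<subseteq> closure (complex_vector.span S)" and eq: "\<And>x. x \<in> S \<Longrightarrow> A x = B x"
    and x: "x \<in> X"
  shows "A x = B x"
proof -
  have sub: "complex_vector.span S \<subseteq> X"
    using complex_vector.span_minimal[OF S(1)] X by (auto simp: hilbert_subspace_def)
  have *: "A y = B y" if "y \<in> complex_vector.span S" for y
  proof -
    have "y \<in> X \<and> A y = B y" using that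
    proof (induction rule: complex_vector.span_induct_alt)
      case base
      then show ?case by (simp add: bounded_op_zero[OF X A] bounded_op_zero[OF X B] hilbert_0[OF X])
    next
      case (step c u y)
      then have "u \<in> X" using S by auto
      then show ?case using step eq bounded_op_add[OF A] bounded_op_add[OF B] bounded_op_scaleC[OF A]
          bounded_op_scaleC[OF B] by (auto simp: hilbert_intros[OF X])
    qed
    then show ?thesis by blast
  qed
  obtain f where f: "\<forall>n. f n \<in> complex_vector.span S" "f \<longlonglongrightarrow> x"
    using x S(2) closure_sequential by blast
  have fX: "\<And>n. f n \<in> X" using f(1) sub by auto
  have "(\<lambda>n. A (f n)) \<longlonglongrightarrow> A x"
    by (rule bounded_op_tendsto[OF X A f(2) fX])
  moreover have "(\<lambda>n. B (f n)) \<longlonglongrightarrow> B x"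
    by (rule bounded_op_tendsto[OF X B f(2) fX])
  ultimately show ?thesis
    using * f(1) LIMSEQ_unique by simp
qed

lemma bounded_op_comp:
  assumes "bounded_op X Y A" "bounded_op Y Z B" shows "bounded_op X Z (\<lambda>x. B (A x))"
proof -
  obtain K where K: "0 \<le> K" "\<And>x. x \<in> X \<Longrightarrow> norm (A x) \<le> K * norm x"
    using bounded_op_bound[OF assms(1)] by blast
  obtain L where L: "0 \<le> L" "\<And>x. x \<in> Y \<Longrightarrow> norm (B x) \<le> L * norm x"
    using bounded_op_bound[OF assms(2)] by blast
  show ?thesis
  proof (rule bounded_opI[where K="L * K"])
    fix x assume x: "x \<in> X"
    have "norm (B (A x)) \<le> L * norm (A x)"
      using L x assms bounded_op_mem by blast
    also have "\<dots> \<le> L * (K * norm x)"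
      using K L x by (intro mult_left_mono) auto
    finally show "norm (B (A x)) \<le> L * K * norm x" by simp
  qed (use assms in \<open>auto simp: bounded_op_def\<close>)
qed

lemma bounded_op_subset:
  assumes "bounded_op X Y A" "X' \<subseteq> X" "\<And>x. x \<in> X' \<Longrightarrow> A x \<in> Y'"
  shows "bounded_op X' Y' A"
proof -
  obtain K where K: "\<And>x. x \<in> X \<Longrightarrow> norm (A x) \<le> K * norm x"
    using bounded_op_bound[OF assms(1)] by blast
  show ?thesis
    by (rule bounded_opI[where K=K])
      (use assms(2,3) K bounded_op_add[OF assms(1)] bounded_op_scaleC[OF assms(1)] in \<open>simp_all add: subsetD\<close>)
qed

lemma bounded_op_cong:
  fixes X :: "'a::chilbert set"
  assumes "hilbert_subspace X" "bounded_op X Y A" "\<And>x. x \<in> X \<Longrightarrow> B x = A x"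
  shows "bounded_op X Y B"
proof -
  obtain K where K: "\<And>x. x \<in> X \<Longrightarrow> norm (A x) \<le> K * norm x"
    using bounded_op_bound[OF assms(2)] by blast
  show ?thesis
    by (rule bounded_opI[where K=K])
      (use K in \<open>simp_all add: assms(3) hilbert_intros[OF assms(1)] bounded_op_mem[OF assms(2)]
        bounded_op_add[OF assms(2)] bounded_op_scaleC[OF assms(2)]\<close>)
qed

lemma bounded_op_add_op:
  assumes "bounded_op X UNIV A" "bounded_op X UNIV B"
  shows "bounded_op X UNIV (\<lambda>x. A x + B x)"
proof -
  obtain K where K: "\<And>x. x \<in> X \<Longrightarrow> norm (A x) \<le> K * norm x"
    using bounded_op_bound[OF assms(1)] by blast
  obtain L where L: "\<And>x. x \<in> X \<Longrightarrow> norm (B x) \<le> L * norm x"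
    using bounded_op_bound[OF assms(2)] by blast
  show ?thesis
  proof (rule bounded_opI[where K="K + L"])
    fix x assume "x \<in> X"
    then show "norm (A x + B x) \<le> (K + L) * norm x"
      using norm_triangle_ineq[of "A x" "B x"] K[of x] L[of x] by (simp add: algebra_simps)
  qed (use assms in \<open>auto simp: bounded_op_def scaleC_add_right\<close>)
qed

lemma bounded_op_scaleC_op:
  assumes "bounded_op X UNIV A"
  shows "bounded_op X UNIV (\<lambda>x. c *\<^sub>C A x)"
proof -
  obtain K where K: "\<And>x. x \<in> X \<Longrightarrow> norm (A x) \<le> K * norm x"
    using bounded_op_bound[OF assms] by blast
  show ?thesis
  proof (rule bounded_opI[where K="cmod c * K"])
    fix x assume "x \<in> X"
    then show "norm (c *\<^sub>C A x) \<le> cmod c * K * norm x"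
      using K[of x] by (simp add: norm_scaleC mult.assoc mult_left_mono)
  qed (use assms in \<open>auto simp: bounded_op_def scaleC_add_right scaleC_scaleC mult.commute\<close>)
qed

lemma bounded_op_UNIV_linear:
  assumes "bounded_op UNIV Y A" shows "bounded_linear A"
proof -
  obtain K where "\<And>x. norm (A x) \<le> K * norm x"
    using bounded_op_bound[OF assms] by auto
  then show ?thesis
    by (intro bounded_linear_intro[where K=K])
      (use assms in \<open>auto simp: bounded_op_def scaleR_scaleC mult.commute\<close>)
qed

lemma bounded_op_sum_op:
  "(\<And>i. i \<in> I \<Longrightarrow> bounded_op X UNIV (A i)) \<Longrightarrow> bounded_op X UNIV (\<lambda>x. \<Sum>i\<in>I. A i x)"
proof (induction I rule: infinite_finite_induct)
  case (insert i I)
  then show ?case by (simp add: bounded_op_add_op)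
qed (simp_all, (rule bounded_opI[where K=0]; simp)+)

lemma subspace_image:
  fixes G :: "'a::chilbert set"
  assumes G: "hilbert_subspace G" and A: "bounded_op G Y A"
  shows "complex_vector.subspace (A ` G)"
proof (rule complex_vector.subspaceI)
  show "0 \<in> A ` G"
    using bounded_op_zero[OF G A] hilbert_0[OF G] by (metis image_eqI)
  show "x + y \<in> A ` G" if "x \<in> A ` G" "y \<in> A ` G" for x y
    using that bounded_op_add[OF A] hilbert_add[OF G] by (metis (no_types, lifting) image_iff)
  show "c *\<^sub>C x \<in> A ` G" if "x \<in> A ` G" for c x
    using that bounded_op_scaleC[OF A] hilbert_scaleC[OF G] by (metis (no_types, lifting) image_iff)
qed

section \<open>Riesz representation of bounded functionals\<close>

text \<open>The first-order condition of a minimum at t = 0, in a form that also covers d = 0; it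
  serves the Riesz functional and positive forms.\<close>

lemma quadratic_nonneg_imp_zero:
  fixes c d :: real
  assumes "\<And>t. 0 \<le> 2 * t * c + t\<^sup>2 * d" "0 \<le> d"
  shows "c = 0"
proof (rule ccontr)
  assume "c \<noteq> 0"
  \<comment> \<open>The minimiser would be - c / d; the added 1 keeps the denominator positive and
    still yields a negative value.\<close>
  define t where "t = - c / (d + 1)"
  have "0 \<le> (d + 1)\<^sup>2 * (2 * t * c + t\<^sup>2 * d)"
    by (intro mult_nonneg_nonneg assms) simp
  also have "\<dots> = 2 * (t * (d + 1)) * (d + 1) * c + (t * (d + 1))\<^sup>2 * d"
    by algebra
  also have "t * (d + 1) = - c"
    using assms(2) by (simp add: t_def)
  finally have "0 \<le> - 2 * c\<^sup>2 * (d + 1) + c\<^sup>2 * d"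
    by (simp add: power2_eq_square ac_simps)
  moreover have "0 < c\<^sup>2" "0 \<le> c\<^sup>2 * d" using \<open>c \<noteq> 0\<close> assms(2) by auto
  moreover have "- 2 * c\<^sup>2 * (d + 1) + c\<^sup>2 * d = - (2 * c\<^sup>2) - c\<^sup>2 * d"
    by (simp add: algebra_simps)
  ultimately show False by linarith
qed

text \<open>Minimise \<open>\<Parallel>x\<Parallel>\<^sup>2 - 2 Re F(x)\<close> over \<open>S\<close>; a minimising sequence is Cauchy by the parallelogram law.\<close>

lemma riesz_representation:
  fixes S :: "'a::chilbert set" and F :: "'a \<Rightarrow> complex"
  assumes S: "complex_vector.subspace S"
    and add: "\<And>x y. x \<in> S \<Longrightarrow> y \<in> S \<Longrightarrow> F (x + y) = F x + F y"
    and scale: "\<And>c x. x \<in> S \<Longrightarrow> F (c *\<^sub>C x) = c * F x"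
    and bound: "\<And>x. x \<in> S \<Longrightarrow> cmod (F x) \<le> B * norm x"
  shows "\<exists>u\<in>closure S. \<forall>x\<in>S. F x = cinner x u"
proof -
  define q where "q x = (norm x)\<^sup>2 - 2 * Re (F x)" for x
  define m where "m = Inf (q ` S)"
  note S_intros = complex_vector.subspace_add[OF S] complex_vector.subspace_scale[OF S]
  have scaleR: "r *\<^sub>R x \<in> S" "F (r *\<^sub>R x) = of_real r * F x" if "x \<in> S" for x r
    using that by (auto simp: scaleR_scaleC scale S_intros)
  have lower: "- B\<^sup>2 \<le> q x" if "x \<in> S" for x
  proof -
    have "Re (F x) \<le> B * norm x"
      using bound[OF that] complex_Re_le_cmod[of "F x"] by linarith
    moreover have "0 \<le> (norm x - B)\<^sup>2" by simp
    ultimately show ?thesis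
      by (simp add: q_def power2_diff mult.commute)
  qed
  have bdd: "bdd_below (q ` S)"
    using lower by (intro bdd_belowI[of _ "- B\<^sup>2"]) auto
  have m_le: "m \<le> q x" if "x \<in> S" for x
    unfolding m_def using bdd that by (intro cInf_lower) auto
  have "\<exists>x\<in>S. q x < m + inverse (real (Suc n))" for n
    using cInf_lessD[of "q ` S" "m + inverse (real (Suc n))"] complex_vector.subspace_0[OF S]
    by (auto simp: m_def)
  then obtain X where X: "\<And>n. X n \<in> S" "\<And>n. q (X n) < m + inverse (real (Suc n))"
    by metis
  have para: "(norm (x - y))\<^sup>2 \<le> 2 * q x + 2 * q y - 4 * m" if "x \<in> S" "y \<in> S" for x y
  proof -
    define z where "z = (1/2) *\<^sub>R (x + y)"
    have "z \<in> S" using that by (simp add: z_def scaleR S_intros)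
    have Fz: "F z = (F x + F y) / 2"
      using that by (simp add: z_def scaleR S_intros add)
    have nz: "norm z = norm (x + y) / 2"
      unfolding z_def by simp
    have "q z = (norm (x + y))\<^sup>2 / 4 - (Re (F x) + Re (F y))"
      unfolding q_def Fz nz by (simp add: power_divide add_divide_distrib)
    moreover have "(norm (x + y))\<^sup>2 + (norm (x - y))\<^sup>2 = 2 * (norm x)\<^sup>2 + 2 * (norm y)\<^sup>2"
      by (simp add: norm_diff_square norm_add_square)
    ultimately have "(norm (x - y))\<^sup>2 = 2 * q x + 2 * q y - 4 * q z"
      by (simp add: q_def)
    then show ?thesis using m_le[OF \<open>z \<in> S\<close>] by simp
  qed
  have "Cauchy X"
  proof (rule CauchyI)
    fix e :: real assume e: "0 < e"
    then obtain N where N: "inverse (real (Suc N)) < e\<^sup>2 / 4"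
      using reals_Archimedean[of "e\<^sup>2 / 4"] by auto
    have "norm (X i - X j) < e" if "i \<ge> N" "j \<ge> N" for i j
    proof -
      have "inverse (real (Suc i)) \<le> inverse (real (Suc N))" "inverse (real (Suc j)) \<le> inverse (real (Suc N))"
        using that by (auto intro!: le_imp_inverse_le)
      then have "(norm (X i - X j))\<^sup>2 < e\<^sup>2"
        using para[OF X(1) X(1), of i j] X(2)[of i] X(2)[of j] N by linarith
      then show ?thesis using e by (rule power2_less_imp_less[OF _ less_imp_le])
    qed
    then show "\<exists>M. \<forall>i\<ge>M. \<forall>j\<ge>M. norm (X i - X j) < e" by blast
  qed
  then obtain u where u: "X \<longlonglongrightarrow> u"
    using Cauchy_convergent convergent_def by blast
  \<comment> \<open>\<open>S\<close> need not be closed, since it will also be the range of an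
    operator. As \<open>u\<close> may lie outside \<open>S\<close>, \<open>q\<close> and
    \<open>F\<close> are never evaluated at \<open>u\<close>.\<close>
  then have uS: "u \<in> closure S"
    using X(1) closure_sequential by blast
  have q_lim: "(\<lambda>n. q (X n)) \<longlonglongrightarrow> m"
  proof (rule tendsto_sandwich[where f="\<lambda>_. m" and h="\<lambda>n. m + inverse (real (Suc n))"])
    show "(\<lambda>n. m + inverse (real (Suc n))) \<longlonglongrightarrow> m"
      using tendsto_add[OF tendsto_const LIMSEQ_inverse_real_of_nat] by simp
    show "\<forall>\<^sub>F n in sequentially. m \<le> q (X n)"
      using m_le X(1) by simp
    show "\<forall>\<^sub>F n in sequentially. q (X n) \<le> m + inverse (real (Suc n))"
      using X(2) by (intro always_eventually allI less_imp_le)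
  qed simp
  have re: "inner u x = Re (F x)" if x: "x \<in> S" for x
  proof -
    define d where "d = (norm x)\<^sup>2"
    have "inner u x - Re (F x) = 0"
    proof (rule quadratic_nonneg_imp_zero)
      fix t :: real
      have "(\<lambda>n. q (X n) + 2 * t * (inner (X n) x - Re (F x)) + t\<^sup>2 * d)
          \<longlonglongrightarrow> m + 2 * t * (inner u x - Re (F x)) + t\<^sup>2 * d"
        by (intro tendsto_intros q_lim u)
      moreover have "m \<le> q (X n) + 2 * t * (inner (X n) x - Re (F x)) + t\<^sup>2 * d" for n
      proof -
        have "q (X n + t *\<^sub>R x) = q (X n) + 2 * t * (inner (X n) x - Re (F x)) + t\<^sup>2 * d"
          using x X(1)[of n] by (simp add: q_def d_def scaleR add norm_add_square
            inner_cinner[symmetric] algebra_simps power_mult_distrib)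
        moreover have "X n + t *\<^sub>R x \<in> S" using x X(1) by (simp add: scaleR S_intros)
        ultimately show ?thesis using m_le by metis
      qed
      ultimately have "m \<le> m + 2 * t * (inner u x - Re (F x)) + t\<^sup>2 * d"
        by (intro LIMSEQ_le_const) auto
      then show "0 \<le> 2 * t * (inner u x - Re (F x)) + t\<^sup>2 * d" by simp
    qed (simp add: d_def)
    then show ?thesis by simp
  qed
  have "F x = cinner x u" if "x \<in> S" for x
  proof (rule complex_eqI)
    show "Re (F x) = Re (cinner x u)"
      using re[OF that] by (simp add: inner_commute inner_cinner[symmetric])
    have "\<i> *\<^sub>C x \<in> S" using that by (rule S_intros)
    then have "Re (cinner (\<i> *\<^sub>C x) u) = Re (F (\<i> *\<^sub>C x))"
      unfolding inner_cinner[symmetric] inner_commute[of "\<i> *\<^sub>C x" u] by (rule re)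
    then show "Im (F x) = Im (cinner x u)"
      using that by (simp add: cinner_scaleC_left scale)
  qed
  then show ?thesis using uS by blast
qed

lemma hilbert_closure_eq: "hilbert_subspace X \<Longrightarrow> closure X = X"
  by (simp add: hilbert_subspace_def)

lemma cinner_ext:
  fixes X :: "'a::chilbert set"
  assumes "hilbert_subspace X" "y \<in> X" "z \<in> X" "\<And>x. x \<in> X \<Longrightarrow> cinner x y = cinner x z"
  shows "y = z"
proof -
  have "cinner (y - z) (y - z) = 0"
    using assms(4)[of "y - z"] hilbert_diff[OF assms(1-3)] by (simp add: cinner.diff_right)
  then show ?thesis by (simp add: cinner_self)
qed

subsection \<open>Adjoints\<close>

lemma adj_exists:
  fixes X :: "'a::chilbert set" and Y :: "'b::chilbert set"
  assumes X: "hilbert_subspace X" and Y: "hilbert_subspace Y" and A: "bounded_op X Y A"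
  shows "\<exists>B. bounded_op Y X B \<and> (\<forall>x\<in>X. \<forall>y\<in>Y. cinner (A x) y = cinner x (B y))"
proof -
  obtain K where K: "0 \<le> K" "\<And>x. x \<in> X \<Longrightarrow> norm (A x) \<le> K * norm x"
    using bounded_op_bound[OF A] by blast
  have "\<exists>u\<in>X. \<forall>x\<in>X. cinner (A x) y = cinner x u" for y
  proof -
    have "\<exists>u\<in>closure X. \<forall>x\<in>X. cinner (A x) y = cinner x u"
    proof (rule riesz_representation[where B="K * norm y"])
      show "cmod (cinner (A x) y) \<le> K * norm y * norm x" if "x \<in> X" for x
      proof -
        have "cmod (cinner (A x) y) \<le> norm (A x) * norm y" by (rule cmod_cinner_le)
        also have "\<dots> \<le> K * norm x * norm y" using K that by (intro mult_right_mono) auto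
        finally show ?thesis by (simp add: ac_simps)
      qed
    qed (use X A in \<open>auto simp: hilbert_subspace_def bounded_op_def cinner_add_left cinner_scaleC_left\<close>)
    then show ?thesis using hilbert_closure_eq[OF X] by simp
  qed
  then obtain B where B: "\<And>y. B y \<in> X" "\<And>x y. x \<in> X \<Longrightarrow> cinner (A x) y = cinner x (B y)"
    by metis
  have "bounded_op Y X B"
  proof (rule bounded_opI[where K=K])
    show "B y \<in> X" for y by (rule B)
    show "B (x + y) = B x + B y" for x y
      by (rule cinner_ext[OF X]) (auto simp: B(1) hilbert_intros[OF X] cinner_add_right simp flip: B(2))
    show "B (c *\<^sub>C x) = c *\<^sub>C B x" for c x
      by (rule cinner_ext[OF X]) (auto simp: B(1) hilbert_intros[OF X] cinner_scaleC_right simp flip: B(2))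
    show "norm (B y) \<le> K * norm y" for y
    proof (cases "B y = 0")
      case False
      have "(norm (B y))\<^sup>2 = cmod (cinner (A (B y)) y)"
        by (simp add: B cinner_self norm_power)
      also have "\<dots> \<le> norm (A (B y)) * norm y" by (rule cmod_cinner_le)
      also have "\<dots> \<le> K * norm (B y) * norm y" using K B by (intro mult_right_mono) auto
      finally show ?thesis using False by (simp add: power2_eq_square ac_simps)
    qed (use K in simp)
  qed
  then show ?thesis using B by blast
qed

context
  fixes X :: "'a::chilbert set" and Y :: "'b::chilbert set" and A
  assumes X: "hilbert_subspace X" and Y: "hilbert_subspace Y" and A: "bounded_op X Y A"
begin

lemma bounded_op_adj: "bounded_op Y X (adj X Y A)"
  and cinner_adj: "x \<in> X \<Longrightarrow> y \<in> Y \<Longrightarrow> cinner (A x) y = cinner x (adj X Y A y)"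
  unfolding adj_def using someI_ex[OF adj_exists[OF X Y A]] by blast+

lemma cinner_adj': "x \<in> X \<Longrightarrow> y \<in> Y \<Longrightarrow> cinner y (A x) = cinner (adj X Y A y) x"
  by (rule cinner_flip) (rule cinner_adj)

lemma adj_eqI:
  assumes "y \<in> Y" "z \<in> X" "\<And>x. x \<in> X \<Longrightarrow> cinner (A x) y = cinner x z"
  shows "adj X Y A y = z"
  using assms cinner_adj bounded_op_mem[OF bounded_op_adj]
  by (intro cinner_ext[OF X]) auto

lemma norm_adj_le:
  assumes "0 \<le> K" "\<And>x. x \<in> X \<Longrightarrow> norm (A x) \<le> K * norm x" "y \<in> Y"
  shows "norm (adj X Y A y) \<le> K * norm y"
proof (cases "adj X Y A y = 0")
  case False
  define z where "z = adj X Y A y"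
  have z: "z \<in> X" using assms(3) bounded_op_mem[OF bounded_op_adj] by (simp add: z_def)
  have "(norm z)\<^sup>2 = cmod (cinner (A z) y)"
    using z assms(3) by (simp add: cinner_adj cinner_self norm_power flip: z_def)
  also have "\<dots> \<le> norm (A z) * norm y" by (rule cmod_cinner_le)
  also have "\<dots> \<le> K * norm z * norm y" using assms z by (intro mult_right_mono) auto
  finally show ?thesis using False by (simp add: power2_eq_square ac_simps flip: z_def)
qed (use assms in simp)

end

lemma adj_adj:
  fixes X :: "'a::chilbert set" and Y :: "'b::chilbert set"
  assumes "hilbert_subspace X" "hilbert_subspace Y" "bounded_op X Y A" "x \<in> X"
  shows "adj Y X (adj X Y A) x = A x"
  using assms by (intro adj_eqI bounded_op_adj cinner_adj'[symmetric] bounded_op_mem[OF assms(3)]) auto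

subsection \<open>Orthogonal projections\<close>

lemma proj_exists:
  fixes X :: "'a::chilbert set"
  assumes X: "hilbert_subspace X"
  shows "\<exists>y. y \<in> X \<and> (\<forall>z\<in>X. cinner (x - y) z = 0)"
proof -
  have "\<exists>u\<in>closure X. \<forall>z\<in>X. cinner z x = cinner z u"
    by (rule riesz_representation[where B="norm x"])
      (use X in \<open>auto simp: hilbert_subspace_def cinner_add_left cinner_scaleC_left mult.commute[of "norm x"] cmod_cinner_le\<close>)
  then obtain u where "u \<in> X" "\<forall>z\<in>X. cinner z x = cinner z u"
    using hilbert_closure_eq[OF X] by auto
  then show ?thesis
    by (intro exI[of _ u]) (simp add: cinner_commute_0[of "x - u"] cinner.diff_right)
qed

context
  fixes X :: "'a::chilbert set"
  assumes X: "hilbert_subspace X"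
begin

lemma proj_mem: "proj X x \<in> X"
  and proj_orth: "z \<in> X \<Longrightarrow> cinner (x - proj X x) z = 0"
  unfolding proj_def using someI_ex[OF proj_exists[OF X]] by blast+

lemma cinner_proj: "z \<in> X \<Longrightarrow> cinner (proj X x) z = cinner x z"
  using proj_orth[of z x] by (simp add: cinner.diff_left)

lemma cinner_proj': "z \<in> X \<Longrightarrow> cinner z (proj X x) = cinner z x"
  by (rule cinner_flip) (rule cinner_proj)

lemma proj_eqI:
  assumes "y \<in> X" "\<And>z. z \<in> X \<Longrightarrow> cinner z x = cinner z y"
  shows "proj X x = y"
  using assms by (intro cinner_ext[OF X]) (auto simp: proj_mem cinner_proj')

lemma norm_proj_le: "norm (proj X x) \<le> norm x"
proof (cases "proj X x = 0")
  case False
  have "cinner x (proj X x) = of_real ((norm (proj X x))\<^sup>2)"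
    using cinner_proj[OF proj_mem, of x x] by (simp only: cinner_self)
  then have "(norm (proj X x))\<^sup>2 = cmod (cinner x (proj X x))"
    by (simp only: norm_of_real) simp
  also have "\<dots> \<le> norm x * norm (proj X x)" by (rule cmod_cinner_le)
  finally show ?thesis using False by (simp add: power2_eq_square)
qed simp

lemma bounded_op_proj: "bounded_op UNIV X (proj X)"
proof (rule bounded_opI[where K=1])
  show "proj X (x + y) = proj X x + proj X y" for x y
    by (rule proj_eqI) (auto simp: hilbert_intros[OF X] proj_mem cinner_add_right cinner_proj')
  show "proj X (c *\<^sub>C x) = c *\<^sub>C proj X x" for c x
    by (rule proj_eqI) (auto simp: hilbert_intros[OF X] proj_mem cinner_scaleC_right cinner_proj')
qed (auto simp: proj_mem norm_proj_le)

text \<open>The difference of \<open>x\<close> and its projection to the closure is orthogonal to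
  \<open>S\<close>, so the hypothesis kills it; used to show that ranges are dense.\<close>

lemma proj_closure_eqI:
  assumes S: "complex_vector.subspace S" "S \<subseteq> X"
    and 0: "\<And>x. x \<in> X \<Longrightarrow> (\<And>s. s \<in> S \<Longrightarrow> cinner s x = 0) \<Longrightarrow> x = 0"
  shows "closure S = X"
proof
  show "closure S \<subseteq> X"
    using S(2) X by (simp add: closure_minimal hilbert_subspace_def)
  have H: "hilbert_subspace (closure S)" by (rule hilbert_closure[OF S(1)])
  have "x \<in> closure S" if x: "x \<in> X" for x
  proof -
    let ?P = "proj (closure S) x"
    have P: "?P \<in> closure S"
      using someI_ex[OF proj_exists[OF H]] unfolding proj_def by blast
    have orth: "cinner (x - ?P) z = 0" if "z \<in> closure S" for z
      using someI_ex[OF proj_exists[OF H], of x] that unfolding proj_def by blast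
    have "x - ?P = 0"
      using x P \<open>closure S \<subseteq> X\<close> orth closure_subset[of S]
      by (intro 0) (auto simp: hilbert_diff[OF X] cinner_commute_0[of _ "x - ?P"])
    then show ?thesis using P by simp
  qed
  then show "X \<subseteq> closure S" by blast
qed

end

subsection \<open>Square roots of positive operators\<close>

context
  fixes X :: "'a::chilbert set" and B
  assumes X: "hilbert_subspace X" and B: "positive_op X B"
begin

lemma positive_op_bounded: "bounded_op X X B"
  using B by (simp add: positive_op_def)

lemma positive_op_Re: "x \<in> X \<Longrightarrow> 0 \<le> Re (cinner (B x) x)"
  using B by (auto simp: positive_op_def complex_nonneg_Reals_iff)

text \<open>Polarisation: the form \<open>f\<close> vanishes on the diagonal because positivity
  includes reality, and its values at x + y and x + i y give f x y + f y x = 0 and f y x = f x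
  y.\<close>

lemma positive_op_sym:
  assumes x: "x \<in> X" and y: "y \<in> X"
  shows "cinner (B x) y = cinner x (B y)"
proof -
  define f where "f x y = cinner (B x) y - cinner x (B y)" for x y
  have f0: "f x x = 0" if "x \<in> X" for x
  proof -
    have "cinner (B x) x \<in> \<real>\<^sub>\<ge>\<^sub>0"
      using B that by (auto simp: positive_op_def)
    then have "cnj (cinner (B x) x) = cinner (B x) x"
      by (simp add: complex_nonneg_Reals_iff complex_eq_iff)
    then show ?thesis
      by (simp add: f_def cinner_commute[of x "B x"])
  qed
  note B_simps = bounded_op_add[OF positive_op_bounded] bounded_op_scaleC[OF positive_op_bounded]
    hilbert_scaleC[OF X]
  have "f (x + y) (x + y) = f x x + f x y + f y x + f y y"
    using x y by (simp add: f_def B_simps cinner_add_left cinner_add_right)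
  then have 1: "f x y + f y x = 0"
    using f0 x y hilbert_add[OF X] by simp
  have "f (x + \<i> *\<^sub>C y) (x + \<i> *\<^sub>C y) = f x x - \<i> * f x y + \<i> * f y x + f y y"
    using x y by (simp add: f_def B_simps cinner_add_left cinner_add_right cinner_scaleC_left
      cinner_scaleC_right algebra_simps)
  then have "\<i> * (f y x - f x y) = 0"
    using f0 x y hilbert_add[OF X] hilbert_scaleC[OF X] by (simp add: algebra_simps)
  with 1 have "f x y = 0" by simp
  then show ?thesis by (simp add: f_def)
qed

text \<open>A zero of a positive form is a minimum. Varying \<open>x\<close> in the direction
  \<open>B x\<close> makes the squared norm of \<open>B x\<close> the linear coefficient, which must
  vanish.\<close>

lemma positive_op_eq_0:
  assumes x: "x \<in> X" and 0: "Re (cinner (B x) x) = 0"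
  shows "B x = 0"
proof -
  let ?z = "B x"
  have z: "?z \<in> X" using bounded_op_mem[OF positive_op_bounded x] .
  have "Re (cinner (B x) ?z) = 0"
  proof (rule quadratic_nonneg_imp_zero)
    fix t :: real
    have "0 \<le> Re (cinner (B (x + t *\<^sub>R ?z)) (x + t *\<^sub>R ?z))"
      using x z by (intro positive_op_Re hilbert_intros[OF X])
    also have "B (x + t *\<^sub>R ?z) = B x + t *\<^sub>R B ?z"
      using x z by (simp add: bounded_op_add[OF positive_op_bounded]
        bounded_op_scaleR[OF X positive_op_bounded] hilbert_intros[OF X])
    also have "Re (cinner (B x + t *\<^sub>R B ?z) (x + t *\<^sub>R ?z))
      = 2 * t * Re (cinner (B x) ?z) + t\<^sup>2 * Re (cinner (B ?z) ?z)"
      using 0 positive_op_sym[OF z x] by (simp add: cinner_add_left cinner_add_right cinner.scaleR_left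
        cinner.scaleR_right power2_eq_square algebra_simps)
    finally show "0 \<le> 2 * t * Re (cinner (B x) ?z) + t\<^sup>2 * Re (cinner (B ?z) ?z)" .
  qed (rule positive_op_Re[OF z])
  then show ?thesis by (simp add: Re_cinner_self)
qed

end

text \<open>Zero is a nonnegative value, so \<open>A\<close> qualifies as a positive operator. This
  is how a norm identity for adjoints becomes an operator identity.\<close>

lemma cinner_diagonal_0:
  fixes X :: "'a::chilbert set"
  assumes "hilbert_subspace X" "bounded_op X X A" "\<And>x. x \<in> X \<Longrightarrow> cinner (A x) x = 0" "x \<in> X"
  shows "A x = 0"
proof -
  have "positive_op X A"
    using assms(2,3) by (simp add: positive_op_def)
  from positive_op_eq_0[OF assms(1) this assms(4)] show ?thesis
    using assms(3)[OF assms(4)] by simp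
qed

text \<open>
  The iteration \<open>Y\<^sub>n\<^sub>+\<^sub>1 = (E + Y\<^sub>n\<^sup>2) / 2\<close> converges to a solution of \<open>2 Y = E + Y\<^sup>2\<close>, so that
  \<open>(I - Y)\<^sup>2 = I - E\<close>.  Its scalar counterpart with \<open>E = 1\<close> controls the norms.
\<close>

primrec sqrt_iter :: "('a::real_vector \<Rightarrow> 'a) \<Rightarrow> nat \<Rightarrow> 'a \<Rightarrow> 'a" where
  "sqrt_iter E 0 x = 0"
| "sqrt_iter E (Suc n) x = (1/2) *\<^sub>R (E x + sqrt_iter E n (sqrt_iter E n x))"

primrec sqrt_scal :: "nat \<Rightarrow> real" where
  "sqrt_scal 0 = 0"
| "sqrt_scal (Suc n) = (1 + (sqrt_scal n)\<^sup>2) / 2"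

definition sqrt_one_minus :: "('a::real_normed_vector \<Rightarrow> 'a) \<Rightarrow> 'a \<Rightarrow> 'a" where
  "sqrt_one_minus E x = x - lim (\<lambda>n. sqrt_iter E n x)"

lemma sqrt_scal_bounds: "0 \<le> sqrt_scal n \<and> sqrt_scal n \<le> 1"
proof (induction n)
  case (Suc n)
  then have "(sqrt_scal n)\<^sup>2 \<le> 1" by (simp add: power_le_one)
  then show ?case by simp
qed simp

lemma sqrt_scal_mono: "incseq sqrt_scal"
proof (rule incseq_SucI)
  fix n
  have "0 \<le> (1 - sqrt_scal n)\<^sup>2" by simp
  then show "sqrt_scal n \<le> sqrt_scal (Suc n)"
    by (simp add: power2_diff)
qed

lemma sqrt_scal_Cauchy: "Cauchy sqrt_scal"
proof -
  obtain L where "sqrt_scal \<longlonglongrightarrow> L"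
    using incseq_convergent[OF sqrt_scal_mono] sqrt_scal_bounds by metis
  then show ?thesis by (rule LIMSEQ_imp_Cauchy)
qed

context
  fixes X :: "'a::chilbert set" and E
  assumes X: "hilbert_subspace X" and E: "bounded_op X X E"
    and contr: "\<And>x. x \<in> X \<Longrightarrow> norm (E x) \<le> norm x"
begin

lemma sqrt_iter_bounded:
  "bounded_op X X (sqrt_iter E n) \<and> (\<forall>x\<in>X. norm (sqrt_iter E n x) \<le> sqrt_scal n * norm x)"
proof (induction n)
  case 0
  have "bounded_op X X (sqrt_iter E 0)"
    by (rule bounded_opI[where K=0]) (simp_all add: hilbert_0[OF X])
  moreover have "\<forall>x\<in>X. norm (sqrt_iter E 0 x) \<le> sqrt_scal 0 * norm x" by simp
  ultimately show ?case by blast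
next
  case (Suc n)
  then have Y: "bounded_op X X (sqrt_iter E n)" and
    le: "\<And>x. x \<in> X \<Longrightarrow> norm (sqrt_iter E n x) \<le> sqrt_scal n * norm x" by auto
  have norm: "norm (sqrt_iter E (Suc n) x) \<le> sqrt_scal (Suc n) * norm x" if x: "x \<in> X" for x
  proof -
    let ?y = "sqrt_iter E n x"
    have "norm (sqrt_iter E n ?y) \<le> sqrt_scal n * norm ?y"
      using le bounded_op_mem[OF Y x] by blast
    also have "\<dots> \<le> sqrt_scal n * (sqrt_scal n * norm x)"
      using le[OF x] sqrt_scal_bounds by (intro mult_left_mono) auto
    finally have "norm (E x + sqrt_iter E n ?y) \<le> norm x + (sqrt_scal n)\<^sup>2 * norm x"
      using contr[OF x] norm_triangle_ineq[of "E x" "sqrt_iter E n ?y"]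
      by (simp add: power2_eq_square mult.assoc)
    moreover have "norm (sqrt_iter E (Suc n) x) = norm (E x + sqrt_iter E n ?y) / 2"
      unfolding sqrt_iter.simps(2) by (simp del: scaleR_add_right)
    ultimately show ?thesis by (simp add: algebra_simps del: sqrt_iter.simps)
  qed
  have "bounded_op X X (sqrt_iter E (Suc n))"
  proof (rule bounded_opI[OF _ _ _ norm])
    fix x y c assume x: "x \<in> X"
    note YX = bounded_op_mem[OF Y] and EX = bounded_op_mem[OF E]
    show "sqrt_iter E (Suc n) x \<in> X"
      using x by (simp add: YX EX hilbert_intros[OF X])
    show "sqrt_iter E (Suc n) (c *\<^sub>C x) = c *\<^sub>C sqrt_iter E (Suc n) x"
      using x by (simp add: YX bounded_op_scaleC[OF Y] bounded_op_scaleC[OF E] scaleC_add_right scaleC.scaleR_right)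
    show "sqrt_iter E (Suc n) (x + y) = sqrt_iter E (Suc n) x + sqrt_iter E (Suc n) y" if "y \<in> X"
      using x that by (simp add: YX bounded_op_add[OF Y] bounded_op_add[OF E] scaleR_add_right[symmetric] del: scaleR_add_right)
  qed
  then show ?case using norm by blast
qed

lemmas sqrt_iter_op = sqrt_iter_bounded[THEN conjunct1]
lemmas sqrt_iter_norm = sqrt_iter_bounded[THEN conjunct2, rule_format]
lemmas sqrt_iter_mem = bounded_op_mem[OF sqrt_iter_op]

lemma sqrt_iter_sym:
  assumes sym: "\<And>x y. x \<in> X \<Longrightarrow> y \<in> X \<Longrightarrow> cinner (E x) y = cinner x (E y)"
  shows "x \<in> X \<Longrightarrow> y \<in> X \<Longrightarrow> cinner (sqrt_iter E n x) y = cinner x (sqrt_iter E n y)"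
proof (induction n arbitrary: x y)
  case (Suc n)
  then show ?case
    by (simp add: cinner.scaleR_left cinner.scaleR_right cinner_add_left cinner_add_right sym sqrt_iter_mem)
qed simp

text \<open>Majorisation by the scalar recursion. For consecutive iterates Y and Z, Z Z - Y Y = Z (Z
  - Y) + (Z - Y) Y, which needs no commutation, and the bounds add up to t (t - s) + (t - s) s = t^2
  - s^2.\<close>

lemma sqrt_iter_Suc_diff:
  "x \<in> X \<Longrightarrow> norm (sqrt_iter E (Suc n) x - sqrt_iter E n x) \<le> (sqrt_scal (Suc n) - sqrt_scal n) * norm x"
proof (induction n arbitrary: x)
  case 0
  then show ?case using contr[of x] bounded_op_zero[OF X E] by simp
next
  case (Suc n)
  let ?Y = "sqrt_iter E n" and ?Z = "sqrt_iter E (Suc n)"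
  let ?s = "sqrt_scal n" and ?t = "sqrt_scal (Suc n)"
  note x = Suc.prems
  have st: "0 \<le> ?s" "0 \<le> ?t" "0 \<le> ?t - ?s"
    using sqrt_scal_bounds[of n] sqrt_scal_bounds[of "Suc n"] incseq_SucD[OF sqrt_scal_mono, of n] by auto
  have "sqrt_iter E (Suc (Suc n)) x - ?Z x = (1/2) *\<^sub>R (?Z (?Z x) - ?Y (?Y x))"
    unfolding sqrt_iter.simps(2)[of E "Suc n"] by (subst (3) sqrt_iter.simps(2)) (simp only: scaleR_diff_right[symmetric] add_diff_cancel_left)
  also have "?Z (?Z x) - ?Y (?Y x) = ?Z (?Z x - ?Y x) + (?Z (?Y x) - ?Y (?Y x))"
    using bounded_op_diff[OF X sqrt_iter_op, of "?Z x" "?Y x" "Suc n"] x sqrt_iter_mem by (simp del: sqrt_iter.simps)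
  finally have "norm (sqrt_iter E (Suc (Suc n)) x - ?Z x)
      \<le> (norm (?Z (?Z x - ?Y x)) + norm (?Z (?Y x) - ?Y (?Y x))) / 2"
    using norm_triangle_ineq[of "?Z (?Z x - ?Y x)" "?Z (?Y x) - ?Y (?Y x)"] by (simp del: sqrt_iter.simps)
  also have "norm (?Z (?Z x - ?Y x)) \<le> ?t * norm (?Z x - ?Y x)"
    using x by (intro sqrt_iter_norm hilbert_diff[OF X] sqrt_iter_mem)
  also have "\<dots> \<le> ?t * ((?t - ?s) * norm x)"
    using Suc.IH[OF x] st by (intro mult_left_mono) auto
  also have "norm (?Z (?Y x) - ?Y (?Y x)) \<le> (?t - ?s) * norm (?Y x)"
    using x by (intro Suc.IH sqrt_iter_mem)
  also have "\<dots> \<le> (?t - ?s) * (?s * norm x)"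
    using sqrt_iter_norm[OF x, of n] st by (intro mult_left_mono) auto
  also have "(?t * ((?t - ?s) * norm x) + (?t - ?s) * (?s * norm x)) / 2
      = (sqrt_scal (Suc (Suc n)) - ?t) * norm x"
  proof -
    have "sqrt_scal (Suc (Suc n)) - ?t = (?t\<^sup>2 - ?s\<^sup>2) / 2"
      by (simp add: field_simps)
    then show ?thesis
      by (simp only:) (simp add: power2_eq_square field_simps del: sqrt_scal.simps)
  qed
  finally show ?case by simp
qed

lemma sqrt_iter_diff:
  assumes x: "x \<in> X" and "n \<le> m"
  shows "norm (sqrt_iter E m x - sqrt_iter E n x) \<le> (sqrt_scal m - sqrt_scal n) * norm x"
  using \<open>n \<le> m\<close>
proof (induction rule: dec_induct)
  case (step m)
  have "norm (sqrt_iter E (Suc m) x - sqrt_iter E n x)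
      \<le> norm (sqrt_iter E (Suc m) x - sqrt_iter E m x) + norm (sqrt_iter E m x - sqrt_iter E n x)"
    using norm_triangle_ineq[of "sqrt_iter E (Suc m) x - sqrt_iter E m x" "sqrt_iter E m x - sqrt_iter E n x"]
    by (simp del: sqrt_iter.simps)
  also have "\<dots> \<le> (sqrt_scal (Suc m) - sqrt_scal m) * norm x + (sqrt_scal m - sqrt_scal n) * norm x"
    by (intro add_mono step.IH sqrt_iter_Suc_diff x)
  also have "\<dots> = (sqrt_scal (Suc m) - sqrt_scal n) * norm x"
    by (simp add: left_diff_distrib del: sqrt_scal.simps)
  finally show ?case .
qed simp

lemma sqrt_iter_tendsto:
  assumes x: "x \<in> X" shows "(\<lambda>n. sqrt_iter E n x) \<longlonglongrightarrow> x - sqrt_one_minus E x"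
proof -
  have "Cauchy (\<lambda>n. sqrt_iter E n x)"
  proof (rule CauchyI)
    fix e :: real assume e: "0 < e"
    \<comment> \<open>Dividing by \<open>norm x + 1\<close> also covers
      \<open>x = 0\<close>.\<close>
    define d where "d = e / (norm x + 1)"
    have d: "0 < d" "d * norm x < e"
      using e by (auto simp: d_def divide_simps add_nonneg_pos algebra_simps add_pos_nonneg)
    obtain N where N: "\<And>m n. m \<ge> N \<Longrightarrow> n \<ge> N \<Longrightarrow> norm (sqrt_scal m - sqrt_scal n) < d"
      using CauchyD[OF sqrt_scal_Cauchy d(1)] by blast
    have *: "norm (sqrt_iter E m x - sqrt_iter E n x) < e" if "N \<le> n" "n \<le> m" for m n
    proof -
      have "norm (sqrt_iter E m x - sqrt_iter E n x) \<le> (sqrt_scal m - sqrt_scal n) * norm x"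
        by (rule sqrt_iter_diff[OF x that(2)])
      also have "\<dots> \<le> d * norm x"
        using N[of m n] that by (intro mult_right_mono) auto
      also have "\<dots> < e" by (rule d)
      finally show ?thesis .
    qed
    have "norm (sqrt_iter E m x - sqrt_iter E n x) < e" if "N \<le> n" "N \<le> m" for m n
      using *[of n m] *[of m n] that by (cases "n \<le> m") (auto simp: norm_minus_commute)
    then show "\<exists>M. \<forall>m\<ge>M. \<forall>n\<ge>M. norm (sqrt_iter E m x - sqrt_iter E n x) < e" by blast
  qed
  then show ?thesis
    by (simp add: sqrt_one_minus_def Cauchy_convergent convergent_LIMSEQ_iff[symmetric])
qed

lemma sqrt_one_minus_mem: "x \<in> X \<Longrightarrow> sqrt_one_minus E x \<in> X"
  using hilbert_limit[OF X sqrt_iter_tendsto sqrt_iter_mem, of x]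
    hilbert_diff[OF X, of x "x - sqrt_one_minus E x"] by simp

lemma norm_sqrt_one_minus: "x \<in> X \<Longrightarrow> norm (x - sqrt_one_minus E x) \<le> norm x"
proof (rule LIMSEQ_le_const2[OF tendsto_norm[OF sqrt_iter_tendsto]])
  assume x: "x \<in> X"
  have "norm (sqrt_iter E n x) \<le> norm x" for n
    using sqrt_iter_norm[OF x, of n] sqrt_scal_bounds[of n] mult_right_mono[of "sqrt_scal n" 1 "norm x"] by simp
  then show "\<exists>N. \<forall>n\<ge>N. norm (sqrt_iter E n x) \<le> norm x" by blast
qed

lemma sqrt_one_minus_eqI:
  assumes "x \<in> X" "(\<lambda>n. sqrt_iter E n x) \<longlonglongrightarrow> x - z"
  shows "sqrt_one_minus E x = z"
  using LIMSEQ_unique[OF sqrt_iter_tendsto[OF assms(1)] assms(2)] by simp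

lemma bounded_op_sqrt_one_minus: "bounded_op X X (sqrt_one_minus E)"
proof (rule bounded_opI[where K=2])
  fix x y c assume x: "x \<in> X"
  show "sqrt_one_minus E x \<in> X" by (rule sqrt_one_minus_mem[OF x])
  show "norm (sqrt_one_minus E x) \<le> 2 * norm x"
    using norm_sqrt_one_minus[OF x] norm_triangle_ineq4[of x "x - sqrt_one_minus E x"] by simp
  show "sqrt_one_minus E (c *\<^sub>C x) = c *\<^sub>C sqrt_one_minus E x"
  proof (rule sqrt_one_minus_eqI)
    show "(\<lambda>n. sqrt_iter E n (c *\<^sub>C x)) \<longlonglongrightarrow> c *\<^sub>C x - c *\<^sub>C sqrt_one_minus E x"
      using scaleC.tendsto[OF tendsto_const sqrt_iter_tendsto[OF x], of c] x
      by (simp add: bounded_op_scaleC[OF sqrt_iter_op] scaleC.diff_right)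
  qed (use x in \<open>simp add: hilbert_intros[OF X]\<close>)
  show "sqrt_one_minus E (x + y) = sqrt_one_minus E x + sqrt_one_minus E y" if y: "y \<in> X"
  proof (rule sqrt_one_minus_eqI)
    show "(\<lambda>n. sqrt_iter E n (x + y)) \<longlonglongrightarrow> x + y - (sqrt_one_minus E x + sqrt_one_minus E y)"
      using tendsto_add[OF sqrt_iter_tendsto[OF x] sqrt_iter_tendsto[OF y]] x y
      by (simp add: bounded_op_add[OF sqrt_iter_op] algebra_simps)
  qed (use x y in \<open>simp add: hilbert_intros[OF X]\<close>)
qed

lemma sqrt_one_minus_square:
  assumes x: "x \<in> X"
  shows "sqrt_one_minus E (sqrt_one_minus E x) = x - E x"
proof -
  define L where "L x = x - sqrt_one_minus E x" for x
  have LX: "L z \<in> X" if "z \<in> X" for z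
    using that by (simp add: L_def hilbert_diff[OF X] sqrt_one_minus_mem)
  have lim: "(\<lambda>n. sqrt_iter E n z) \<longlonglongrightarrow> L z" if "z \<in> X" for z
    unfolding L_def by (rule sqrt_iter_tendsto[OF that])
  \<comment> \<open>The index occurs twice in the iterated term. As the iterates are uniformly
    contractive, replacing the inner one by its limit costs nothing in the limit.\<close>
  have "(\<lambda>n. sqrt_iter E n (sqrt_iter E n x - L x)) \<longlonglongrightarrow> 0"
  proof (rule Lim_null_comparison[OF always_eventually[OF allI]])
    fix n
    have "sqrt_iter E n x - L x \<in> X"
      using x LX by (simp add: sqrt_iter_mem hilbert_diff[OF X])
    from sqrt_iter_norm[OF this, of n]
    show "norm (sqrt_iter E n (sqrt_iter E n x - L x)) \<le> norm (sqrt_iter E n x - L x)"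
      using sqrt_scal_bounds[of n] mult_right_mono[of "sqrt_scal n" 1 "norm (sqrt_iter E n x - L x)"] by simp
    show "(\<lambda>n. norm (sqrt_iter E n x - L x)) \<longlonglongrightarrow> 0"
      using lim[OF x] LIM_zero tendsto_norm_zero by blast
  qed
  from tendsto_add[OF this lim[OF LX[OF x]]]
  have "(\<lambda>n. sqrt_iter E n (sqrt_iter E n x)) \<longlonglongrightarrow> L (L x)"
    using x LX by (simp add: bounded_op_diff[OF X sqrt_iter_op] sqrt_iter_mem)
  then have "(\<lambda>n. sqrt_iter E (Suc n) x) \<longlonglongrightarrow> (1/2) *\<^sub>R (E x + L (L x))"
    unfolding sqrt_iter.simps(2) by (intro tendsto_intros)
  moreover have "(\<lambda>n. sqrt_iter E (Suc n) x) \<longlonglongrightarrow> L x"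
    using lim[OF x] by (rule LIMSEQ_Suc)
  ultimately have "L x = (1/2) *\<^sub>R (E x + L (L x))"
    using LIMSEQ_unique by blast
  from arg_cong[of _ _ "\<lambda>v. 2 *\<^sub>R v", OF this] have "E x = 2 *\<^sub>R L x - L (L x)"
    by (simp add: algebra_simps)
  moreover have "L (L x) = x - sqrt_one_minus E x - (sqrt_one_minus E x - sqrt_one_minus E (sqrt_one_minus E x))"
    using x bounded_op_diff[OF X bounded_op_sqrt_one_minus x sqrt_one_minus_mem[OF x]] by (simp add: L_def)
  ultimately show ?thesis
    by (simp add: L_def[of x] scaleR_2)
qed

lemma sqrt_one_minus_sym:
  assumes sym: "\<And>x y. x \<in> X \<Longrightarrow> y \<in> X \<Longrightarrow> cinner (E x) y = cinner x (E y)"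
    and x: "x \<in> X" and y: "y \<in> X"
  shows "cinner (sqrt_one_minus E x) y = cinner x (sqrt_one_minus E y)"
proof -
  have "(\<lambda>n. cinner (sqrt_iter E n x) y) \<longlonglongrightarrow> cinner (x - sqrt_one_minus E x) y"
    by (intro cinner.tendsto tendsto_const sqrt_iter_tendsto x)
  moreover have "(\<lambda>n. cinner x (sqrt_iter E n y)) \<longlonglongrightarrow> cinner x (y - sqrt_one_minus E y)"
    by (intro cinner.tendsto tendsto_const sqrt_iter_tendsto y)
  ultimately show ?thesis
    using LIMSEQ_unique x y by (fastforce simp: sqrt_iter_sym[OF sym] cinner.diff_left cinner.diff_right)
qed

lemma positive_op_sqrt_one_minus:
  assumes sym: "\<And>x y. x \<in> X \<Longrightarrow> y \<in> X \<Longrightarrow> cinner (E x) y = cinner x (E y)"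
  shows "positive_op X (sqrt_one_minus E)"
  unfolding positive_op_def
proof (intro conjI ballI bounded_op_sqrt_one_minus)
  fix x assume x: "x \<in> X"
  let ?B = "sqrt_one_minus E x"
  have "cnj (cinner ?B x) = cinner ?B x"
    using sqrt_one_minus_sym[OF sym x x] by (simp add: cinner_commute[of x ?B])
  then have "Im (cinner ?B x) = 0"
    by (simp add: complex_eq_iff)
  moreover have "Re (cinner (x - ?B) x) \<le> norm (x - ?B) * norm x"
    using complex_Re_le_cmod cmod_cinner_le order_trans by blast
  then have "Re (cinner (x - ?B) x) \<le> norm x * norm x"
    using norm_sqrt_one_minus[OF x] mult_right_mono[of "norm (x - ?B)" "norm x" "norm x"] by simp
  then have "0 \<le> Re (cinner ?B x)"
    by (simp add: cinner.diff_left Re_cinner_self power2_eq_square)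
  ultimately show "cinner ?B x \<in> \<real>\<^sub>\<ge>\<^sub>0"
    by (simp add: complex_nonneg_Reals_iff)
qed

end

text \<open>Every iterate is a polynomial in \<open>E\<close>, hence intertwined by
  \<open>V\<close>, and limits follow. It yields both the commutation behind uniqueness of roots and
  the exchange of the two defect operators.\<close>

lemma sqrt_one_minus_intertwine:
  fixes X :: "'a::chilbert set" and Y :: "'b::chilbert set"
  assumes X: "hilbert_subspace X" "bounded_op X X E" "\<And>x. x \<in> X \<Longrightarrow> norm (E x) \<le> norm x"
    and Y: "hilbert_subspace Y" "bounded_op Y Y F" "\<And>x. x \<in> Y \<Longrightarrow> norm (F x) \<le> norm x"
    and V: "bounded_op X Y V" and VE: "\<And>x. x \<in> X \<Longrightarrow> V (E x) = F (V x)" and x: "x \<in> X"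
  shows "V (sqrt_one_minus E x) = sqrt_one_minus F (V x)"
proof -
  have "V (sqrt_iter E n x) = sqrt_iter F n (V x)" if "x \<in> X" for n x
    using that
  proof (induction n arbitrary: x)
    case 0
    then show ?case by (simp add: bounded_op_zero[OF X(1) V])
  next
    case (Suc n)
    then show ?case
      using sqrt_iter_mem[OF X] bounded_op_mem[OF X(2)]
      by (simp add: bounded_op_scaleR[OF X(1) V] bounded_op_add[OF V] hilbert_intros[OF X(1)] VE
          del: scaleR_add_right)
  qed
  then have "(\<lambda>n. sqrt_iter F n (V x)) \<longlonglongrightarrow> V (x - sqrt_one_minus E x)"
    using bounded_op_tendsto[OF X(1) V sqrt_iter_tendsto[OF X x] sqrt_iter_mem[OF X x]] x by simp
  then show ?thesis
    using sqrt_one_minus_eqI[OF Y bounded_op_mem[OF V x]] sqrt_one_minus_mem[OF X x]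
    by (simp add: bounded_op_diff[OF X(1) V x])
qed

text \<open>\<open>B\<close> commutes with E = I - B^2 and hence with the constructed root C. For y
  = (B - C) x one gets (B + C) y = 0, so both nonnegative forms vanish at y, B y = C y = 0, and the
  squared norm of y is the inner product of x with (B - C) y.\<close>

lemma positive_sqrt_unique:
  fixes X :: "'a::chilbert set"
  assumes X: "hilbert_subspace X" "bounded_op X X E" "\<And>x. x \<in> X \<Longrightarrow> norm (E x) \<le> norm x"
    and sym: "\<And>x y. x \<in> X \<Longrightarrow> y \<in> X \<Longrightarrow> cinner (E x) y = cinner x (E y)"
    and B: "positive_op X B" "\<And>x. x \<in> X \<Longrightarrow> B (B x) = x - E x" and x: "x \<in> X"
  shows "B x = sqrt_one_minus E x"
proof -
  let ?C = "sqrt_one_minus E"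
  have C: "positive_op X ?C" by (rule positive_op_sqrt_one_minus[OF X sym])
  note Bb = positive_op_bounded[OF X(1) B(1)] and Cb = positive_op_bounded[OF X(1) C]
  note mem = bounded_op_mem[OF Bb] bounded_op_mem[OF Cb] hilbert_diff[OF X(1)]
  note diff = bounded_op_diff[OF X(1) Bb] bounded_op_diff[OF X(1) Cb]
  have E: "E z = z - B (B z)" if "z \<in> X" for z
    using B(2)[OF that] by (simp add: algebra_simps)
  have comm: "B (?C z) = ?C (B z)" if "z \<in> X" for z
  proof (rule sqrt_one_minus_intertwine[OF X X Bb _ that])
    fix w assume w: "w \<in> X"
    show "B (E w) = E (B w)"
      unfolding E[OF w] E[OF mem(1)[OF w]] using w by (simp add: diff mem)
  qed
  define y where "y = B x - ?C x"
  have y: "y \<in> X" using x by (simp add: y_def mem)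
  have "B y + ?C y = B (B x) - ?C (?C x)"
    using x by (simp add: y_def diff mem comm)
  also have "\<dots> = 0" using x by (simp add: B(2) sqrt_one_minus_square[OF X])
  finally have "Re (cinner (B y) y) + Re (cinner (?C y) y) = 0"
    by (metis cinner_add_left cinner_zero_left plus_complex.sel(1) zero_complex.sel(1))
  then have "Re (cinner (B y) y) = 0" "Re (cinner (?C y) y) = 0"
    using positive_op_Re[OF X(1) B(1) y] positive_op_Re[OF X(1) C y] by auto
  then have "B y = 0" "?C y = 0"
    using positive_op_eq_0[OF X(1) B(1) y] positive_op_eq_0[OF X(1) C y] by auto
  then have "cinner y y = 0"
    using positive_op_sym[OF X(1) B(1) x y] positive_op_sym[OF X(1) C x y]
    by (subst y_def) (simp add: cinner.diff_left)
  then show ?thesis by (simp add: cinner_self y_def)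
qed

text \<open>The operators to which the iteration with E = I - A applies. The defect I - A^* A of a
  contraction is of this kind.\<close>

definition near_one :: "'a::complex_inner set \<Rightarrow> ('a \<Rightarrow> 'a) \<Rightarrow> bool" where
  "near_one X A \<longleftrightarrow> bounded_op X X A \<and> (\<forall>x\<in>X. \<forall>y\<in>X. cinner (A x) y = cinner x (A y)) \<and>
     (\<forall>x\<in>X. norm (x - A x) \<le> norm x)"

context
  fixes X :: "'a::chilbert set" and A
  assumes X: "hilbert_subspace X" and A: "near_one X A"
begin

lemma near_one_E:
  "bounded_op X X (\<lambda>x. x - A x)" "\<And>x. x \<in> X \<Longrightarrow> norm (x - A x) \<le> norm x"
  "\<And>x y. x \<in> X \<Longrightarrow> y \<in> X \<Longrightarrow> cinner (x - A x) y = cinner x (y - A y)"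
proof -
  have Ab: "bounded_op X X A" using A by (simp add: near_one_def)
  show "bounded_op X X (\<lambda>x. x - A x)"
    by (rule bounded_opI[where K=1]) (use A in \<open>auto simp: near_one_def bounded_op_mem[OF Ab]
      bounded_op_add[OF Ab] bounded_op_scaleC[OF Ab] scaleC.diff_right hilbert_diff[OF X]\<close>)
qed (use A in \<open>auto simp: near_one_def cinner.diff_left cinner.diff_right\<close>)

lemma op_sqrt_works: "positive_op X (op_sqrt X A)" "x \<in> X \<Longrightarrow> op_sqrt X A (op_sqrt X A x) = A x"
proof -
  let ?B = "sqrt_one_minus (\<lambda>x. x - A x)"
  have "positive_op X ?B \<and> (\<forall>x\<in>X. ?B (?B x) = A x)"
    using positive_op_sqrt_one_minus[OF X near_one_E] sqrt_one_minus_square[OF X near_one_E(1,2)] by simp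
  then have "\<exists>B. positive_op X B \<and> (\<forall>x\<in>X. B (B x) = A x)" by blast
  from someI_ex[OF this] show "positive_op X (op_sqrt X A)"
    and "x \<in> X \<Longrightarrow> op_sqrt X A (op_sqrt X A x) = A x" unfolding op_sqrt_def by auto
qed

lemma op_sqrt_eq: "x \<in> X \<Longrightarrow> op_sqrt X A x = sqrt_one_minus (\<lambda>x. x - A x) x"
  by (rule positive_sqrt_unique[OF X near_one_E op_sqrt_works(1)]) (simp_all add: op_sqrt_works(2))

end

lemma op_sqrt_intertwine:
  fixes X :: "'a::chilbert set" and Y :: "'b::chilbert set"
  assumes X: "hilbert_subspace X" "near_one X A" and Y: "hilbert_subspace Y" "near_one Y B"
    and V: "bounded_op X Y V" and VA: "\<And>x. x \<in> X \<Longrightarrow> V (A x) = B (V x)" and x: "x \<in> X"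
  shows "V (op_sqrt X A x) = op_sqrt Y B (V x)"
proof -
  have Ab: "bounded_op X X A" using X by (simp add: near_one_def)
  show ?thesis
    unfolding op_sqrt_eq[OF X x] op_sqrt_eq[OF Y bounded_op_mem[OF V x]]
  proof (rule sqrt_one_minus_intertwine[OF X(1) near_one_E(1,2)[OF X] Y(1) near_one_E(1,2)[OF Y] V _ x])
    fix w assume w: "w \<in> X"
    show "V (w - A w) = V w - B (V w)"
      unfolding bounded_op_diff[OF X(1) V w bounded_op_mem[OF Ab w]] VA[OF w] ..
  qed
qed

subsection \<open>Unitary operators from dense ranges\<close>

text \<open>Equal Gram matrices turn \<open>cinner (C g) h\<close> into a functional of
  \<open>A g\<close>, bounded by \<open>norm h\<close>. Its Riesz vector is the image of
  \<open>h\<close> under the isometry \<open>C g\<close> \<mapsto> \<open>A g\<close>, obtained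
  without extending a map by continuity.\<close>

lemma isometric_factor:
  fixes X :: "'a::chilbert set" and Y :: "'b::chilbert set" and G :: "'c::chilbert set"
  assumes G: "hilbert_subspace G" and C: "bounded_op G X C" and A: "bounded_op G Y A"
    and eq: "\<And>g g'. g \<in> G \<Longrightarrow> g' \<in> G \<Longrightarrow> cinner (A g) (A g') = cinner (C g) (C g')"
    and Y: "closure (A ` G) = Y"
  shows "\<exists>u\<in>Y. (\<forall>g\<in>G. cinner (A g) u = cinner (C g) h) \<and> norm u \<le> norm h"
proof -
  have norm_eq: "norm (C g) = norm (A g)" if "g \<in> G" for g
  proof -
    have "(norm (C g))\<^sup>2 = (norm (A g))\<^sup>2"
      unfolding Re_cinner_self[symmetric] eq[OF that that] ..
    then show ?thesis by (simp add: power2_eq_iff_nonneg)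
  qed
  define F where "F a = cinner (C (inv_into G A a)) h" for a
  \<comment> \<open>Two preimages of one vector differ by an element on which \<open>A\<close>, and
    hence \<open>C\<close>, has norm 0, so the choice made by \<open>inv_into\<close> is
    immaterial.\<close>
  have F: "F (A g) = cinner (C g) h" if g: "g \<in> G" for g
  proof -
    define g' where "g' = inv_into G A (A g)"
    have g': "g' \<in> G" "A g' = A g"
      using g by (auto simp: g'_def inv_into_into f_inv_into_f)
    have "norm (C (g' - g)) = norm (A (g' - g))"
      by (intro norm_eq hilbert_diff[OF G] g g')
    then have "C g' = C g"
      using g g' by (simp add: bounded_op_diff[OF G C] bounded_op_diff[OF G A])
    then show ?thesis by (simp add: F_def g'_def)
  qed
  have S: "complex_vector.subspace (A ` G)"
    by (rule subspace_image[OF G A])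
  have "\<exists>u\<in>closure (A ` G). \<forall>x\<in>A ` G. F x = cinner x u"
  proof (rule riesz_representation[OF S, where B="norm h"])
    show "F (x + y) = F x + F y" if xy: "x \<in> A ` G" "y \<in> A ` G" for x y
    proof -
      obtain g g' where g: "x = A g" "y = A g'" "g \<in> G" "g' \<in> G" using xy by auto
      have "F (A (g + g')) = F (A g) + F (A g')"
        using g by (simp add: F hilbert_add[OF G] bounded_op_add[OF C] cinner_add_left)
      then show ?thesis using g by (simp add: bounded_op_add[OF A])
    qed
    show "F (c *\<^sub>C x) = c * F x" if xy: "x \<in> A ` G" for x c
    proof -
      obtain g where g: "x = A g" "g \<in> G" using xy by auto
      have "F (A (c *\<^sub>C g)) = c * F (A g)"
        using g by (simp add: F hilbert_scaleC[OF G] bounded_op_scaleC[OF C] cinner_scaleC_left)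
      then show ?thesis using g by (simp add: bounded_op_scaleC[OF A])
    qed
    show "cmod (F x) \<le> norm h * norm x" if xA: "x \<in> A ` G" for x
    proof -
      obtain g where g: "x = A g" "g \<in> G" using xA by auto
      then show ?thesis
        using cmod_cinner_le[of "C g" h] by (simp add: F norm_eq mult.commute)
    qed
  qed
  then obtain u where u: "u \<in> Y" "\<And>g. g \<in> G \<Longrightarrow> cinner (A g) u = cinner (C g) h"
    using F Y by auto
  \<comment> \<open>The bound is known on the range only; approximating \<open>u\<close> from the
    range allows the functional to be tested at \<open>u\<close> itself.\<close>
  obtain a where a: "\<forall>n. a n \<in> A ` G" "a \<longlonglongrightarrow> u"
    using u(1) Y closure_sequential by blast
  have "cmod (cinner (a n) u) \<le> norm h * norm (a n)" for n
  proof -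
    obtain g where g: "a n = A g" "g \<in> G" using a(1) by blast
    then show ?thesis
      using cmod_cinner_le[of "C g" h] by (simp add: u norm_eq mult.commute)
  qed
  moreover have "(\<lambda>n. cmod (cinner (a n) u)) \<longlonglongrightarrow> cmod (cinner u u)"
    "(\<lambda>n. norm h * norm (a n)) \<longlonglongrightarrow> norm h * norm u"
    by (intro tendsto_intros cinner.tendsto a)+
  ultimately have "cmod (cinner u u) \<le> norm h * norm u"
    by (intro LIMSEQ_le) auto
  then have "norm u * norm u \<le> norm h * norm u"
    by (simp add: cinner_self norm_power norm_mult power2_eq_square)
  then have "norm u \<le> norm h"
    by (cases "u = 0") auto
  then show ?thesis using u by blast
qed

lemma cinner_dense_ext:
  fixes Y :: "'b::chilbert set"
  assumes "hilbert_subspace Y" "closure S = Y" "y \<in> Y" "y' \<in> Y" "\<And>s. s \<in> S \<Longrightarrow> cinner s y = cinner s y'"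
  shows "y = y'"
proof -
  have "cinner (y - y') (y - y') = 0"
    by (rule cinner_eq_0_closure[of S]) (use assms in \<open>auto simp: cinner.diff_right hilbert_diff\<close>)
  then show ?thesis by (simp add: cinner_self)
qed

text \<open>Factoring in both directions gives mutually inverse contractions, which must be
  isometric; polarisation then recovers inner products.\<close>

lemma unitary_from_dense_ranges:
  fixes X :: "'a::chilbert set" and Y :: "'b::chilbert set" and G :: "'c::chilbert set"
  assumes XY: "hilbert_subspace X" "hilbert_subspace Y"
    and G: "hilbert_subspace G" and C: "bounded_op G X C" and A: "bounded_op G Y A"
    and eq: "\<And>g g'. g \<in> G \<Longrightarrow> g' \<in> G \<Longrightarrow> cinner (A g) (A g') = cinner (C g) (C g')"
    and CX: "closure (C ` G) = X" and AY: "closure (A ` G) = Y"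
  shows "\<exists>U. unitary_op X Y U \<and> (\<forall>h\<in>X. \<forall>g\<in>G. cinner (A g) (U h) = cinner (C g) h)"
proof -
  obtain U where U: "\<And>h. U h \<in> Y" "\<And>h g. g \<in> G \<Longrightarrow> cinner (A g) (U h) = cinner (C g) h"
    "\<And>h. norm (U h) \<le> norm h"
    using isometric_factor[OF G C A eq AY] by metis
  obtain V where V: "\<And>h. V h \<in> X" "\<And>h g. g \<in> G \<Longrightarrow> cinner (C g) (V h) = cinner (A g) h"
    "\<And>h. norm (V h) \<le> norm h"
    using isometric_factor[OF G A C eq[symmetric] CX] by metis
  have VU: "V (U h) = h" if "h \<in> X" for h
    by (rule cinner_dense_ext[OF XY(1) CX]) (use U V that in auto)
  have UV: "U (V h) = h" if "h \<in> Y" for h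
    by (rule cinner_dense_ext[OF XY(2) AY]) (use U V that in auto)
  have ext: "y = y'" if "y \<in> Y" "y' \<in> Y" "\<And>g. g \<in> G \<Longrightarrow> cinner (A g) y = cinner (A g) y'" for y y'
    by (rule cinner_dense_ext[OF XY(2) AY]) (use that in auto)
  have lin: "U (x + y) = U x + U y" "U (c *\<^sub>C x) = c *\<^sub>C U x" for x y c
    by (rule ext; simp add: U cinner_add_right cinner_scaleC_right hilbert_intros[OF XY(2)])+
  have norm: "norm (U h) = norm h" if "h \<in> X" for h
    using U(3)[of h] V(3)[of "U h"] VU[OF that] by simp
  have "cinner (U x) (U y) = cinner x y" if xy: "x \<in> X" "y \<in> X" for x y
  proof -
    have re: "Re (cinner (U x) (U y)) = Re (cinner x y)" if "x \<in> X" "y \<in> X" for x y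
    proof -
      have "norm (U (x + y)) = norm (x + y)"
        using that by (intro norm hilbert_add[OF XY(1)])
      then have "(norm (U x + U y))\<^sup>2 = (norm (x + y))\<^sup>2" by (simp add: lin)
      then show ?thesis using norm that by (simp add: norm_add_square)
    qed
    show ?thesis
    proof (rule complex_eqI)
      show "Re (cinner (U x) (U y)) = Re (cinner x y)" by (rule re[OF xy])
      show "Im (cinner (U x) (U y)) = Im (cinner x y)"
        using re[OF hilbert_scaleC[OF XY(1) xy(1), of \<i>] xy(2)] by (simp add: lin cinner_scaleC_left)
    qed
  qed
  moreover have "U ` X = Y"
  proof (intro subset_antisym subsetI)
    fix y assume "y \<in> Y"
    then show "y \<in> U ` X" using UV V(1) by (metis image_eqI)
  qed (use U(1) in auto)
  moreover have "bounded_op X Y U"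
    by (rule bounded_opI[where K=1]) (simp_all add: U lin)
  ultimately show ?thesis using U(2) unfolding unitary_op_def by blast
qed

section \<open>The Fock space with coefficients\<close>

lemma ell2_coeff_sum: "ell2_coeff (sum f A) \<alpha> = (\<Sum>i\<in>A. ell2_coeff (f i) \<alpha>)"
  by (induction A rule: infinite_finite_induct) auto

lemma bounded_op_ell2_coeff: "bounded_op UNIV UNIV (\<lambda>z. ell2_coeff z \<alpha>)"
  by (rule bounded_opI[where K=1]) (simp_all add: norm_ell2_coeff_le)

lemma tensor_add_left: "(x + y) \<otimes>\<^sub>t h = x \<otimes>\<^sub>t h + y \<otimes>\<^sub>t h"
  and tensor_scaleC_left: "(c *\<^sub>C x) \<otimes>\<^sub>t h = c *\<^sub>C (x \<otimes>\<^sub>t h)"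
  and tensor_diff_left: "(x - y) \<otimes>\<^sub>t h = x \<otimes>\<^sub>t h - y \<otimes>\<^sub>t h"
  by (rule ell2_eqI; simp add: ell2_coeff_tensor scaleC_add_left scaleC_add_right scaleC_scaleC
    scaleC_complex_def mult.commute scaleC.diff_left)+

lemma norm_tensor: "norm (x \<otimes>\<^sub>t h) = norm x * norm h"
proof -
  have "cinner (x \<otimes>\<^sub>t h) (x \<otimes>\<^sub>t h) = of_real ((norm x * norm h)\<^sup>2)"
    by (subst cinner_tensor) (simp add: cinner_self power_mult_distrib)
  from arg_cong[OF this, of Re] have "(norm (x \<otimes>\<^sub>t h))\<^sup>2 = (norm x * norm h)\<^sup>2"
    unfolding Re_cinner_self by simp
  then show ?thesis by (simp add: power2_eq_iff_nonneg)
qed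

lemma bounded_op_tensor_left: "bounded_op UNIV UNIV (\<lambda>x. x \<otimes>\<^sub>t h)"
  by (rule bounded_opI[where K="norm h"])
    (simp_all add: tensor_add_left tensor_scaleC_left norm_tensor mult.commute)

lemma cinner_fock_basis_tensor:
  "cinner z (fock_basis \<alpha> \<otimes>\<^sub>t h) = cinner (ell2_coeff z \<alpha>) h"
proof -
  have "cinner z (fock_basis \<alpha> \<otimes>\<^sub>t h) = (\<Sum>\<^sub>\<infinity>\<beta>\<in>{\<alpha>}. cinner (ell2_coeff z \<beta>) h)"
    unfolding cinner_ell2_def
    by (rule infsum_cong_neutral) (auto simp: ell2_coeff_tensor ell2_coeff_fock_basis scaleC_one)
  then show ?thesis by simp
qed

lemma norm_fock_partial_sum:
  assumes "finite A"
  shows "(norm (z - (\<Sum>\<alpha>\<in>A. fock_basis \<alpha> \<otimes>\<^sub>t ell2_coeff z \<alpha>)))\<^sup>2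
    = (norm z)\<^sup>2 - (\<Sum>\<alpha>\<in>A. (norm (ell2_coeff z \<alpha>))\<^sup>2)"
proof -
  define s where "s = (\<Sum>\<alpha>\<in>A. fock_basis \<alpha> \<otimes>\<^sub>t ell2_coeff z \<alpha>)"
  have coeff: "ell2_coeff s \<alpha> = ell2_coeff z \<alpha>" if "\<alpha> \<in> A" for \<alpha>
  proof -
    have "ell2_coeff s \<alpha> = (\<Sum>\<beta>\<in>A. if \<beta> = \<alpha> then ell2_coeff z \<alpha> else 0)"
      unfolding s_def ell2_coeff_sum
      by (intro sum.cong) (auto simp: ell2_coeff_tensor ell2_coeff_fock_basis scaleC_one)
    then show ?thesis using assms that by simp
  qed
  have *: "cinner w s = (\<Sum>\<alpha>\<in>A. cinner (ell2_coeff w \<alpha>) (ell2_coeff z \<alpha>))" for w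
    unfolding s_def cinner.sum_right cinner_fock_basis_tensor ..
  have "cinner z s = of_real (\<Sum>\<alpha>\<in>A. (norm (ell2_coeff z \<alpha>))\<^sup>2)"
    "cinner s s = of_real (\<Sum>\<alpha>\<in>A. (norm (ell2_coeff z \<alpha>))\<^sup>2)"
    unfolding * by (simp_all add: coeff cinner_self)
  then have "Re (cinner z s) = (\<Sum>\<alpha>\<in>A. (norm (ell2_coeff z \<alpha>))\<^sup>2)"
    "(norm s)\<^sup>2 = (\<Sum>\<alpha>\<in>A. (norm (ell2_coeff z \<alpha>))\<^sup>2)"
    unfolding Re_cinner_self[of s, symmetric] by simp_all
  then show ?thesis
    unfolding s_def[symmetric] norm_diff_square by simp
qed

lemma has_sum_fock: "((\<lambda>\<alpha>. fock_basis \<alpha> \<otimes>\<^sub>t ell2_coeff z \<alpha>) has_sum z) UNIV"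
proof -
  let ?f = "\<lambda>\<alpha>. fock_basis \<alpha> \<otimes>\<^sub>t ell2_coeff z \<alpha>" and ?g = "\<lambda>\<alpha>. (norm (ell2_coeff z \<alpha>))\<^sup>2"
  have "(?g has_sum (norm z)\<^sup>2) UNIV"
    using has_sum_infsum[OF ell2_summable[of z]] by (simp add: norm_ell2_square)
  then have "((\<lambda>A. sqrt ((norm z)\<^sup>2 - sum ?g A)) \<longlongrightarrow> sqrt ((norm z)\<^sup>2 - (norm z)\<^sup>2)) (finite_subsets_at_top UNIV)"
    unfolding has_sum_def by (intro tendsto_intros)
  then have "((\<lambda>A. sqrt ((norm z)\<^sup>2 - sum ?g A)) \<longlongrightarrow> 0) (finite_subsets_at_top UNIV)"
    by simp
  moreover have "\<forall>\<^sub>F A in finite_subsets_at_top UNIV. sqrt ((norm z)\<^sup>2 - sum ?g A) = norm (z - sum ?f A)"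
    by (rule eventually_mono[OF eventually_finite_subsets_at_top_weakI])
      (auto simp: norm_fock_partial_sum[symmetric])
  ultimately have "((\<lambda>A. norm (z - sum ?f A)) \<longlongrightarrow> 0) (finite_subsets_at_top UNIV)"
    by (rule Lim_transform_eventually)
  then have "((\<lambda>A. z - sum ?f A) \<longlongrightarrow> 0) (finite_subsets_at_top UNIV)"
    by (rule tendsto_norm_zero_cancel)
  from tendsto_diff[OF tendsto_const[of z] this] show ?thesis
    unfolding has_sum_def by simp
qed

lemma fock_basis_tensor_complex: "fock_basis \<alpha> \<otimes>\<^sub>t c = c *\<^sub>C fock_basis \<alpha>"
  by (rule ell2_eqI) (simp add: ell2_coeff_tensor scaleC_complex_def)

lemma closure_span_fock_basis: "closure (complex_vector.span (range fock_basis)) = UNIV"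
proof -
  have "sum (\<lambda>\<alpha>. fock_basis \<alpha> \<otimes>\<^sub>t ell2_coeff z \<alpha>) F \<in> closure (complex_vector.span (range fock_basis))"
    for F and z :: "('a, complex) fock"
    by (rule subsetD[OF closure_subset], rule complex_vector.span_sum)
      (simp add: fock_basis_tensor_complex complex_vector.span_scale complex_vector.span_base)
  then have "z \<in> closure (complex_vector.span (range fock_basis))" for z :: "('a, complex) fock"
    by (rule Lim_in_closed_set[OF closed_closure eventuallyI finite_subsets_at_top_neq_bot
          has_sum_fock[of z, unfolded has_sum_def]])
  then show ?thesis by blast
qed

subsection \<open>Sums over words\<close>

lemma finite_length_eq [simp]: "finite {\<alpha> :: 'n::finite list. length \<alpha> = k}"
  using finite_lists_length_eq[of "UNIV :: 'n set" k] by simp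

lemma finite_length_less [simp]: "finite {\<alpha> :: 'n::finite list. length \<alpha> < k}"
  by (rule finite_subset[OF _ finite_lists_length_le[of "UNIV :: 'n set" k]]) auto

lemma sum_length_Suc:
  "(\<Sum>\<alpha> | length \<alpha> = Suc k. f \<alpha>) = (\<Sum>i\<in>UNIV. \<Sum>\<beta> | length \<beta> = k. f (i # \<beta>))"
  for f :: "'n::finite list \<Rightarrow> 'b::comm_monoid_add"
proof -
  have "{\<alpha> :: 'n list. length \<alpha> = Suc k} = (\<lambda>(i, \<beta>). i # \<beta>) ` (UNIV \<times> {\<beta>. length \<beta> = k})"
    by (auto simp: image_iff length_Suc_conv)
  moreover have "inj_on (\<lambda>(i, \<beta>). i # \<beta>) (UNIV \<times> {\<beta> :: 'n list. length \<beta> = k})"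
    by (auto simp: inj_on_def)
  ultimately have "(\<Sum>\<alpha> | length \<alpha> = Suc k. f \<alpha>) = (\<Sum>(i, \<beta>)\<in>UNIV \<times> {\<beta>. length \<beta> = k}. f (i # \<beta>))"
    by (simp add: sum.reindex case_prod_unfold)
  then show ?thesis by (simp add: sum.cartesian_product)
qed

lemma sum_length_less_Suc_level:
  "(\<Sum>\<alpha> | length \<alpha> < Suc k. f \<alpha>) = (\<Sum>\<alpha> | length \<alpha> < k. f \<alpha>) + (\<Sum>\<alpha> | length \<alpha> = k. f \<alpha>)"
  for f :: "'n::finite list \<Rightarrow> 'b::comm_monoid_add"
proof -
  have "{\<alpha> :: 'n list. length \<alpha> < Suc k} = {\<alpha>. length \<alpha> < k} \<union> {\<alpha>. length \<alpha> = k}" by auto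
  then show ?thesis by (simp add: sum.union_disjoint disjoint_iff)
qed

text \<open>Splitting off the first letter rather than the last level: the inductions over words
  below replace a vector by its backward shifts, which act on the front of a word.\<close>

lemma sum_length_less_Suc:
  "(\<Sum>\<alpha> | length \<alpha> < Suc k. f \<alpha>) = f [] + (\<Sum>i\<in>UNIV. \<Sum>\<beta> | length \<beta> < k. f (i # \<beta>))"
  for f :: "'n::finite list \<Rightarrow> 'b::comm_monoid_add"
proof (induction k)
  case (Suc k)
  then show ?case
    unfolding sum_length_less_Suc_level[where k="Suc k"]
    by (simp only: sum_length_less_Suc_level[where k=k and f="\<lambda>\<beta>. f (_ # \<beta>)"] sum_length_Suc sum.distrib add.assoc)
qed simp

text \<open>Balls of words are finite, as the alphabet is, and swallow every finite set, so
  unordered sums can be taken level by level.\<close>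

lemma has_sum_length_tendsto:
  fixes f :: "'n::finite list \<Rightarrow> 'b::topological_comm_monoid_add"
  assumes "(f has_sum S) UNIV"
  shows "(\<lambda>N. \<Sum>\<alpha> | length \<alpha> < N. f \<alpha>) \<longlonglongrightarrow> S"
proof -
  have "filterlim (\<lambda>N. {\<alpha> :: 'n list. length \<alpha> < N}) (finite_subsets_at_top UNIV) sequentially"
    unfolding filterlim_finite_subsets_at_top
  proof (intro allI impI)
    fix X :: "'n list set" assume "finite X \<and> X \<subseteq> UNIV"
    then have "finite (length ` X)" by simp
    then obtain m where m: "\<forall>n\<in>length ` X. n < m"
      using finite_nat_set_iff_bounded by blast
    have "X \<subseteq> {\<alpha>. length \<alpha> < n}" if "m \<le> n" for n
      using m that by fastforce
    then show "\<forall>\<^sub>F y in sequentially. finite {\<alpha> :: 'n list. length \<alpha> < y} \<and> X \<subseteq> {\<alpha>. length \<alpha> < y}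
        \<and> {\<alpha>. length \<alpha> < y} \<subseteq> UNIV"
      unfolding eventually_sequentially by (intro exI[of _ m]) simp
  qed
  with assms show ?thesis
    unfolding has_sum_def by (rule filterlim_compose)
qed

lemma has_sum_length_sums:
  fixes f :: "'n::finite list \<Rightarrow> 'b::{topological_comm_monoid_add, t2_space}"
  assumes "(f has_sum S) UNIV"
  shows "(\<lambda>k. \<Sum>\<alpha> | length \<alpha> = k. f \<alpha>) sums S"
proof -
  have "(\<Sum>k<N. \<Sum>\<alpha> | length \<alpha> = k. f \<alpha>) = (\<Sum>\<alpha> | length \<alpha> < N. f \<alpha>)" for N
    by (induction N) (simp_all add: sum_length_less_Suc_level)
  then show ?thesis
    using has_sum_length_tendsto[OF assms] by (simp add: sums_def)
qed

subsection \<open>Creation operators and their adjoints\<close>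

text \<open>The adjoint of S_\<alpha> \<otimes> I, written on coefficients so that it composes along
  words; for one letter the adjunction is \<open>cinner_creation\<close>.\<close>

definition ell2_shift :: "'n list \<Rightarrow> ('n, 'a::complex_inner) fock \<Rightarrow> ('n, 'a) fock" where
  "ell2_shift \<alpha> z = Abs_ell2 (\<lambda>\<beta>. ell2_coeff z (\<alpha> @ \<beta>))"

text \<open>S_i \<otimes> I on coefficients, which avoids the choice in \<open>ampliation\<close>
  and covers all coefficient spaces at once.\<close>

definition creation :: "'n \<Rightarrow> ('n, 'a::complex_inner) fock \<Rightarrow> ('n, 'a) fock" where
  "creation i z = Abs_ell2 (\<lambda>\<alpha>. case \<alpha> of [] \<Rightarrow> 0 | j # \<beta> \<Rightarrow> if j = i then ell2_coeff z \<beta> else 0)"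

lemma ell2_coeff_shift [simp]: "ell2_coeff (ell2_shift \<alpha> z) \<beta> = ell2_coeff z (\<alpha> @ \<beta>)"
proof -
  have "(\<lambda>\<gamma>. (norm (ell2_coeff z \<gamma>))\<^sup>2) summable_on range ((@) \<alpha>)"
    using ell2_summable by (rule summable_on_subset_banach) simp
  then have "(\<lambda>\<beta>. (norm (ell2_coeff z (\<alpha> @ \<beta>)))\<^sup>2) summable_on UNIV"
    by (subst (asm) summable_on_reindex) (auto simp: inj_on_def o_def)
  then show ?thesis by (simp add: ell2_shift_def ell2_coeff_Abs)
qed

lemma ell2_coeff_creation:
  "ell2_coeff (creation i z) \<alpha> = (case \<alpha> of [] \<Rightarrow> 0 | j # \<beta> \<Rightarrow> if j = i then ell2_coeff z \<beta> else 0)"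
proof -
  define f where
    "f = (\<lambda>\<alpha>. case \<alpha> of [] \<Rightarrow> 0 | j # \<beta> \<Rightarrow> if j = i then ell2_coeff z \<beta> else 0)"
  have "(\<lambda>\<alpha>. (norm (f \<alpha>))\<^sup>2) summable_on range ((#) i)"
    by (subst summable_on_reindex) (auto simp: o_def f_def ell2_summable)
  then have "(\<lambda>\<alpha>. (norm (f \<alpha>))\<^sup>2) summable_on UNIV"
    by (rule summable_on_cong_neutral[THEN iffD1, rotated -1])
      (auto simp: f_def image_iff split: list.splits)
  then show ?thesis
    by (simp add: creation_def ell2_coeff_Abs flip: f_def)
qed

lemma ell2_coeff_creation_simps [simp]:
  "ell2_coeff (creation i z) [] = 0"
  "ell2_coeff (creation i z) (j # \<beta>) = (if j = i then ell2_coeff z \<beta> else 0)"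
  by (simp_all add: ell2_coeff_creation)

lemma left_creation_eq: "left_creation i = creation i"
  by (intro ext ell2_eqI) (simp add: ell2_coeff_creation ell2_coeff_left_creation)

lemma ell2_shift_Nil [simp]: "ell2_shift [] z = z"
  by (rule ell2_eqI) simp

lemma ell2_shift_append: "ell2_shift (\<alpha> @ \<beta>) z = ell2_shift \<beta> (ell2_shift \<alpha> z)"
  by (rule ell2_eqI) simp

lemma ell2_shift_creation: "ell2_shift [j] (creation i z) = (if j = i then z else 0)"
  by (rule ell2_eqI) simp

lemma ell2_shift_zero [simp]: "ell2_shift \<alpha> 0 = 0"
  by (rule ell2_eqI) simp

lemma creation_tensor: "creation i (x \<otimes>\<^sub>t h) = creation i x \<otimes>\<^sub>t h"
  by (rule ell2_eqI) (simp add: ell2_coeff_creation ell2_coeff_tensor split: list.split)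

lemma ell2_shift_tensor: "ell2_shift \<alpha> (x \<otimes>\<^sub>t h) = ell2_shift \<alpha> x \<otimes>\<^sub>t h"
  by (rule ell2_eqI) (simp add: ell2_coeff_tensor)

lemma creation_fock_basis: "creation i (fock_basis \<alpha>) = fock_basis (i # \<alpha>)"
  using left_creation_fock_basis by (simp add: left_creation_eq)

text \<open>The orthogonal decomposition I = P + \<Sum> S_i S_i^* with P the projection to the
  vacuum component: a word is empty or has a unique first letter.\<close>

lemma fock_cinner_split:
  fixes y z :: "('n::finite, 'a::complex_inner) fock"
  shows "cinner y z = cinner (ell2_coeff y []) (ell2_coeff z [])
    + (\<Sum>i\<in>UNIV. cinner (ell2_shift [i] y) (ell2_shift [i] z))"
proof -
  let ?f = "\<lambda>\<alpha>. cinner (ell2_coeff y \<alpha>) (ell2_coeff z \<alpha>)"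
  have "(?f has_sum cinner (ell2_shift [i] y) (ell2_shift [i] z)) (range ((#) i))" for i
  proof -
    have "((?f \<circ> (#) i) has_sum cinner (ell2_shift [i] y) (ell2_shift [i] z)) UNIV"
      using has_sum_infsum[OF ell2_cinner_summable[of "ell2_shift [i] y" "ell2_shift [i] z"]]
      by (simp add: cinner_ell2_def o_def)
    then show ?thesis by (subst has_sum_reindex) auto
  qed
  then have "(?f has_sum (\<Sum>i\<in>UNIV. cinner (ell2_shift [i] y) (ell2_shift [i] z))) (\<Union>i\<in>UNIV. range ((#) i))"
    by (intro sum_has_sum) auto
  then have "(?f has_sum (?f [] + (\<Sum>i\<in>UNIV. cinner (ell2_shift [i] y) (ell2_shift [i] z))))
      (insert [] (\<Union>i\<in>UNIV. range ((#) i)))"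
    by (intro has_sum_insert) auto
  moreover have "insert [] (\<Union>i\<in>UNIV. range ((#) i)) = (UNIV :: 'n list set)"
  proof -
    have "\<alpha> \<in> insert [] (\<Union>i\<in>UNIV. range ((#) i))" for \<alpha> :: "'n list"
      by (cases \<alpha>) auto
    then show ?thesis by blast
  qed
  ultimately show ?thesis
    unfolding cinner_ell2_def[of y z] by (simp add: infsumI)
qed

lemma fock_norm_split:
  fixes y :: "('n::finite, 'a::complex_inner) fock"
  shows "(norm y)\<^sup>2 = (norm (ell2_coeff y []))\<^sup>2 + (\<Sum>i\<in>UNIV. (norm (ell2_shift [i] y))\<^sup>2)"
  using arg_cong[OF fock_cinner_split[of y y], of Re] by (simp add: Re_cinner_self)

lemma fock_norm_split_level:
  fixes y :: "('n::finite, 'a::complex_inner) fock"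
  shows "(norm y)\<^sup>2 = (\<Sum>\<alpha> | length \<alpha> < N. (norm (ell2_coeff y \<alpha>))\<^sup>2) + (\<Sum>\<alpha> | length \<alpha> = N. (norm (ell2_shift \<alpha> y))\<^sup>2)"
proof (induction N arbitrary: y)
  case (Suc N)
  show ?case
    unfolding fock_norm_split[of y] sum_length_less_Suc sum_length_Suc Suc.IH[of "ell2_shift [_] y"]
    by (simp add: sum.distrib ell2_shift_append[symmetric])
qed simp

lemma fock_norm_tendsto:
  fixes y :: "('n::finite, 'a::complex_inner) fock"
  shows "(\<lambda>N. \<Sum>\<alpha> | length \<alpha> < N. (norm (ell2_coeff y \<alpha>))\<^sup>2) \<longlonglongrightarrow> (norm y)\<^sup>2"
  unfolding norm_ell2_square by (intro has_sum_length_tendsto has_sum_infsum ell2_summable)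

lemma norm_ell2_shift_single_le: "norm (ell2_shift [i] z) \<le> norm (z :: ('n::finite, 'a::complex_inner) fock)"
proof -
  have "(norm (ell2_shift [i] z))\<^sup>2 \<le> (\<Sum>i\<in>UNIV. (norm (ell2_shift [i] z))\<^sup>2)"
    by (rule member_le_sum) auto
  then have "(norm (ell2_shift [i] z))\<^sup>2 \<le> (norm z)\<^sup>2"
    unfolding fock_norm_split[of z] by (rule order_trans) simp
  then show ?thesis by (simp add: power2_le_iff_abs_le)
qed

lemma norm_creation: "norm (creation i z) = norm (z :: ('n::finite, 'a::complex_inner) fock)"
proof -
  have "(norm (creation i z))\<^sup>2 = (\<Sum>j\<in>UNIV. if j = i then (norm z)\<^sup>2 else 0)"
    unfolding fock_norm_split[of "creation i z"]
    by (simp add: ell2_shift_creation if_distrib[of norm] if_distrib[of "\<lambda>x. x\<^sup>2"] cong: if_cong)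
  then show ?thesis by (simp add: power2_eq_iff_nonneg)
qed

lemma bounded_op_creation:
  "bounded_op UNIV UNIV (creation i :: ('n::finite, 'a::complex_inner) fock \<Rightarrow> _)"
proof (rule bounded_opI[where K=1])
  show "creation i (x + y) = creation i x + creation i y"
    "creation i (c *\<^sub>C x) = c *\<^sub>C creation i x" for x y :: "('n, 'a) fock" and c
    by (rule ell2_eqI; simp add: ell2_coeff_creation split: list.split)+
qed (simp_all add: norm_creation)

lemma bounded_op_ell2_shift:
  "bounded_op UNIV UNIV (ell2_shift [i] :: ('n::finite, 'a::complex_inner) fock \<Rightarrow> _)"
proof (rule bounded_opI[where K=1])
  show "ell2_shift [i] (x + y) = ell2_shift [i] x + ell2_shift [i] y"
    "ell2_shift [i] (c *\<^sub>C x) = c *\<^sub>C ell2_shift [i] x" for x y :: "('n, 'a) fock" and c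
    by (rule ell2_eqI; simp)+
qed (simp_all add: norm_ell2_shift_single_le)

lemma cinner_creation:
  fixes z w :: "('n::finite, 'a::complex_inner) fock"
  shows "cinner (creation i z) w = cinner z (ell2_shift [i] w)"
proof -
  have "cinner (creation i z) w = (\<Sum>j\<in>UNIV. if j = i then cinner z (ell2_shift [j] w) else 0)"
    unfolding fock_cinner_split[of "creation i z" w]
    by (simp add: ell2_shift_creation if_distrib[of "\<lambda>x. cinner x _"] cong: if_cong)
  then show ?thesis by simp
qed

subsection \<open>Tensor products of subspaces\<close>

lemma hilbert_tensor [simp]:
  "hilbert_subspace ((N :: ('n, complex) fock set) \<otimes>\<^sub>s (K :: 'a::chilbert set))"
  unfolding tensor_space_def by (intro hilbert_closure complex_vector.subspace_span)

lemma tensor_mem: "x \<in> N \<Longrightarrow> h \<in> K \<Longrightarrow> x \<otimes>\<^sub>t h \<in> N \<otimes>\<^sub>s K"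
  unfolding tensor_space_def
  by (rule subsetD[OF closure_subset]) (auto intro: complex_vector.span_base)

lemma tensor_space_least:
  fixes K :: "'a::chilbert set"
  assumes W: "hilbert_subspace W" and "\<And>x h. x \<in> N \<Longrightarrow> h \<in> K \<Longrightarrow> x \<otimes>\<^sub>t h \<in> W"
  shows "N \<otimes>\<^sub>s K \<subseteq> W"
  unfolding tensor_space_def using assms
  by (intro closure_minimal complex_vector.span_minimal) (auto simp: hilbert_subspace_def)

lemma tensor_space_mono:
  fixes K :: "'a::chilbert set"
  shows "N \<subseteq> N' \<Longrightarrow> K \<subseteq> K' \<Longrightarrow> N \<otimes>\<^sub>s K \<subseteq> N' \<otimes>\<^sub>s K'"
  by (rule tensor_space_least) (auto intro: tensor_mem)

lemma tensor_op_eqI: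
  fixes K :: "'a::chilbert set"
  assumes "bounded_op (N \<otimes>\<^sub>s K) Y A" "bounded_op (N \<otimes>\<^sub>s K) Z B"
    "\<And>x h. x \<in> N \<Longrightarrow> h \<in> K \<Longrightarrow> A (x \<otimes>\<^sub>t h) = B (x \<otimes>\<^sub>t h)" "z \<in> N \<otimes>\<^sub>s K"
  shows "A z = B z"
  using assms(3)
  by (intro bounded_op_eq_closure_span[OF hilbert_tensor assms(1,2) _ _ _ assms(4),
        where S="{x \<otimes>\<^sub>t h |x h. x \<in> N \<and> h \<in> K}"])
    (auto simp: tensor_mem tensor_space_def[symmetric])

lemma tensor_orthI:
  fixes K :: "'a::chilbert set"
  assumes "\<And>x h. x \<in> N \<Longrightarrow> h \<in> K \<Longrightarrow> cinner (x \<otimes>\<^sub>t h) w = 0" "z \<in> N \<otimes>\<^sub>s K"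
  shows "cinner z w = 0"
  by (rule cinner_eq_0_closure_span[OF _ assms(2)[unfolded tensor_space_def]]) (use assms(1) in auto)

text \<open>One explicit bounded \<open>M\<close> shows that the choice in \<open>ampliation\<close>
  is not vacuous; totality of the elementary tensors shows that it is unique.\<close>

lemma ampliation_eqI:
  fixes K :: "'a::chilbert set"
  assumes "bounded_op (N \<otimes>\<^sub>s K) (N \<otimes>\<^sub>s K) M" "\<And>x h. x \<in> N \<Longrightarrow> h \<in> K \<Longrightarrow> M (x \<otimes>\<^sub>t h) = A x \<otimes>\<^sub>t h"
    "z \<in> N \<otimes>\<^sub>s K"
  shows "ampliation N K A z = M z"
proof -
  have "\<exists>M. bounded_op (N \<otimes>\<^sub>s K) (N \<otimes>\<^sub>s K) M \<and> (\<forall>x\<in>N. \<forall>h\<in>K. M (x \<otimes>\<^sub>t h) = A x \<otimes>\<^sub>t h)"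
    using assms(1,2) by blast
  from someI_ex[OF this] have amp: "bounded_op (N \<otimes>\<^sub>s K) (N \<otimes>\<^sub>s K) (ampliation N K A)"
    "\<forall>x\<in>N. \<forall>h\<in>K. ampliation N K A (x \<otimes>\<^sub>t h) = A x \<otimes>\<^sub>t h"
    unfolding ampliation_def by auto
  show ?thesis
    by (rule tensor_op_eqI[OF amp(1) assms(1) _ assms(3)]) (use amp(2) assms(2) in auto)
qed

lemma tensor_coeff_mem:
  fixes K :: "'a::chilbert set"
  assumes K: "hilbert_subspace K" and "z \<in> N \<otimes>\<^sub>s K"
  shows "ell2_coeff z \<alpha> \<in> K"
proof -
  let ?W = "{z. \<forall>\<alpha>. ell2_coeff z \<alpha> \<in> K}"
  have "closed ?W"
  proof (unfold closed_sequential_limits, intro allI impI CollectI)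
    fix f l \<alpha> assume f: "(\<forall>n. f n \<in> ?W) \<and> f \<longlonglongrightarrow> l"
    then have "(\<lambda>n. ell2_coeff (f n) \<alpha>) \<longlonglongrightarrow> ell2_coeff l \<alpha>"
      by (intro bounded_op_tendsto[OF hilbert_UNIV bounded_op_ell2_coeff]) auto
    then show "ell2_coeff l \<alpha> \<in> K"
      by (rule hilbert_limit[OF K]) (use f in auto)
  qed
  then have "hilbert_subspace ?W"
    by (auto simp: hilbert_subspace_def complex_vector.subspace_def hilbert_intros[OF K])
  then have "N \<otimes>\<^sub>s K \<subseteq> ?W"
    by (rule tensor_space_least) (auto simp: ell2_coeff_tensor hilbert_scaleC[OF K])
  then show ?thesis using assms(2) by blast
qed

lemma tensor_UNIV_memI:
  fixes K :: "'a::chilbert set"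
  assumes K: "hilbert_subspace K" and z: "\<And>\<alpha>. ell2_coeff z \<alpha> \<in> K"
  shows "z \<in> UNIV \<otimes>\<^sub>s K"
proof -
  let ?P = "proj (UNIV \<otimes>\<^sub>s K) z"
  have P: "?P \<in> UNIV \<otimes>\<^sub>s K" by (rule proj_mem) simp
  have "ell2_coeff (z - ?P) \<alpha> = 0" for \<alpha>
  proof -
    have mem: "ell2_coeff (z - ?P) \<alpha> \<in> K"
      using z tensor_coeff_mem[OF K P] hilbert_diff[OF K] by simp
    then have "cinner (z - ?P) (fock_basis \<alpha> \<otimes>\<^sub>t ell2_coeff (z - ?P) \<alpha>) = 0"
      by (intro proj_orth tensor_mem) auto
    then show ?thesis
      unfolding cinner_fock_basis_tensor by (simp add: cinner_self)
  qed
  then have "z - ?P = 0" by (intro ell2_eqI) simp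
  with P show ?thesis by simp
qed

lemma proj_tensor:
  fixes K :: "'a::chilbert set"
  assumes N: "hilbert_subspace N" and h: "h \<in> K"
  shows "proj (N \<otimes>\<^sub>s K) (x \<otimes>\<^sub>t h) = proj N x \<otimes>\<^sub>t h"
proof (rule proj_eqI[OF hilbert_tensor])
  show "proj N x \<otimes>\<^sub>t h \<in> N \<otimes>\<^sub>s K"
    by (rule tensor_mem[OF proj_mem[OF N] h])
  fix z assume z: "z \<in> N \<otimes>\<^sub>s K"
  have "cinner z ((x - proj N x) \<otimes>\<^sub>t h) = 0"
  proof (rule tensor_orthI[OF _ z])
    fix y k assume "y \<in> N"
    then have "cinner y (x - proj N x) = 0"
      unfolding cinner_commute_0[of y] by (rule proj_orth[OF N])
    then show "cinner (y \<otimes>\<^sub>t k) ((x - proj N x) \<otimes>\<^sub>t h) = 0"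
      by (simp add: cinner_tensor)
  qed
  then show "cinner z (x \<otimes>\<^sub>t h) = cinner z (proj N x \<otimes>\<^sub>t h)"
    by (simp add: tensor_diff_left cinner.diff_right)
qed

lemma ampliation_compression:
  fixes K :: "'a::chilbert set"
  assumes N: "hilbert_subspace N" and M: "bounded_op UNIV UNIV M"
    "\<And>x h. M (x \<otimes>\<^sub>t h) = A x \<otimes>\<^sub>t h" and z: "z \<in> N \<otimes>\<^sub>s K"
  shows "ampliation N K (\<lambda>x. proj N (A x)) z = proj (N \<otimes>\<^sub>s K) (M z)"
proof (rule ampliation_eqI[OF _ _ z])
  show "bounded_op (N \<otimes>\<^sub>s K) (N \<otimes>\<^sub>s K) (\<lambda>z. proj (N \<otimes>\<^sub>s K) (M z))"
    by (rule bounded_op_subset[OF bounded_op_comp[OF M(1) bounded_op_proj[of "N \<otimes>\<^sub>s K"]]])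
      (simp_all add: proj_mem)
qed (simp add: M(2) proj_tensor[OF N])

text \<open>The slice of \<open>z\<close> along \<open>h\<close>, with \<open>\<alpha>\<close>-coefficient \<open>\<langle>z\<^sub>\<alpha>, h\<rangle>\<close>.\<close>

definition slice :: "'a::chilbert \<Rightarrow> ('n, 'a) fock \<Rightarrow> ('n, complex) fock" where
  "slice h = adj UNIV UNIV (\<lambda>x. x \<otimes>\<^sub>t h)"

lemma bounded_op_slice: "bounded_op UNIV UNIV (slice h)"
  unfolding slice_def by (intro bounded_op_adj bounded_op_tensor_left) simp_all

lemma cinner_slice: "cinner x (slice h z) = cinner (x \<otimes>\<^sub>t h) z"
  unfolding slice_def
  by (rule cinner_adj[OF hilbert_UNIV hilbert_UNIV bounded_op_tensor_left, symmetric]) simp_all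

text \<open>Slicing acts on the coefficient space and creation on words. This brings
  coefficient-valued operators down to the scalar Fock space, where the algebra acts.\<close>

lemma slice_creation: "slice h (creation i z) = creation i (slice h (z :: ('n::finite, 'a::chilbert) fock))"
proof (rule cinner_ext[OF hilbert_UNIV])
  fix x :: "('n, complex) fock"
  have "cinner (creation i z) (x \<otimes>\<^sub>t h) = cinner z (ell2_shift [i] x \<otimes>\<^sub>t h)"
    by (simp add: cinner_creation ell2_shift_tensor)
  then have 1: "cinner (x \<otimes>\<^sub>t h) (creation i z) = cinner (ell2_shift [i] x \<otimes>\<^sub>t h) z"
    by (rule cinner_flip)
  have "cinner (ell2_shift [i] x) (slice h z) = cinner x (creation i (slice h z))"
    by (rule cinner_flip[OF cinner_creation[symmetric]])
  then show "cinner x (slice h (creation i z)) = cinner x (creation i (slice h z))"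
    by (simp add: cinner_slice 1)
qed simp_all

section \<open>Row contractions\<close>

lemma norm_vec_square: "(norm (v :: 'a::complex_inner ^ 'n))\<^sup>2 = (\<Sum>i\<in>UNIV. (norm (v $ i))\<^sup>2)"
  unfolding Re_cinner_self[symmetric] cinner_vec_def by simp

lemma scaleC_vec_nth: "(c *\<^sub>C (v :: 'a::complex_inner ^ 'n)) $ i = c *\<^sub>C v $ i"
  by (simp add: scaleC_vec_def)

lemma bounded_op_vec_nth: "bounded_op UNIV UNIV (\<lambda>v :: 'a::complex_inner ^ 'n. v $ i)"
  by (rule bounded_opI[where K=1]) (simp_all add: scaleC_vec_def Finite_Cartesian_Product.norm_nth_le)

lemma near_one_defect:
  fixes X :: "'a::chilbert set" and Y :: "'b::chilbert set"
  assumes X: "hilbert_subspace X" and Y: "hilbert_subspace Y" and A: "bounded_op X Y A"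
    and le: "\<And>x. x \<in> X \<Longrightarrow> norm (A x) \<le> norm x"
  shows "near_one X (\<lambda>x. x - adj X Y A (A x))"
  unfolding near_one_def
proof (intro conjI ballI)
  let ?B = "adj X Y A"
  note B = bounded_op_adj[OF X Y A]
  note mem = bounded_op_mem[OF A] bounded_op_mem[OF B]
  show "bounded_op X X (\<lambda>x. x - ?B (A x))"
  proof (rule bounded_opI[where K=2])
    fix x y c assume x: "x \<in> X"
    show "x - ?B (A x) \<in> X" using x by (simp add: hilbert_diff[OF X] mem)
    show "x + y - ?B (A (x + y)) = x - ?B (A x) + (y - ?B (A y))" if "y \<in> X"
      using x that by (simp add: bounded_op_add[OF A] bounded_op_add[OF B] mem)
    show "c *\<^sub>C x - ?B (A (c *\<^sub>C x)) = c *\<^sub>C (x - ?B (A x))"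
      using x by (simp add: bounded_op_scaleC[OF A] bounded_op_scaleC[OF B] mem scaleC.diff_right)
    have "norm (?B (A x)) \<le> 1 * norm (A x)"
      by (rule norm_adj_le[OF X Y A]) (use le x mem in auto)
    then have "norm (?B (A x)) \<le> norm x" using le[OF x] by simp
    then show "norm (x - ?B (A x)) \<le> 2 * norm x"
      using norm_triangle_ineq4[of x "?B (A x)"] by simp
  qed
next
  fix x y assume x: "x \<in> X" and y: "y \<in> X"
  show "cinner (x - adj X Y A (A x)) y = cinner x (y - adj X Y A (A y))"
    using x y cinner_adj[OF X Y A x bounded_op_mem[OF A y]] cinner_adj'[OF X Y A y bounded_op_mem[OF A x]]
    by (simp add: cinner.diff_left cinner.diff_right)
next
  fix x assume x: "x \<in> X"
  have "norm (adj X Y A (A x)) \<le> 1 * norm (A x)"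
    by (rule norm_adj_le[OF X Y A]) (use le x bounded_op_mem[OF A] in auto)
  then show "norm (x - (x - adj X Y A (A x))) \<le> norm x"
    using le[OF x] by simp
qed

lemma bounded_op_closure_mem:
  fixes A :: "'a::chilbert \<Rightarrow> 'b::complex_inner"
  assumes A: "bounded_op UNIV UNIV A" and W: "closed W" and S: "\<And>s. s \<in> S \<Longrightarrow> A s \<in> W"
    and x: "x \<in> closure S"
  shows "A x \<in> W"
proof -
  obtain f where f: "\<forall>n. f n \<in> S" "f \<longlonglongrightarrow> x"
    using x closure_sequential by blast
  have "(\<lambda>n. A (f n)) \<longlonglongrightarrow> A x"
    using f(2) by (rule bounded_op_tendsto[OF hilbert_UNIV A]) simp
  moreover have "\<forall>n. A (f n) \<in> W" using f(1) S by simp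
  ultimately show ?thesis
    by (intro W[unfolded closed_sequential_limits, rule_format] conjI)
qed

lemma finite_words_bounded:
  assumes "finite A" obtains N where "A \<subseteq> {\<alpha> :: 'n::finite list. length \<alpha> < N}"
proof -
  obtain m where "\<forall>n\<in>length ` A. n < m"
    using finite_nat_set_iff_bounded assms by blast
  then show ?thesis by (intro that[of m]) auto
qed

lemma ell2_exists_level:
  fixes f :: "'n::finite list \<Rightarrow> 'b::complex_inner"
  assumes "\<And>N. (\<Sum>\<alpha> | length \<alpha> < N. (norm (f \<alpha>))\<^sup>2) \<le> e\<^sup>2" "0 \<le> e"
  shows "ell2_coeff (Abs_ell2 f) = f \<and> norm (Abs_ell2 f) \<le> e"
proof -
  have "\<exists>x. ell2_coeff x = f \<and> norm x \<le> e"
  proof (rule square_sum_bounded_ell2[OF _ assms(2)])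
    fix A :: "'n list set" assume "finite A"
    then obtain N where N: "A \<subseteq> {\<alpha>. length \<alpha> < N}" by (rule finite_words_bounded)
    have "(\<Sum>\<alpha>\<in>A. (norm (f \<alpha>))\<^sup>2) \<le> (\<Sum>\<alpha> | length \<alpha> < N. (norm (f \<alpha>))\<^sup>2)"
      by (rule sum_mono2) (use N in auto)
    then show "(\<Sum>\<alpha>\<in>A. (norm (f \<alpha>))\<^sup>2) \<le> e\<^sup>2" using assms(1)[of N] by simp
  qed
  then show ?thesis by (metis ell2_coeff_inverse)
qed

lemma ampliation_creation:
  fixes K :: "'a::chilbert set" and z :: "('n::finite, 'a) fock"
  assumes "hilbert_subspace K" "z \<in> UNIV \<otimes>\<^sub>s K"
  shows "ampliation UNIV K (left_creation i) z = creation i z"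
proof (rule ampliation_eqI[OF _ _ assms(2)])
  show "bounded_op (UNIV \<otimes>\<^sub>s K) (UNIV \<otimes>\<^sub>s K) (creation i)"
  proof (rule bounded_op_subset[OF bounded_op_creation])
    fix x :: "('n, 'a) fock" assume x: "x \<in> UNIV \<otimes>\<^sub>s K"
    show "creation i x \<in> UNIV \<otimes>\<^sub>s K"
    proof (rule tensor_UNIV_memI[OF assms(1)])
      show "ell2_coeff (creation i x) \<alpha> \<in> K" for \<alpha>
        using tensor_coeff_mem[OF assms(1) x] hilbert_0[OF assms(1)]
        by (simp add: ell2_coeff_creation split: list.split)
    qed
  qed simp
qed (simp add: creation_tensor left_creation_eq)

declare word_op.simps [simp del]

locale row_contraction_op =
  fixes T :: "'n::finite \<Rightarrow> 'h::chilbert \<Rightarrow> 'h"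
  assumes row: "row_contraction UNIV T"
begin

abbreviation Ta where "Ta i \<equiv> adj UNIV UNIV (T i)"
abbreviation R where "R \<equiv> row_op T"
abbreviation Ra where "Ra \<equiv> adj UNIV UNIV (row_op T)"
abbreviation D where "D \<equiv> Delta T"
abbreviation Ds where "Ds \<equiv> Delta_star T"
abbreviation Tw where "Tw \<alpha> \<equiv> adj UNIV UNIV (word_op T \<alpha>)"

lemma T_op: "bounded_op UNIV UNIV (T i)"
  using row by (simp add: row_contraction_def)

lemma Ta_op: "bounded_op UNIV UNIV (Ta i)"
  by (intro bounded_op_adj hilbert_UNIV T_op)

lemma cinner_T: "cinner (T i x) y = cinner x (Ta i y)"
  by (intro cinner_adj hilbert_UNIV T_op UNIV_I)

lemma cinner_T': "cinner y (T i x) = cinner (Ta i y) x"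
  by (rule cinner_flip) (rule cinner_T)

lemma sum_norm_Ta_le: "(\<Sum>i\<in>UNIV. (norm (Ta i h))\<^sup>2) \<le> (norm h)\<^sup>2"
proof -
  have "cinner (h - (\<Sum>i\<in>UNIV. T i (Ta i h))) h \<in> \<real>\<^sub>\<ge>\<^sub>0"
    using row by (simp add: row_contraction_def positive_op_def)
  then have "0 \<le> Re (cinner (h - (\<Sum>i\<in>UNIV. T i (Ta i h))) h)"
    by (simp add: complex_nonneg_Reals_iff)
  also have "\<dots> = (norm h)\<^sup>2 - (\<Sum>i\<in>UNIV. (norm (Ta i h))\<^sup>2)"
    by (simp add: cinner.diff_left cinner.sum_left cinner_T Re_cinner_self)
  finally show ?thesis by simp
qed

lemma R_op: "bounded_op UNIV UNIV R"
proof -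
  have "bounded_op UNIV UNIV (\<lambda>v. T i (v $ i))" for i
    by (rule bounded_op_comp[OF bounded_op_vec_nth T_op])
  then have "bounded_op UNIV UNIV (\<lambda>v. \<Sum>i\<in>UNIV. T i (v $ i))"
    by (intro bounded_op_sum_op)
  then show ?thesis by (simp add: row_op_def[abs_def])
qed

lemma Ra_op: "bounded_op UNIV UNIV Ra"
  by (intro bounded_op_adj hilbert_UNIV R_op)

lemma cinner_R: "cinner (R v) h = cinner v (Ra h)"
  by (intro cinner_adj hilbert_UNIV R_op UNIV_I)

lemma cinner_R': "cinner h (R v) = cinner (Ra h) v"
  by (rule cinner_flip) (rule cinner_R)

lemma Ra_eq: "Ra h = (\<chi> i. Ta i h)"
  by (rule adj_eqI[OF hilbert_UNIV hilbert_UNIV R_op])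
    (simp_all add: row_op_def cinner.sum_left cinner_vec_def cinner_T)

lemma Ra_nth: "Ra h $ i = Ta i h"
  by (simp add: Ra_eq)

lemma norm_Ra_le: "norm (Ra h) \<le> norm h"
proof -
  have "(norm (Ra h))\<^sup>2 \<le> (norm h)\<^sup>2"
    using sum_norm_Ta_le by (simp add: norm_vec_square Ra_nth)
  then show ?thesis by (simp add: power2_le_iff_abs_le)
qed

lemma adj_Ra: "adj UNIV UNIV Ra = R"
  by (rule ext) (intro adj_adj hilbert_UNIV R_op UNIV_I)

lemma norm_R_le: "norm (R v) \<le> norm v"
  using norm_adj_le[OF hilbert_UNIV hilbert_UNIV Ra_op, of 1 v] norm_Ra_le
  by (simp add: adj_Ra)

lemma R_Ra: "R (Ra h) = (\<Sum>i\<in>UNIV. T i (Ta i h))"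
  by (simp add: row_op_def Ra_nth)

lemma Delta_eq: "D = op_sqrt UNIV (\<lambda>h. h - R (Ra h))"
  unfolding Delta_def R_Ra ..

lemma near_one_D: "near_one UNIV (\<lambda>h. h - R (Ra h))"
  using near_one_defect[OF hilbert_UNIV hilbert_UNIV Ra_op norm_Ra_le] by (simp add: adj_Ra)

lemma near_one_Ds: "near_one UNIV (\<lambda>v. v - Ra (R v))"
  by (rule near_one_defect[OF hilbert_UNIV hilbert_UNIV R_op norm_R_le])

lemmas D_positive = op_sqrt_works(1)[OF hilbert_UNIV near_one_D, folded Delta_eq]
lemmas Ds_positive = op_sqrt_works(1)[OF hilbert_UNIV near_one_Ds, folded Delta_star_def]
lemmas D_op = positive_op_bounded[OF hilbert_UNIV D_positive]
lemmas Ds_op = positive_op_bounded[OF hilbert_UNIV Ds_positive]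
lemmas cinner_D = positive_op_sym[OF hilbert_UNIV D_positive UNIV_I UNIV_I]
lemmas cinner_Ds = positive_op_sym[OF hilbert_UNIV Ds_positive UNIV_I UNIV_I]
lemmas D_D = op_sqrt_works(2)[OF hilbert_UNIV near_one_D UNIV_I, folded Delta_eq]
lemmas Ds_Ds = op_sqrt_works(2)[OF hilbert_UNIV near_one_Ds UNIV_I, folded Delta_star_def]

text \<open>\<open>R\<close> carries I - R^* R to I - R R^* and hence the square roots to each
  other. This cancels the mixed terms in the system matrix.\<close>

lemma R_Ds: "R (Ds v) = D (R v)"
  unfolding Delta_eq Delta_star_def
  by (rule op_sqrt_intertwine[OF hilbert_UNIV near_one_Ds hilbert_UNIV near_one_D R_op])
    (simp_all add: bounded_op_diff[OF hilbert_UNIV R_op])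

lemma Ra_D: "Ra (D h) = Ds (Ra h)"
  unfolding Delta_eq Delta_star_def
  by (rule op_sqrt_intertwine[OF hilbert_UNIV near_one_D hilbert_UNIV near_one_Ds Ra_op])
    (simp_all add: bounded_op_diff[OF hilbert_UNIV Ra_op])

lemmas op_linear =
  bounded_op_add[OF T_op UNIV_I UNIV_I] bounded_op_scaleC[OF T_op UNIV_I]
  bounded_op_add[OF Ta_op UNIV_I UNIV_I] bounded_op_scaleC[OF Ta_op UNIV_I]
  bounded_op_add[OF R_op UNIV_I UNIV_I] bounded_op_scaleC[OF R_op UNIV_I]
  bounded_op_add[OF Ra_op UNIV_I UNIV_I] bounded_op_scaleC[OF Ra_op UNIV_I]
  bounded_op_add[OF D_op UNIV_I UNIV_I] bounded_op_scaleC[OF D_op UNIV_I]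
  bounded_op_add[OF Ds_op UNIV_I UNIV_I] bounded_op_scaleC[OF Ds_op UNIV_I]

lemmas op_zero [simp] =
  bounded_op_zero[OF hilbert_UNIV T_op] bounded_op_zero[OF hilbert_UNIV Ta_op]
  bounded_op_zero[OF hilbert_UNIV R_op] bounded_op_zero[OF hilbert_UNIV Ra_op]
  bounded_op_zero[OF hilbert_UNIV D_op] bounded_op_zero[OF hilbert_UNIV Ds_op]

lemma norm_D: "(norm (D h))\<^sup>2 = (norm h)\<^sup>2 - (\<Sum>i\<in>UNIV. (norm (Ta i h))\<^sup>2)"
proof -
  have "(norm (D h))\<^sup>2 = Re (cinner (D (D h)) h)"
    unfolding Re_cinner_self[of "D h", symmetric] cinner_D[of "D h" h] ..
  also have "\<dots> = (norm h)\<^sup>2 - Re (cinner (Ra h) (Ra h))"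
    by (simp add: D_D cinner.diff_left cinner_R Re_cinner_self)
  finally show ?thesis
    by (simp add: Re_cinner_self norm_vec_square Ra_nth)
qed

lemma norm_Ds: "(norm (Ds v))\<^sup>2 = (norm v)\<^sup>2 - (norm (R v))\<^sup>2"
proof -
  have "(norm (Ds v))\<^sup>2 = Re (cinner v (Ds (Ds v)))"
    unfolding Re_cinner_self[of "Ds v", symmetric] cinner_Ds[of v "Ds v"] ..
  also have "\<dots> = (norm v)\<^sup>2 - Re (cinner (R v) (R v))"
    by (simp add: Ds_Ds cinner.diff_right cinner_R Re_cinner_self)
  finally show ?thesis
    by (simp add: Re_cinner_self)
qed

text \<open>The operator matrix with rows \<open>(T\<^sup>*, \<Delta>\<^sub>*)\<close> and \<open>(\<Delta>, -T)\<close> is unitary.\<close>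

lemma julia_isometry:
  "(norm (D x - R v))\<^sup>2 + (\<Sum>i\<in>UNIV. (norm (Ta i x + Ds v $ i))\<^sup>2) = (norm x)\<^sup>2 + (norm v)\<^sup>2"
proof -
  have "(\<Sum>i\<in>UNIV. (norm (Ta i x + Ds v $ i))\<^sup>2) = (norm (Ra x + Ds v))\<^sup>2"
    by (simp add: norm_vec_square Ra_nth)
  moreover have "Re (cinner (Ra x) (Ds v)) = Re (cinner (D x) (R v))"
    by (simp add: cinner_R'[symmetric] R_Ds cinner_D)
  moreover have "(norm (D x))\<^sup>2 + (norm (Ra x))\<^sup>2 = (norm x)\<^sup>2"
    by (simp add: norm_D norm_vec_square[of "Ra x"] Ra_nth)
  ultimately show ?thesis
    by (simp add: norm_diff_square norm_add_square norm_Ds)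
qed

text \<open>The adjoint of the system matrix is isometric too. This is the balance for
  \<open>Ka\<close> and \<open>Ca\<close>, with z made of the values of \<open>Ka\<close> on the
  shifts of a Fock vector and y its vacuum coefficient.\<close>

lemma julia_coisometry:
  "(norm (R z + D y))\<^sup>2 + (norm (Ds z - Ra y))\<^sup>2 = (norm z)\<^sup>2 + (norm y)\<^sup>2"
proof -
  have "cinner (Ds z) (Ra y) = cinner (R z) (D y)"
    by (simp add: cinner_R[symmetric] R_Ds cinner_D)
  moreover have "(norm (D y))\<^sup>2 + (norm (Ra y))\<^sup>2 = (norm y)\<^sup>2"
    by (simp add: norm_D norm_vec_square[of "Ra y"] Ra_nth)
  ultimately show ?thesis
    by (simp add: norm_diff_square norm_add_square norm_Ds)
qed

lemma hilbert_subspace_defect [simp]: "hilbert_subspace (defect T)"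
  unfolding defect_def by (intro hilbert_closure subspace_image[OF hilbert_UNIV D_op])

lemma hilbert_subspace_defect_star [simp]: "hilbert_subspace (defect_star T)"
  unfolding defect_star_def by (intro hilbert_closure subspace_image[OF hilbert_UNIV Ds_op])

lemma D_mem: "D h \<in> defect T"
  unfolding defect_def by (rule subsetD[OF closure_subset rangeI])

lemma Ds_mem: "Ds v \<in> defect_star T"
  unfolding defect_star_def by (rule subsetD[OF closure_subset rangeI])

lemma R_mem:
  assumes "v \<in> defect_star T" shows "R v \<in> defect T"
  using assms unfolding defect_star_def
  by (rule bounded_op_closure_mem[OF R_op _ _, rotated -1]) (auto simp: R_Ds D_mem, simp add: defect_def)

lemma Ra_mem:
  assumes "h \<in> defect T" shows "Ra h \<in> defect_star T"
  using assms unfolding defect_def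
  by (rule bounded_op_closure_mem[OF Ra_op _ _, rotated -1]) (auto simp: Ra_D Ds_mem, simp add: defect_star_def)

lemma word_op_op: "bounded_op UNIV UNIV (word_op T \<alpha>)"
proof (induction \<alpha>)
  case Nil
  show ?case by (rule bounded_opI[where K=1]) (simp_all add: word_op.simps)
next
  case (Cons i \<alpha>)
  show ?case using bounded_op_comp[OF Cons T_op] by (simp add: comp_def word_op.simps)
qed

lemma Tw_op: "bounded_op UNIV UNIV (Tw \<alpha>)"
  by (intro bounded_op_adj hilbert_UNIV word_op_op)

lemma cinner_word_op: "cinner (word_op T \<alpha> x) y = cinner x (Tw \<alpha> y)"
  by (intro cinner_adj hilbert_UNIV word_op_op UNIV_I)

lemma Tw_Nil: "Tw [] h = h"
  by (rule adj_eqI[OF hilbert_UNIV hilbert_UNIV word_op_op]) (simp_all add: word_op.simps)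

lemma Tw_Cons: "Tw (i # \<alpha>) h = Tw \<alpha> (Ta i h)"
  by (rule adj_eqI[OF hilbert_UNIV hilbert_UNIV word_op_op])
    (simp_all add: cinner_T cinner_word_op word_op.simps)

subsection \<open>The Poisson kernel\<close>

definition poisson :: "'h \<Rightarrow> ('n, 'h) fock" where
  "poisson h = Abs_ell2 (\<lambda>\<alpha>. D (Tw \<alpha> h))"

text \<open>By \<open>norm_D\<close>, what \<open>D\<close> does not absorb at a node of the word
  tree moves on to its children. The sum over level \<open>N\<close> is the mass not yet
  absorbed.\<close>

lemma poisson_level:
  "(\<Sum>\<alpha> | length \<alpha> < N. (norm (D (Tw \<alpha> h)))\<^sup>2) + (\<Sum>\<alpha> | length \<alpha> = N. (norm (Tw \<alpha> h))\<^sup>2) = (norm h)\<^sup>2"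
proof (induction N arbitrary: h)
  case 0
  then show ?case by (simp add: Tw_Nil)
next
  case (Suc N)
  have "(\<Sum>\<alpha> | length \<alpha> < Suc N. (norm (D (Tw \<alpha> h)))\<^sup>2) + (\<Sum>\<alpha> | length \<alpha> = Suc N. (norm (Tw \<alpha> h))\<^sup>2)
     = (norm (D h))\<^sup>2 + (\<Sum>i\<in>UNIV. (norm (Ta i h))\<^sup>2)"
    unfolding sum_length_less_Suc sum_length_Suc Tw_Cons Tw_Nil Suc.IH[of "Ta _ h", symmetric]
    by (simp add: sum.distrib)
  then show ?case by (simp add: norm_D)
qed

lemma poisson_coeff: "ell2_coeff (poisson h) \<alpha> = D (Tw \<alpha> h)"
  and norm_poisson_le: "norm (poisson h) \<le> norm h"
proof -
  have "(\<Sum>\<alpha> | length \<alpha> < N. (norm (D (Tw \<alpha> h)))\<^sup>2) \<le> (norm h)\<^sup>2" for N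
    using poisson_level[of h N] sum_nonneg[of "{\<alpha>. length \<alpha> = N}" "\<lambda>\<alpha>. (norm (Tw \<alpha> h))\<^sup>2"] by simp
  from ell2_exists_level[OF this norm_ge_zero]
  show "ell2_coeff (poisson h) \<alpha> = D (Tw \<alpha> h)" "norm (poisson h) \<le> norm h"
    by (simp_all add: poisson_def)
qed

lemma poisson_mem: "poisson h \<in> UNIV \<otimes>\<^sub>s defect T"
  by (rule tensor_UNIV_memI) (simp_all add: poisson_coeff D_mem)

lemma poisson_op: "bounded_op UNIV UNIV poisson"
proof (rule bounded_opI[where K=1])
  show "poisson (x + y) = poisson x + poisson y" "poisson (c *\<^sub>C x) = c *\<^sub>C poisson x" for x y c
    by (rule ell2_eqI; simp add: poisson_coeff bounded_op_add[OF Tw_op] bounded_op_scaleC[OF Tw_op] op_linear)+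
qed (simp_all add: norm_poisson_le)

lemma shift_poisson: "ell2_shift [i] (poisson h) = poisson (Ta i h)"
  by (rule ell2_eqI) (simp add: poisson_coeff Tw_Cons)

lemma defect_limit: "(\<lambda>N. \<Sum>\<alpha> | length \<alpha> = N. (norm (Tw \<alpha> h))\<^sup>2) \<longlonglongrightarrow> (norm h)\<^sup>2 - (norm (poisson h))\<^sup>2"
proof -
  have "(\<lambda>N. (norm h)\<^sup>2 - (\<Sum>\<alpha> | length \<alpha> < N. (norm (ell2_coeff (poisson h) \<alpha>))\<^sup>2))
      \<longlonglongrightarrow> (norm h)\<^sup>2 - (norm (poisson h))\<^sup>2"
    by (intro tendsto_intros fock_norm_tendsto)
  moreover have "(norm h)\<^sup>2 - (\<Sum>\<alpha> | length \<alpha> < N. (norm (ell2_coeff (poisson h) \<alpha>))\<^sup>2)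
      = (\<Sum>\<alpha> | length \<alpha> = N. (norm (Tw \<alpha> h))\<^sup>2)" for N
    using poisson_level[of h N] by (simp add: poisson_coeff)
  ultimately show ?thesis by simp
qed

text \<open>If nothing is absorbed at any node, \<open>poisson_level\<close> puts the full squared
  norm of \<open>h\<close> on every level, which is the excluded coisometric behaviour.\<close>

lemma poisson_inj:
  assumes "cnc UNIV T" and 0: "poisson h = 0" shows "h = 0"
proof (rule ccontr)
  assume "h \<noteq> 0"
  have "D (Tw \<alpha> h) = 0" for \<alpha>
    unfolding poisson_coeff[symmetric] 0 by simp
  then have "(\<Sum>\<alpha> | length \<alpha> = k. (norm (Tw \<alpha> h))\<^sup>2) = (norm h)\<^sup>2" for k
    using poisson_level[of h k] by simp
  then show False
    using assms(1) \<open>h \<noteq> 0\<close> unfolding cnc_def by auto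
qed

text \<open>The row of all \<open>word_op T \<alpha>\<close> with \<alpha> of length k is a
  contraction because its adjoint column is one by \<open>poisson_level\<close>; pairing the sum
  \<open>Q\<close> with itself performs the duality.\<close>

lemma norm_level_sum_le:
  "norm (\<Sum>\<alpha> | length \<alpha> = k. word_op T \<alpha> (y \<alpha>)) \<le> sqrt (\<Sum>\<alpha> | length \<alpha> = k. (norm (y \<alpha>))\<^sup>2)"
proof (cases "(\<Sum>\<alpha> | length \<alpha> = k. word_op T \<alpha> (y \<alpha>)) = 0")
  case True
  then show ?thesis by (simp add: sum_nonneg)
next
  case False
  define Q where "Q = (\<Sum>\<alpha> | length \<alpha> = k. word_op T \<alpha> (y \<alpha>))"
  have q_le: "(\<Sum>\<alpha> | length \<alpha> = k. (norm (Tw \<alpha> Q))\<^sup>2) \<le> (norm Q)\<^sup>2"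
    using poisson_level[of Q k] sum_nonneg[of "{\<alpha>. length \<alpha> < k}" "\<lambda>\<alpha>. (norm (D (Tw \<alpha> Q)))\<^sup>2"] by simp
  have "(norm Q)\<^sup>2 = Re (cinner Q Q)"
    by (simp add: Re_cinner_self)
  also have "\<dots> = (\<Sum>\<alpha> | length \<alpha> = k. Re (cinner (y \<alpha>) (Tw \<alpha> Q)))"
    by (subst (1) Q_def) (simp add: cinner.sum_left cinner_word_op)
  also have "\<dots> \<le> (\<Sum>\<alpha> | length \<alpha> = k. \<bar>norm (y \<alpha>)\<bar> * \<bar>norm (Tw \<alpha> Q)\<bar>)"
    using complex_Re_le_cmod cmod_cinner_le order_trans by (intro sum_mono) fastforce
  also have "\<dots> \<le> L2_set (\<lambda>\<alpha>. norm (y \<alpha>)) {\<alpha>. length \<alpha> = k} * L2_set (\<lambda>\<alpha>. norm (Tw \<alpha> Q)) {\<alpha>. length \<alpha> = k}"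
    by (rule L2_set_mult_ineq)
  also have "\<dots> \<le> sqrt (\<Sum>\<alpha> | length \<alpha> = k. (norm (y \<alpha>))\<^sup>2) * norm Q"
  proof -
    have "sqrt (\<Sum>\<alpha> | length \<alpha> = k. (norm (Tw \<alpha> Q))\<^sup>2) \<le> norm Q"
      using q_le by (rule real_le_lsqrt[OF norm_ge_zero])
    then show ?thesis
      unfolding L2_set_def by (intro mult_left_mono) (simp_all add: sum_nonneg)
  qed
  finally show ?thesis using False by (simp add: power2_eq_square flip: Q_def)
qed

text \<open>\<open>defect_limit\<close> controls only the quadratic form of the level sums. Strong
  convergence is recovered by feeding the vectors \<open>Tw \<alpha> h\<close> into
  \<open>norm_level_sum_le\<close>.\<close>

lemma pure_iff_poisson: "pure UNIV T \<longleftrightarrow> (\<forall>h. norm (poisson h) = norm h)"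
proof
  assume pure: "pure UNIV T"
  show "\<forall>h. norm (poisson h) = norm h"
  proof
    fix h
    have "(\<lambda>k. \<Sum>\<alpha> | length \<alpha> = k. word_op T \<alpha> (Tw \<alpha> h)) \<longlonglongrightarrow> 0"
      using pure by (simp add: pure_def)
    then have "(\<lambda>k. Re (cinner (\<Sum>\<alpha> | length \<alpha> = k. word_op T \<alpha> (Tw \<alpha> h)) h)) \<longlonglongrightarrow> Re (cinner 0 h)"
      by (intro tendsto_Re cinner.tendsto tendsto_const)
    then have "(\<lambda>k. \<Sum>\<alpha> | length \<alpha> = k. (norm (Tw \<alpha> h))\<^sup>2) \<longlonglongrightarrow> 0"
      by (simp add: cinner.sum_left cinner_word_op Re_cinner_self)
    with defect_limit[of h] have "(norm h)\<^sup>2 - (norm (poisson h))\<^sup>2 = 0"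
      by (rule LIMSEQ_unique)
    then show "norm (poisson h) = norm h" by simp
  qed
next
  assume iso: "\<forall>h. norm (poisson h) = norm h"
  show "pure UNIV T"
    unfolding pure_def
  proof
    fix h
    define Q where "Q k = (\<Sum>\<alpha> | length \<alpha> = k. word_op T \<alpha> (Tw \<alpha> h))" for k
    let ?q = "\<lambda>k x. \<Sum>\<alpha> | length \<alpha> = k. (norm (Tw \<alpha> x))\<^sup>2"
    have "norm (Q k) \<le> sqrt (?q k h)" for k
      unfolding Q_def by (rule norm_level_sum_le)
    moreover have "(\<lambda>k. sqrt (?q k h)) \<longlonglongrightarrow> sqrt ((norm h)\<^sup>2 - (norm (poisson h))\<^sup>2)"
      by (intro tendsto_real_sqrt defect_limit)
    then have "(\<lambda>k. sqrt (?q k h)) \<longlonglongrightarrow> 0" using iso by simp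
    ultimately have "Q \<longlonglongrightarrow> 0"
      by (rule Lim_null_comparison[OF always_eventually[OF allI]])
    then show "(\<lambda>k. \<Sum>\<alpha> | length \<alpha> = k. word_op T \<alpha> (Tw \<alpha> h)) \<longlonglongrightarrow> 0"
      unfolding Q_def[abs_def] .
  qed
qed

abbreviation Ka where "Ka \<equiv> adj UNIV UNIV poisson"

lemma Ka_op: "bounded_op UNIV UNIV Ka"
  by (intro bounded_op_adj hilbert_UNIV poisson_op)

lemma cinner_poisson: "cinner (poisson h) y = cinner h (Ka y)"
  by (intro cinner_adj hilbert_UNIV poisson_op UNIV_I)

lemma cinner_poisson': "cinner y (poisson h) = cinner (Ka y) h"
  by (rule cinner_flip) (rule cinner_poisson)

lemma norm_Ka_le: "norm (Ka y) \<le> norm y"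
  using norm_adj_le[OF hilbert_UNIV hilbert_UNIV poisson_op, of 1 y] norm_poisson_le
  by simp

text \<open>Dual to expanding the kernel at the first letter: vacuum coefficient \<open>D h\<close>,
  and behind the letter i the kernel of \<open>Ta i h\<close>.\<close>

lemma Ka_split: "Ka y = R (\<chi> i. Ka (ell2_shift [i] y)) + D (ell2_coeff y [])"
proof (rule adj_eqI[OF hilbert_UNIV hilbert_UNIV poisson_op])
  fix h
  show "cinner (poisson h) y = cinner h (R (\<chi> i. Ka (ell2_shift [i] y)) + D (ell2_coeff y []))"
    by (subst fock_cinner_split) (simp add: shift_poisson poisson_coeff Tw_Nil cinner_poisson
      cinner_D row_op_def cinner_add_right cinner.sum_right cinner_T')
qed simp_all

subsection \<open>The characteristic function\<close>

text \<open>
  \<open>char_fun T\<close> is the transfer function of the system with unitary system matrix \<open>julia_isometry\<close>: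
  along a word the state starts at \<open>0\<close>, the letter \<open>i\<close> sends the state \<open>x\<close> and the input \<open>v\<close> to
  \<open>T\<^sub>i\<^sup>* x + (\<Delta>\<^sub>* v)\<^sub>i\<close>, and the output is \<open>\<Delta> x - T v\<close>.
\<close>

primrec char_state :: "'h \<Rightarrow> ('n list \<Rightarrow> 'h ^ 'n) \<Rightarrow> 'n list \<Rightarrow> 'h" where
  "char_state x f [] = x"
| "char_state x f (i # \<beta>) = char_state (Ta i x + Ds (f []) $ i) (\<lambda>\<gamma>. f (i # \<gamma>)) \<beta>"

definition char_out :: "'h \<Rightarrow> ('n list \<Rightarrow> 'h ^ 'n) \<Rightarrow> 'n list \<Rightarrow> 'h" where
  "char_out x f \<beta> = D (char_state x f \<beta>) - R (f \<beta>)"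

lemma char_out_Nil: "char_out x f [] = D x - R (f [])"
  by (simp add: char_out_def)

lemma char_out_Cons: "char_out x f (i # \<beta>) = char_out (Ta i x + Ds (f []) $ i) (\<lambda>\<gamma>. f (i # \<gamma>)) \<beta>"
  by (simp add: char_out_def)

text \<open>Energy balance of the isometric system: initial state plus input equals output plus the
  states still stored at level \<open>N\<close>. The initial state is arbitrary because it is in
  general nonzero after one letter.\<close>

lemma char_level:
  "(\<Sum>\<beta> | length \<beta> < N. (norm (char_out x f \<beta>))\<^sup>2) + (\<Sum>\<beta> | length \<beta> = N. (norm (char_state x f \<beta>))\<^sup>2)
    = (norm x)\<^sup>2 + (\<Sum>\<beta> | length \<beta> < N. (norm (f \<beta>))\<^sup>2)"
proof (induction N arbitrary: x f)
  case (Suc N)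
  let ?x = "\<lambda>i. Ta i x + Ds (f []) $ i"
  have "(\<Sum>\<beta> | length \<beta> < Suc N. (norm (char_out x f \<beta>))\<^sup>2) + (\<Sum>\<beta> | length \<beta> = Suc N. (norm (char_state x f \<beta>))\<^sup>2)
     = (norm (D x - R (f [])))\<^sup>2 + (\<Sum>i\<in>UNIV. (\<Sum>\<beta> | length \<beta> < N. (norm (char_out (?x i) (\<lambda>\<gamma>. f (i # \<gamma>)) \<beta>))\<^sup>2)
        + (\<Sum>\<beta> | length \<beta> = N. (norm (char_state (?x i) (\<lambda>\<gamma>. f (i # \<gamma>)) \<beta>))\<^sup>2))"
    unfolding sum_length_less_Suc sum_length_Suc by (simp add: char_out_Nil char_out_Cons sum.distrib)
  also have "\<dots> = (norm (D x - R (f [])))\<^sup>2 + (\<Sum>i\<in>UNIV. (norm (?x i))\<^sup>2) + (\<Sum>i\<in>UNIV. \<Sum>\<beta> | length \<beta> < N. (norm (f (i # \<beta>)))\<^sup>2)"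
    unfolding Suc.IH by (simp add: sum.distrib)
  also have "\<dots> = (norm x)\<^sup>2 + (\<Sum>\<beta> | length \<beta> < Suc N. (norm (f \<beta>))\<^sup>2)"
    unfolding julia_isometry sum_length_less_Suc by simp
  finally show ?case .
qed simp

definition char_op :: "('n, 'h ^ 'n) fock \<Rightarrow> ('n, 'h) fock" where
  "char_op f = Abs_ell2 (char_out 0 (ell2_coeff f))"

lemma char_op_coeff: "ell2_coeff (char_op f) \<beta> = char_out 0 (ell2_coeff f) \<beta>"
  and norm_char_op_le: "norm (char_op f) \<le> norm f"
proof -
  have "(\<Sum>\<beta> | length \<beta> < N. (norm (char_out 0 (ell2_coeff f) \<beta>))\<^sup>2) \<le> (norm f)\<^sup>2" for N
  proof -
    have "(\<Sum>\<beta> | length \<beta> < N. (norm (char_out 0 (ell2_coeff f) \<beta>))\<^sup>2) \<le> (\<Sum>\<beta> | length \<beta> < N. (norm (ell2_coeff f \<beta>))\<^sup>2)"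
      using char_level[where N=N and x=0 and f="ell2_coeff f"]
        sum_nonneg[of "{\<alpha>. length \<alpha> = N}" "\<lambda>\<beta>. (norm (char_state 0 (ell2_coeff f) \<beta>))\<^sup>2"] by simp
    also have "\<dots> \<le> (norm f)\<^sup>2" by (rule sum_norm_ell2_coeff_le) simp
    finally show ?thesis .
  qed
  from ell2_exists_level[OF this norm_ge_zero]
  show "ell2_coeff (char_op f) \<beta> = char_out 0 (ell2_coeff f) \<beta>" "norm (char_op f) \<le> norm f"
    by (simp_all add: char_op_def)
qed

lemma char_state_add:
  "char_state (x + y) (\<lambda>\<beta>. f \<beta> + g \<beta>) \<beta> = char_state x f \<beta> + char_state y g \<beta>"
proof (induction \<beta> arbitrary: x y f g)
  case (Cons i \<beta>)
  have "Ta i (x + y) + Ds (f [] + g []) $ i = (Ta i x + Ds (f []) $ i) + (Ta i y + Ds (g []) $ i)"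
    by (simp add: op_linear)
  then show ?case by (simp only: char_state.simps Cons.IH)
qed simp

lemma char_state_scaleC:
  "char_state (c *\<^sub>C x) (\<lambda>\<beta>. c *\<^sub>C f \<beta>) \<beta> = c *\<^sub>C char_state x f \<beta>"
proof (induction \<beta> arbitrary: x f)
  case (Cons i \<beta>)
  have "Ta i (c *\<^sub>C x) + Ds (c *\<^sub>C f []) $ i = c *\<^sub>C (Ta i x + Ds (f []) $ i)"
    by (simp add: op_linear scaleC_vec_nth scaleC_add_right)
  then show ?case by (simp only: char_state.simps Cons.IH)
qed simp

lemma char_op_op: "bounded_op UNIV UNIV char_op"
proof (rule bounded_opI[where K=1])
  show "char_op (x + y) = char_op x + char_op y" for x y
  proof (rule ell2_eqI)
    have "ell2_coeff (x + y) = (\<lambda>\<beta>. ell2_coeff x \<beta> + ell2_coeff y \<beta>)" by (rule ext) simp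
    then show "ell2_coeff (char_op (x + y)) \<beta> = ell2_coeff (char_op x + char_op y) \<beta>" for \<beta>
      using char_state_add[of 0 0 "ell2_coeff x" "ell2_coeff y" \<beta>]
      by (simp add: char_op_coeff char_out_def op_linear)
  qed
  show "char_op (c *\<^sub>C x) = c *\<^sub>C char_op x" for x c
  proof (rule ell2_eqI)
    have "ell2_coeff (c *\<^sub>C x) = (\<lambda>\<beta>. c *\<^sub>C ell2_coeff x \<beta>)" by (rule ext) simp
    then show "ell2_coeff (char_op (c *\<^sub>C x)) \<beta> = ell2_coeff (c *\<^sub>C char_op x) \<beta>" for \<beta>
      using char_state_scaleC[of c 0 "ell2_coeff x" \<beta>]
      by (simp add: char_op_coeff char_out_def op_linear scaleC.diff_right)
  qed
qed (simp_all add: norm_char_op_le)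

lemma char_state_zero: "char_state x (\<lambda>_. 0) \<beta> = Tw \<beta> x"
  by (induction \<beta> arbitrary: x) (simp_all add: Tw_Nil Tw_Cons)

lemma char_out_zero: "char_out x (\<lambda>_. 0) \<beta> = D (Tw \<beta> x)"
  by (simp add: char_out_def char_state_zero)

text \<open>Without input at the empty word the system is still at rest after one letter; behind the
  letter i it then processes \<open>f\<close> from the start, behind any other letter it receives
  nothing.\<close>

lemma char_op_creation: "char_op (creation i f) = creation i (char_op f)"
proof (rule ell2_eqI)
  fix \<alpha>
  show "ell2_coeff (char_op (creation i f)) \<alpha> = ell2_coeff (creation i (char_op f)) \<alpha>"
  proof (cases \<alpha>)
    case Nil
    then show ?thesis by (simp add: char_op_coeff char_out_Nil)
  next
    case (Cons j \<beta>)
    show ?thesis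
    proof (cases "j = i")
      case True
      then show ?thesis by (simp add: Cons char_op_coeff char_out_Cons)
    next
      case False
      then show ?thesis
        using char_out_zero[of 0 \<beta>] bounded_op_zero[OF hilbert_UNIV Tw_op, of \<beta>]
        by (simp add: Cons char_op_coeff char_out_Cons)
    qed
  qed
qed

lemma char_op_vacuum_Nil: "ell2_coeff (char_op (fock_basis [] \<otimes>\<^sub>t v)) [] = - R v"
  by (simp add: char_op_coeff char_out_Nil ell2_coeff_tensor ell2_coeff_fock_basis scaleC_one)

text \<open>An impulse at the empty word leaves the state \<open>Ds v $ i\<close> behind the letter
  i; without further input the output is the kernel of that state, by
  \<open>char_out_zero\<close>.\<close>

lemma char_op_vacuum_shift: "ell2_shift [i] (char_op (fock_basis [] \<otimes>\<^sub>t v)) = poisson (Ds v $ i)"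
proof (rule ell2_eqI)
  fix \<beta>
  have "(\<lambda>\<gamma>. ell2_coeff (fock_basis [] \<otimes>\<^sub>t v) (i # \<gamma>)) = (\<lambda>_. 0)"
    by (rule ext) (simp add: ell2_coeff_tensor ell2_coeff_fock_basis)
  then show "ell2_coeff (ell2_shift [i] (char_op (fock_basis [] \<otimes>\<^sub>t v))) \<beta> = ell2_coeff (poisson (Ds v $ i)) \<beta>"
    by (simp add: char_op_coeff char_out_Cons char_out_zero poisson_coeff ell2_coeff_tensor
      ell2_coeff_fock_basis scaleC_one)
qed

lemma char_op_mem:
  assumes "f \<in> UNIV \<otimes>\<^sub>s defect_star T" shows "char_op f \<in> UNIV \<otimes>\<^sub>s defect T"
proof (rule tensor_UNIV_memI)
  fix \<beta>
  have "ell2_coeff f \<beta> \<in> defect_star T"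
    by (rule tensor_coeff_mem[OF _ assms]) simp
  then show "ell2_coeff (char_op f) \<beta> \<in> defect T"
    by (simp add: char_op_coeff char_out_def D_mem R_mem hilbert_diff[OF hilbert_subspace_defect])
qed simp

lemma char_op_vacuum:
  "char_op (fock_basis [] \<otimes>\<^sub>t v) = - (fock_basis [] \<otimes>\<^sub>t R v)
    + (\<Sum>i\<in>UNIV. \<Sum>\<^sub>\<infinity>\<beta>. fock_basis (i # \<beta>) \<otimes>\<^sub>t D (Tw \<beta> (Ds v $ i)))"
proof -
  have "((\<lambda>\<beta>. fock_basis (i # \<beta>) \<otimes>\<^sub>t D (Tw \<beta> h)) has_sum creation i (poisson h)) UNIV" for i h
    using has_sum_bounded_linear[OF bounded_op_UNIV_linear[OF bounded_op_creation[of i]] has_sum_fock[of "poisson h"]]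
    by (simp add: creation_tensor creation_fock_basis poisson_coeff)
  then have "(\<Sum>\<^sub>\<infinity>\<beta>. fock_basis (i # \<beta>) \<otimes>\<^sub>t D (Tw \<beta> h)) = creation i (poisson h)" for i h
    by (rule infsumI)
  moreover have "char_op (fock_basis [] \<otimes>\<^sub>t v) = - (fock_basis [] \<otimes>\<^sub>t R v) + (\<Sum>i\<in>UNIV. creation i (poisson (Ds v $ i)))"
  proof (rule ell2_eqI)
    fix \<alpha>
    show "ell2_coeff (char_op (fock_basis [] \<otimes>\<^sub>t v)) \<alpha>
      = ell2_coeff (- (fock_basis [] \<otimes>\<^sub>t R v) + (\<Sum>i\<in>UNIV. creation i (poisson (Ds v $ i)))) \<alpha>"
    proof (cases \<alpha>)
      case Nil
      then show ?thesis
        by (simp add: char_op_vacuum_Nil ell2_coeff_sum ell2_coeff_tensor ell2_coeff_fock_basis scaleC_one)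
    next
      case (Cons j \<beta>)
      have "ell2_coeff (char_op (fock_basis [] \<otimes>\<^sub>t v)) \<alpha> = ell2_coeff (poisson (Ds v $ j)) \<beta>"
        unfolding char_op_vacuum_shift[symmetric] by (simp add: Cons)
      then show ?thesis
        by (simp add: Cons ell2_coeff_sum ell2_coeff_tensor ell2_coeff_fock_basis)
    qed
  qed
  ultimately show ?thesis by simp
qed

text \<open>\<open>char_op\<close> is a witness for the choice, and the defining conditions fix the
  values on e_\<alpha> \<otimes> v by induction on \<alpha>. Density then acts twice, in the scalar
  Fock factor and in the span of elementary tensors.\<close>

lemma char_fun_eq:
  assumes f: "f \<in> UNIV \<otimes>\<^sub>s defect_star T"
  shows "char_fun T f = char_op f"
proof -
  let ?X = "UNIV \<otimes>\<^sub>s defect_star T" and ?Y = "UNIV \<otimes>\<^sub>s defect T"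
  let ?P = "\<lambda>\<Theta>. bounded_op ?X ?Y \<Theta> \<and>
        (\<forall>i. \<forall>f\<in>?X. \<Theta> (ampliation UNIV (defect_star T) (left_creation i) f)
             = ampliation UNIV (defect T) (left_creation i) (\<Theta> f)) \<and>
        (\<forall>x\<in>defect_star T.
           \<Theta> (fock_basis [] \<otimes>\<^sub>t x) =
             - (fock_basis [] \<otimes>\<^sub>t row_op T x)
             + (\<Sum>i\<in>UNIV. \<Sum>\<^sub>\<infinity>\<beta>. fock_basis (i # \<beta>) \<otimes>\<^sub>t D (Tw \<beta> (Ds x $ i))))"
  have "bounded_op ?X ?Y char_op"
    by (rule bounded_op_subset[OF char_op_op]) (simp_all add: char_op_mem)
  then have "?P char_op"
    using char_op_mem by (simp add: ampliation_creation char_op_creation char_op_vacuum)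
  then have P: "?P (char_fun T)"
    unfolding char_fun_def by (rule someI[where P="?P"])
  have op: "bounded_op ?X ?Y (char_fun T)" using P by blast
  have basis: "char_fun T (fock_basis \<alpha> \<otimes>\<^sub>t v) = char_op (fock_basis \<alpha> \<otimes>\<^sub>t v)" if v: "v \<in> defect_star T" for \<alpha> v
  proof (induction \<alpha>)
    case Nil
    then show ?case using P v char_op_vacuum by simp
  next
    case (Cons i \<alpha>)
    have mem: "fock_basis \<alpha> \<otimes>\<^sub>t v \<in> ?X" using v by (intro tensor_mem) auto
    have "char_fun T (creation i (fock_basis \<alpha> \<otimes>\<^sub>t v)) = creation i (char_fun T (fock_basis \<alpha> \<otimes>\<^sub>t v))"
      using P mem bounded_op_mem[OF op mem] by (simp add: ampliation_creation)
    then show ?case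
      by (simp add: Cons char_op_creation[symmetric] creation_tensor creation_fock_basis)
  qed
  show ?thesis
  proof (rule tensor_op_eqI[OF op \<open>bounded_op ?X ?Y char_op\<close> _ f])
    fix x :: "('n, complex) fock" and v assume v: "v \<in> defect_star T"
    have X: "x' \<otimes>\<^sub>t v \<in> ?X" for x' using v by (intro tensor_mem) auto
    have "bounded_op UNIV ?X (\<lambda>x. x \<otimes>\<^sub>t v)"
      by (rule bounded_op_subset[OF bounded_op_tensor_left]) (simp_all add: X)
    moreover have "bounded_op ?X UNIV (char_fun T)"
      by (rule bounded_op_subset[OF op]) simp_all
    ultimately have 1: "bounded_op UNIV UNIV (\<lambda>x. char_fun T (x \<otimes>\<^sub>t v))"
      by (rule bounded_op_comp)
    have 2: "bounded_op UNIV UNIV (\<lambda>x. char_op (x \<otimes>\<^sub>t v))"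
      by (rule bounded_op_comp[OF bounded_op_tensor_left char_op_op])
    show "char_fun T (x \<otimes>\<^sub>t v) = char_op (x \<otimes>\<^sub>t v)"
      by (rule bounded_op_eq_closure_span[OF hilbert_UNIV 1 2 subset_UNIV eq_refl[OF closure_span_fock_basis[symmetric]]])
        (auto simp: basis v)
  qed
qed

abbreviation Ca where "Ca \<equiv> adj UNIV UNIV char_op"

lemma Ca_op: "bounded_op UNIV UNIV Ca"
  by (intro bounded_op_adj hilbert_UNIV char_op_op)

lemma cinner_char_op: "cinner (char_op f) y = cinner f (Ca y)"
  by (intro cinner_adj hilbert_UNIV char_op_op UNIV_I)

lemma cinner_char_op': "cinner y (char_op f) = cinner (Ca y) f"
  by (rule cinner_flip) (rule cinner_char_op)

lemma Ca_shift: "ell2_shift [i] (Ca y) = Ca (ell2_shift [i] y)"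
proof (rule adj_eqI[OF hilbert_UNIV hilbert_UNIV char_op_op, symmetric])
  fix x
  show "cinner (char_op x) (ell2_shift [i] y) = cinner x (ell2_shift [i] (Ca y))"
    unfolding cinner_creation[symmetric] char_op_creation[symmetric] by (rule cinner_char_op)
qed simp_all

text \<open>Tested against an impulse v at the vacuum, whose output is - R v at the empty word and a
  kernel behind each letter; the adjoint of the kernel contributes \<open>Ka\<close>.\<close>

lemma Ca_Nil: "ell2_coeff (Ca y) [] = Ds (\<chi> i. Ka (ell2_shift [i] y)) - Ra (ell2_coeff y [])"
proof (rule cinner_ext[OF hilbert_UNIV])
  fix v
  have "cinner (ell2_coeff (Ca y) []) v = cinner y (char_op (fock_basis [] \<otimes>\<^sub>t v))"
    unfolding cinner_char_op' cinner_fock_basis_tensor ..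
  also have "\<dots> = cinner (Ds (\<chi> i. Ka (ell2_shift [i] y)) - Ra (ell2_coeff y [])) v"
    unfolding fock_cinner_split[of y] char_op_vacuum_Nil char_op_vacuum_shift
    by (simp add: cinner_Ds cinner.diff_left cinner_R' cinner_poisson' cinner_vec_def[of "vec_lambda _"] cinner.minus_right)
  finally show "cinner v (ell2_coeff (Ca y) []) = cinner v (Ds (\<chi> i. Ka (ell2_shift [i] y)) - Ra (ell2_coeff y []))"
    by (rule cinner_flip)
qed simp_all

text \<open>By \<open>Ka_split\<close> and \<open>Ca_Nil\<close>, \<open>Ka y\<close> and the vacuum
  coefficient of \<open>Ca y\<close> arise from the adjoint system matrix applied to the values of
  \<open>Ka\<close> on the shifts and the vacuum coefficient of \<open>y\<close>;
  \<open>Ca_shift\<close> carries this to the next letter.\<close>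

lemma adjoint_level:
  "(norm (Ka y))\<^sup>2 + (\<Sum>\<alpha> | length \<alpha> < N. (norm (ell2_coeff (Ca y) \<alpha>))\<^sup>2)
    = (\<Sum>\<alpha> | length \<alpha> = N. (norm (Ka (ell2_shift \<alpha> y)))\<^sup>2) + (\<Sum>\<alpha> | length \<alpha> < N. (norm (ell2_coeff y \<alpha>))\<^sup>2)"
proof (induction N arbitrary: y)
  case (Suc N)
  let ?z = "\<chi> i. Ka (ell2_shift [i] y)"
  have step: "(\<Sum>\<alpha> | length \<alpha> < N. (norm (ell2_coeff (Ca y) (i # \<alpha>)))\<^sup>2)
      = (\<Sum>\<alpha> | length \<alpha> = N. (norm (Ka (ell2_shift (i # \<alpha>) y)))\<^sup>2)
        + (\<Sum>\<alpha> | length \<alpha> < N. (norm (ell2_coeff y (i # \<alpha>)))\<^sup>2) - (norm (?z $ i))\<^sup>2" for i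
  proof -
    have "ell2_coeff (Ca y) (i # \<alpha>) = ell2_coeff (Ca (ell2_shift [i] y)) \<alpha>" for \<alpha>
      unfolding Ca_shift[symmetric] by simp
    then show ?thesis
      using Suc.IH[of "ell2_shift [i] y"] by (simp add: ell2_shift_append[symmetric])
  qed
  have "(norm (Ka y))\<^sup>2 + (norm (ell2_coeff (Ca y) []))\<^sup>2 = (norm ?z)\<^sup>2 + (norm (ell2_coeff y []))\<^sup>2"
    unfolding Ka_split[of y] Ca_Nil by (rule julia_coisometry)
  then show ?case
    unfolding sum_length_less_Suc sum_length_Suc step
    by (simp add: sum.distrib sum_subtractf norm_vec_square)
qed simp

lemma norm_Ka_Ca: "(norm (Ka y))\<^sup>2 + (norm (Ca y))\<^sup>2 = (norm y)\<^sup>2"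
proof (rule LIMSEQ_unique)
  show "(\<lambda>N. (norm (Ka y))\<^sup>2 + (\<Sum>\<alpha> | length \<alpha> < N. (norm (ell2_coeff (Ca y) \<alpha>))\<^sup>2)) \<longlonglongrightarrow> (norm (Ka y))\<^sup>2 + (norm (Ca y))\<^sup>2"
    by (intro tendsto_intros fock_norm_tendsto)
  have lim: "(\<lambda>N. \<Sum>\<alpha> | length \<alpha> < N. (norm (ell2_coeff y \<alpha>))\<^sup>2) \<longlonglongrightarrow> (norm y)\<^sup>2"
    by (rule fock_norm_tendsto)
  \<comment> \<open>\<open>Ka\<close> is contractive, so the remainder is at most the part of
    \<open>y\<close> on words of length at least \<open>N\<close>, the tail of a convergent
    series.\<close>
  have "(\<lambda>N. \<Sum>\<alpha> | length \<alpha> = N. (norm (Ka (ell2_shift \<alpha> y)))\<^sup>2) \<longlonglongrightarrow> 0"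
  proof (rule tendsto_sandwich[OF _ _ tendsto_const])
    show "\<forall>\<^sub>F N in sequentially. 0 \<le> (\<Sum>\<alpha> | length \<alpha> = N. (norm (Ka (ell2_shift \<alpha> y)))\<^sup>2)"
      by (intro always_eventually allI sum_nonneg) simp
    have "(\<Sum>\<alpha> | length \<alpha> = N. (norm (Ka (ell2_shift \<alpha> y)))\<^sup>2) \<le> (norm y)\<^sup>2 - (\<Sum>\<alpha> | length \<alpha> < N. (norm (ell2_coeff y \<alpha>))\<^sup>2)" for N
    proof -
      have "(\<Sum>\<alpha> | length \<alpha> = N. (norm (Ka (ell2_shift \<alpha> y)))\<^sup>2) \<le> (\<Sum>\<alpha> | length \<alpha> = N. (norm (ell2_shift \<alpha> y))\<^sup>2)"
        by (intro sum_mono power_mono norm_Ka_le) simp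
      then show ?thesis using fock_norm_split_level[of y N] by simp
    qed
    then show "\<forall>\<^sub>F N in sequentially. (\<Sum>\<alpha> | length \<alpha> = N. (norm (Ka (ell2_shift \<alpha> y)))\<^sup>2)
        \<le> (norm y)\<^sup>2 - (\<Sum>\<alpha> | length \<alpha> < N. (norm (ell2_coeff y \<alpha>))\<^sup>2)"
      by simp
    show "(\<lambda>N. (norm y)\<^sup>2 - (\<Sum>\<alpha> | length \<alpha> < N. (norm (ell2_coeff y \<alpha>))\<^sup>2)) \<longlonglongrightarrow> 0"
      using tendsto_diff[OF tendsto_const lim, of "(norm y)\<^sup>2"] by simp
  qed
  from tendsto_add[OF this lim]
  show "(\<lambda>N. (norm (Ka y))\<^sup>2 + (\<Sum>\<alpha> | length \<alpha> < N. (norm (ell2_coeff (Ca y) \<alpha>))\<^sup>2)) \<longlonglongrightarrow> (norm y)\<^sup>2"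
    unfolding adjoint_level by simp
qed

lemma norm_Ca_le: "norm (Ca y) \<le> norm y"
proof -
  have "(norm (Ca y))\<^sup>2 \<le> (norm y)\<^sup>2"
    unfolding norm_Ka_Ca[of y, symmetric] by simp
  then show ?thesis by (simp add: power2_le_iff_abs_le)
qed

end

section \<open>The noncommutative analytic Toeplitz algebra\<close>

text \<open>In matrix coefficients, commuting with \<Psi> reads F (\<Psi> x, y) = F (x, y') with y'
  the adjoint of \<Psi> at y. Each condition involves two evaluations only, so it is closed in the
  product topology that \<open>wot\<close> pulls back.\<close>

lemma closedin_wot_commutant:
  fixes \<Psi> :: "'a::chilbert \<Rightarrow> 'a"
  assumes \<Psi>: "bounded_op UNIV UNIV \<Psi>"
  shows "closedin wot {A. bounded_op UNIV UNIV A \<and> (\<forall>x. A (\<Psi> x) = \<Psi> (A x))}"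
proof -
  let ?S = "{A :: 'a \<Rightarrow> 'a. bounded_op UNIV UNIV A}"
  let ?g = "\<lambda>A (x, y). cinner (A x) y :: complex"
  let ?\<Psi>a = "adj UNIV UNIV \<Psi>"
  define V where "V = {F :: 'a \<times> 'a \<Rightarrow> complex. \<forall>x y. F (\<Psi> x, y) = F (x, ?\<Psi>a y)}"
  have V: "closed V"
    unfolding V_def by (intro closed_Collect_all closed_Collect_eq) simp_all
  have iff: "?g A \<in> V \<longleftrightarrow> (\<forall>x. A (\<Psi> x) = \<Psi> (A x))" for A
  proof -
    have adj: "cinner (\<Psi> u) y = cinner u (?\<Psi>a y)" for u y
      by (intro cinner_adj[OF hilbert_UNIV hilbert_UNIV \<Psi>]) simp_all
    have "?g A \<in> V \<longleftrightarrow> (\<forall>x y. cinner (A (\<Psi> x)) y = cinner (\<Psi> (A x)) y)"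
      by (simp add: V_def adj)
    also have "\<dots> \<longleftrightarrow> (\<forall>x. A (\<Psi> x) = \<Psi> (A x))"
    proof
      assume eq: "\<forall>x y. cinner (A (\<Psi> x)) y = cinner (\<Psi> (A x)) y"
      show "\<forall>x. A (\<Psi> x) = \<Psi> (A x)"
      proof
        fix x
        have "cinner z (A (\<Psi> x)) = cinner z (\<Psi> (A x))" for z
          by (rule cinner_flip) (use eq in blast)
        then show "A (\<Psi> x) = \<Psi> (A x)"
          by (rule cinner_ext[OF hilbert_UNIV UNIV_I UNIV_I])
      qed
    qed simp
    finally show ?thesis .
  qed
  have top: "topspace wot = ?S"
    unfolding wot_def topspace_pullback_topology by simp
  have "openin wot (?g -` (- V) \<inter> ?S)"
    unfolding wot_def openin_pullback_topology using V by (intro exI[of _ "- V"]) (simp add: open_Compl)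
  moreover have "?g -` (- V) \<inter> ?S = ?S - {A. bounded_op UNIV UNIV A \<and> (\<forall>x. A (\<Psi> x) = \<Psi> (A x))}"
    using iff by auto
  ultimately show ?thesis
    unfolding closedin_def top by auto
qed

text \<open>The commutant of \<Psi> is one of the algebras whose intersection defines
  \<open>nc_toeplitz\<close>.\<close>

lemma nc_toeplitz_commutant:
  fixes \<Psi> :: "('n::finite, complex) fock \<Rightarrow> ('n, complex) fock"
  assumes \<Psi>: "bounded_op UNIV UNIV \<Psi>" and comm: "\<And>i x. \<Psi> (creation i x) = creation i (\<Psi> x)"
    and f: "f \<in> nc_toeplitz"
  shows "bounded_op UNIV UNIV f" "f (\<Psi> x) = \<Psi> (f x)"
proof -
  let ?A = "{A. bounded_op UNIV UNIV A \<and> (\<forall>x. A (\<Psi> x) = \<Psi> (A x))}"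
  have "unital_operator_algebra ?A"
    unfolding unital_operator_algebra_def
  proof (intro conjI ballI allI)
    show "id \<in> ?A"
      by (auto intro: bounded_opI[where K=1])
  next
    fix A B assume "A \<in> ?A" "B \<in> ?A"
    then show "(\<lambda>x. A x + B x) \<in> ?A" "A \<circ> B \<in> ?A"
      using bounded_op_add[OF \<Psi>] bounded_op_comp[of UNIV UNIV B UNIV A]
      by (simp_all add: bounded_op_add_op comp_def)
  next
    fix c A assume "A \<in> ?A"
    then show "(\<lambda>x. c *\<^sub>C A x) \<in> ?A"
      using bounded_op_scaleC[OF \<Psi>] by (simp add: bounded_op_scaleC_op)
  qed simp
  moreover have "range left_creation \<subseteq> ?A"
    by (auto simp: left_creation_eq bounded_op_creation comm)
  ultimately have "f \<in> ?A"
    using f closedin_wot_commutant[OF \<Psi>] unfolding nc_toeplitz_def by blast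
  then show "bounded_op UNIV UNIV f" "f (\<Psi> x) = \<Psi> (f x)" by auto
qed

lemma nc_toeplitz_bounded:
  fixes f :: "('n::finite, complex) fock \<Rightarrow> ('n, complex) fock"
  assumes "f \<in> nc_toeplitz" shows "bounded_op UNIV UNIV f"
  using assms by (rule nc_toeplitz_commutant(1)[where \<Psi>="\<lambda>x. x", rotated 2])
    (auto intro: bounded_opI[where K=1])

lemma left_creation_nc_toeplitz: "left_creation i \<in> nc_toeplitz"
  unfolding nc_toeplitz_def by blast

lemma nc_toeplitz_comp: "A \<in> nc_toeplitz \<Longrightarrow> B \<in> nc_toeplitz \<Longrightarrow> A \<circ> B \<in> nc_toeplitz"
  unfolding nc_toeplitz_def unital_operator_algebra_def by blast

lemma word_creation_nc_toeplitz: "word_op left_creation \<alpha> \<in> nc_toeplitz"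
proof (induction \<alpha>)
  case Nil
  show ?case unfolding word_op.simps nc_toeplitz_def unital_operator_algebra_def by blast
next
  case (Cons i \<alpha>)
  then show ?case unfolding word_op.simps by (rule nc_toeplitz_comp[OF left_creation_nc_toeplitz])
qed

lemma word_creation_vacuum: "word_op left_creation \<alpha> (fock_basis []) = fock_basis \<alpha>"
  by (induction \<alpha>) (simp_all add: word_op.simps left_creation_fock_basis)

lemma bounded_op_closure_span_mem:
  fixes A :: "'a::chilbert \<Rightarrow> 'b::chilbert"
  assumes A: "bounded_op UNIV UNIV A" and W: "hilbert_subspace W" and S: "\<And>s. s \<in> S \<Longrightarrow> A s \<in> W"
    and x: "x \<in> closure (complex_vector.span S)"
  shows "A x \<in> W"
proof (rule bounded_op_closure_mem[OF A _ _ x])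
  fix s assume "s \<in> complex_vector.span S"
  then show "A s \<in> W"
    by (induction rule: complex_vector.span_induct_alt)
      (simp_all add: bounded_op_zero[OF hilbert_UNIV A] bounded_op_add[OF A] bounded_op_scaleC[OF A]
        hilbert_intros[OF W] S)
qed (use W in \<open>simp add: hilbert_subspace_def\<close>)

lemma tensor_op_mem:
  fixes K :: "'a::chilbert set" and A :: "('n, 'a) fock \<Rightarrow> 'b::chilbert"
  assumes "bounded_op UNIV UNIV A" "hilbert_subspace W" "\<And>x h. x \<in> N \<Longrightarrow> h \<in> K \<Longrightarrow> A (x \<otimes>\<^sub>t h) \<in> W"
    "z \<in> N \<otimes>\<^sub>s K"
  shows "A z \<in> W"
  by (rule bounded_op_closure_span_mem[OF assms(1,2) _ assms(4)[unfolded tensor_space_def]])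
    (use assms(3) in auto)

locale toeplitz_ideal =
  fixes J :: "(('n::finite, complex) fock \<Rightarrow> ('n, complex) fock) set"
  assumes J: "wot_closed_ideal J"
begin

abbreviation M where "M \<equiv> M_space J"
abbreviation N where "N \<equiv> N_space J"

lemma J_nc_toeplitz: "\<phi> \<in> J \<Longrightarrow> \<phi> \<in> nc_toeplitz"
  using J unfolding wot_closed_ideal_def by blast

lemma J_op: "\<phi> \<in> J \<Longrightarrow> bounded_op UNIV UNIV \<phi>"
  by (intro nc_toeplitz_bounded J_nc_toeplitz)

lemma J_comp: "\<phi> \<in> J \<Longrightarrow> A \<in> nc_toeplitz \<Longrightarrow> A \<circ> \<phi> \<in> J"
  and J_comp': "\<phi> \<in> J \<Longrightarrow> A \<in> nc_toeplitz \<Longrightarrow> \<phi> \<circ> A \<in> J"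
  using J unfolding wot_closed_ideal_def by blast+

lemma hilbert_M [simp]: "hilbert_subspace M"
  unfolding M_space_def by (intro hilbert_closure complex_vector.subspace_span)

lemma hilbert_N [simp]: "hilbert_subspace N"
  unfolding N_space_def by (intro hilbert_ominus hilbert_UNIV)

lemma J_mem_M: "\<phi> \<in> J \<Longrightarrow> \<phi> f \<in> M"
  unfolding M_space_def
  by (rule subsetD[OF closure_subset], rule complex_vector.span_base) auto

lemma N_orth: "x \<in> N \<Longrightarrow> m \<in> M \<Longrightarrow> cinner x m = 0"
  by (simp add: N_space_def ominus_def)

lemma N_orth': "x \<in> N \<Longrightarrow> m \<in> M \<Longrightarrow> cinner m x = 0"
  using N_orth cinner_commute_0 by blast

lemma diff_proj_M: "x - proj M x \<in> N"
  by (simp add: N_space_def ominus_def proj_orth)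

text \<open>Since \<Psi> (\<phi> f) = \<phi> (\<Psi> f), generators of \<open>M\<close> are sent to
  generators.\<close>

lemma M_commutant:
  assumes \<Psi>: "bounded_op UNIV UNIV \<Psi>" and comm: "\<And>i x. \<Psi> (creation i x) = creation i (\<Psi> x)"
    and m: "m \<in> M"
  shows "\<Psi> m \<in> M"
proof (rule bounded_op_closure_span_mem[OF \<Psi> hilbert_M _ m[unfolded M_space_def]])
  fix s assume "s \<in> {\<phi> f |\<phi> f. \<phi> \<in> J}"
  then obtain \<phi> f where s: "s = \<phi> f" "\<phi> \<in> J" by blast
  then show "\<Psi> s \<in> M"
    using nc_toeplitz_commutant(2)[OF \<Psi> comm J_nc_toeplitz, of \<phi> f] J_mem_M[of \<phi> "\<Psi> f"] by simp
qed

text \<open>Left multiplication in the ideal; dually, the orthogonal complement becomes invariant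
  under the backward shifts.\<close>

lemma M_creation: "m \<in> M \<Longrightarrow> creation i m \<in> M"
proof (rule bounded_op_closure_span_mem[OF bounded_op_creation hilbert_M])
  fix s assume "s \<in> {\<phi> f |\<phi> f. \<phi> \<in> J}"
  then obtain \<phi> f where s: "s = \<phi> f" "\<phi> \<in> J" by blast
  have "left_creation i \<circ> \<phi> \<in> J"
    by (intro J_comp left_creation_nc_toeplitz s)
  from J_mem_M[OF this, of f] show "creation i s \<in> M"
    by (simp add: s left_creation_eq)
qed (simp add: M_space_def)

lemma N_shift:
  assumes x: "x \<in> N" shows "ell2_shift [i] x \<in> N"
proof -
  have "cinner (ell2_shift [i] x) m = 0" if m: "m \<in> M" for m
  proof -
    have "cinner m (ell2_shift [i] x) = 0"
      unfolding cinner_creation[symmetric] by (rule N_orth'[OF x M_creation[OF m]])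
    then show ?thesis by (simp add: cinner_commute_0)
  qed
  then show ?thesis by (simp add: N_space_def ominus_def)
qed

lemma N_tensor_orth_M:
  fixes K :: "'a::chilbert set"
  assumes "m \<in> M" "z \<in> N \<otimes>\<^sub>s K" shows "cinner z (m \<otimes>\<^sub>t h) = 0"
  by (rule tensor_orthI[OF _ assms(2)]) (simp add: cinner_tensor N_orth assms(1))

text \<open>Every \<open>x\<close> is the sum of an \<open>M\<close>-part and an
  \<open>N\<close>-part. The residual of the projection is orthogonal to tensors with the
  \<open>N\<close>-part by construction and to those with the \<open>M\<close>-part by hypothesis,
  hence to itself.\<close>

lemma N_tensor_memI:
  fixes K :: "'a::chilbert set"
  assumes w: "w \<in> UNIV \<otimes>\<^sub>s K" and orth: "\<And>m h. m \<in> M \<Longrightarrow> h \<in> K \<Longrightarrow> cinner (m \<otimes>\<^sub>t h) w = 0"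
  shows "w \<in> N \<otimes>\<^sub>s K"
proof -
  define p where "p = proj (N \<otimes>\<^sub>s K) w"
  have p: "p \<in> N \<otimes>\<^sub>s K" unfolding p_def by (rule proj_mem) simp
  have "N \<otimes>\<^sub>s K \<subseteq> UNIV \<otimes>\<^sub>s K" by (rule tensor_space_mono) simp_all
  then have wp: "w - p \<in> UNIV \<otimes>\<^sub>s K"
    using w p by (intro hilbert_diff) auto
  have "cinner (w - p) (w - p) = 0"
  proof (rule tensor_orthI[OF _ wp])
    fix x and h assume h: "h \<in> K"
    have "cinner (w - p) ((x - proj M x) \<otimes>\<^sub>t h) = 0"
      unfolding p_def by (rule proj_orth[OF hilbert_tensor tensor_mem[OF diff_proj_M h]])
    then have 1: "cinner ((x - proj M x) \<otimes>\<^sub>t h) (w - p) = 0"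
      by (simp add: cinner_commute_0)
    have "cinner (proj M x \<otimes>\<^sub>t h) p = 0"
      using N_tensor_orth_M[OF proj_mem[OF hilbert_M] p] cinner_commute_0 by blast
    then have "cinner (proj M x \<otimes>\<^sub>t h) (w - p) = 0"
      using orth[OF proj_mem[OF hilbert_M] h] by (simp add: cinner.diff_right)
    with 1 show "cinner (x \<otimes>\<^sub>t h) (w - p) = 0"
      by (simp add: tensor_diff_left cinner.diff_left)
  qed
  then have "w = p" by (simp add: cinner_self)
  then show ?thesis using p by simp
qed

lemma N_tensor_shift:
  fixes K :: "'a::chilbert set"
  assumes "z \<in> N \<otimes>\<^sub>s K" shows "ell2_shift [i] z \<in> N \<otimes>\<^sub>s K"
  by (rule tensor_op_mem[OF bounded_op_ell2_shift hilbert_tensor _ assms])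
    (simp add: ell2_shift_tensor tensor_mem N_shift)

lemma constrained_creation_eq: "constrained_creation J i = (\<lambda>x. proj N (creation i x))"
  by (rule ext) (simp add: constrained_creation_def left_creation_eq)

lemma constrained_creation_op: "bounded_op N N (constrained_creation J i)"
  unfolding constrained_creation_eq
  by (rule bounded_op_subset[OF bounded_op_comp[OF bounded_op_creation bounded_op_proj[OF hilbert_N]]])
    (simp_all add: proj_mem)

text \<open>As \<open>N\<close> is invariant under the backward shift, the adjoint of the
  compression is a plain restriction of that shift.\<close>

lemma adj_constrained_creation:
  assumes "x \<in> N" shows "adj N N (constrained_creation J i) x = ell2_shift [i] x"
  by (rule adj_eqI[OF hilbert_N hilbert_N constrained_creation_op assms N_shift[OF assms]])
    (simp add: constrained_creation_eq cinner_proj[OF hilbert_N assms] cinner_creation)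

lemma ampliation_constrained_creation:
  fixes K :: "'a::chilbert set"
  assumes "z \<in> N \<otimes>\<^sub>s K"
  shows "ampliation N K (constrained_creation J i) z = proj (N \<otimes>\<^sub>s K) (creation i z)"
  unfolding constrained_creation_eq
  by (rule ampliation_compression[OF hilbert_N bounded_op_creation creation_tensor assms])

lemma ampliation_adj_constrained_creation:
  fixes K :: "'a::chilbert set"
  assumes "z \<in> N \<otimes>\<^sub>s K"
  shows "ampliation N K (adj N N (constrained_creation J i)) z = ell2_shift [i] z"
proof (rule ampliation_eqI[OF _ _ assms])
  show "bounded_op (N \<otimes>\<^sub>s K) (N \<otimes>\<^sub>s K) (ell2_shift [i])"
    by (rule bounded_op_subset[OF bounded_op_ell2_shift]) (simp_all add: N_tensor_shift)
qed (simp add: adj_constrained_creation ell2_shift_tensor)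

end

section \<open>The functional calculus and the Poisson kernel\<close>

text \<open>Absolute convergence dominates all r in [0, 1] at once, so the Weierstrass test makes
  the sum continuous up to r = 1.\<close>

lemma abel_limit_absolute:
  fixes b :: "nat \<Rightarrow> complex"
  assumes "summable (\<lambda>k. norm (b k))"
  shows "((\<lambda>r. \<Sum>k. of_real (r ^ k) * b k) \<longlongrightarrow> (\<Sum>k. b k)) (at_left (1 :: real))"
proof -
  let ?f = "\<lambda>r :: real. \<Sum>k. of_real (r ^ k) * b k"
  have "uniform_limit {0..1} (\<lambda>n r. \<Sum>k<n. of_real (r ^ k) * b k) ?f sequentially"
  proof (rule Weierstrass_m_test[OF _ assms])
    fix k and r :: real assume "r \<in> {0..1}"
    then have "\<bar>r ^ k\<bar> \<le> 1" by (simp add: power_abs power_le_one)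
    then show "norm (of_real (r ^ k) * b k) \<le> norm (b k)"
      unfolding norm_mult norm_of_real by (rule mult_left_le_one_le[OF norm_ge_zero abs_ge_zero])
  qed
  then have "continuous_on {0..1} ?f"
    by (rule uniform_limit_theorem[rotated]) (auto intro!: always_eventually continuous_intros)
  then have "(?f \<longlongrightarrow> ?f 1) (at 1 within {0..1})"
    unfolding continuous_on_def by (rule bspec) simp
  then show ?thesis
    by (simp add: at_within_Icc_at_left)
qed

context row_contraction_op
begin

text \<open>The coefficients are square summable, being those of \<open>f\<close> at the vacuum, and
  the row of words of length k is contractive; r^k makes the series geometric for r < 1.\<close>

lemma fcalc_level_bound:
  fixes f :: "('n, complex) fock \<Rightarrow> ('n, complex) fock"
  assumes "0 \<le> r"
  shows "norm (\<Sum>\<alpha> | length \<alpha> = k. (of_real (r ^ length \<alpha>) * fourier_coeff f \<alpha>) *\<^sub>C word_op T \<alpha> x)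
    \<le> norm (f (fock_basis [])) * norm x * r ^ k"
proof -
  let ?a = "fourier_coeff f"
  have "(\<Sum>\<alpha> | length \<alpha> = k. (of_real (r ^ length \<alpha>) * ?a \<alpha>) *\<^sub>C word_op T \<alpha> x)
      = (\<Sum>\<alpha> | length \<alpha> = k. word_op T \<alpha> ((of_real (r ^ k) * ?a \<alpha>) *\<^sub>C x))"
    by (intro sum.cong) (simp_all add: bounded_op_scaleC[OF word_op_op])
  then have "norm (\<Sum>\<alpha> | length \<alpha> = k. (of_real (r ^ length \<alpha>) * ?a \<alpha>) *\<^sub>C word_op T \<alpha> x)
      \<le> sqrt (\<Sum>\<alpha> | length \<alpha> = k. (norm ((of_real (r ^ k) * ?a \<alpha>) *\<^sub>C x))\<^sup>2)"
    using norm_level_sum_le by simp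
  also have "(\<Sum>\<alpha> | length \<alpha> = k. (norm ((of_real (r ^ k) * ?a \<alpha>) *\<^sub>C x))\<^sup>2)
      = (norm x * r ^ k)\<^sup>2 * (\<Sum>\<alpha> | length \<alpha> = k. (norm (?a \<alpha>))\<^sup>2)"
    unfolding sum_distrib_left
    by (intro sum.cong) (simp_all add: norm_scaleC norm_mult power_mult_distrib norm_power assms)
  also have "\<dots> \<le> (norm x * r ^ k)\<^sup>2 * (norm (f (fock_basis [])))\<^sup>2"
    unfolding fourier_coeff_def by (intro mult_left_mono sum_norm_ell2_coeff_le) simp_all
  finally show ?thesis
    using assms by (simp add: real_sqrt_mult ac_simps)
qed

lemma fcalc_summable:
  fixes f :: "('n, complex) fock \<Rightarrow> ('n, complex) fock"
  assumes "0 \<le> r" "r < 1"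
  shows "summable (\<lambda>k. \<Sum>\<alpha> | length \<alpha> = k. (of_real (r ^ length \<alpha>) * fourier_coeff f \<alpha>) *\<^sub>C word_op T \<alpha> x)"
proof (rule summable_comparison_test'[where N=0])
  show "summable (\<lambda>k. norm (f (fock_basis [])) * norm x * r ^ k)"
    using assms by (intro summable_mult summable_geometric) simp
  show "norm (\<Sum>\<alpha> | length \<alpha> = k. (of_real (r ^ length \<alpha>) * fourier_coeff f \<alpha>) *\<^sub>C word_op T \<alpha> x)
    \<le> norm (f (fock_basis [])) * norm x * r ^ k" for k
    by (rule fcalc_level_bound[OF assms(1)])
qed

text \<open>Expanded over words, the left side is the sum of a_\<alpha> times
  \<open>cinner (word_op T \<alpha> (D d)) h\<close>, formally the form of \<phi>(T) = 0 at
  \<open>D d\<close> and \<open>h\<close>. The Abel limit gives this a meaning.\<close>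

lemma cinner_poisson_fcalc:
  fixes \<phi> :: "('n, complex) fock \<Rightarrow> ('n, complex) fock"
  assumes 0: "has_fcalc UNIV T \<phi> (\<lambda>_. 0)"
  shows "cinner (\<phi> (fock_basis []) \<otimes>\<^sub>t d) (poisson h) = 0"
proof -
  let ?a = "fourier_coeff \<phi>" and ?S = "cinner (\<phi> (fock_basis []) \<otimes>\<^sub>t d) (poisson h)"
  let ?F = "\<lambda>r :: real. \<Sum>k. \<Sum>\<alpha> | length \<alpha> = k. (of_real (r ^ length \<alpha>) * ?a \<alpha>) *\<^sub>C word_op T \<alpha> (D d)"
  define c where "c \<alpha> = ?a \<alpha> * cinner (word_op T \<alpha> (D d)) h" for \<alpha>
  define b where "b k = (\<Sum>\<alpha> | length \<alpha> = k. c \<alpha>)" for k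
  have c: "c \<alpha> = cinner (ell2_coeff (\<phi> (fock_basis []) \<otimes>\<^sub>t d) \<alpha>) (ell2_coeff (poisson h) \<alpha>)" for \<alpha>
    by (simp add: c_def fourier_coeff_def ell2_coeff_tensor cinner_scaleC_left poisson_coeff cinner_word_op cinner_D)
  have summ: "c summable_on UNIV"
    unfolding c by (rule ell2_cinner_summable)
  then have "(c has_sum ?S) UNIV"
    unfolding cinner_ell2_def c[symmetric] by (rule has_sum_infsum)
  then have b: "b sums ?S"
    unfolding b_def by (rule has_sum_length_sums)
  \<comment> \<open>Unordered summability of complex numbers is absolute summability, as the Abel
    limit requires.\<close>
  have "(\<lambda>\<alpha>. norm (c \<alpha>)) summable_on UNIV"
    using summ by (simp add: summable_on_iff_abs_summable_on_complex)
  then have "summable (\<lambda>k. \<Sum>\<alpha> | length \<alpha> = k. norm (c \<alpha>))"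
    using has_sum_length_sums has_sum_infsum sums_summable by blast
  then have "summable (\<lambda>k. norm (b k))"
    by (rule summable_comparison_test'[where N=0]) (simp add: b_def norm_sum)
  from abel_limit_absolute[OF this]
  have lim: "((\<lambda>r. \<Sum>k. of_real (r ^ k) * b k) \<longlongrightarrow> ?S) (at_left 1)"
    unfolding sums_unique[OF b, symmetric] .
  have "(?F \<longlongrightarrow> 0) (at_left 1)"
    using 0 by (simp add: has_fcalc_def)
  then have "((\<lambda>r. cinner (?F r) h) \<longlongrightarrow> cinner 0 h) (at_left 1)"
    by (intro cinner.tendsto tendsto_const)
  \<comment> \<open>For 0 < r < 1 the series of vectors converges, so the inner product may be taken
    term by term.\<close>
  moreover have "\<forall>\<^sub>F r in at_left 1. cinner (?F r) h = (\<Sum>k. of_real (r ^ k) * b k)"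
  proof (rule eventually_mono[OF eventually_at_left_real[of 0 1]])
    fix r :: real assume r: "r \<in> {0<..<1}"
    have "cinner (?F r) h = (\<Sum>k. cinner (\<Sum>\<alpha> | length \<alpha> = k. (of_real (r ^ length \<alpha>) * ?a \<alpha>) *\<^sub>C word_op T \<alpha> (D d)) h)"
      using r by (intro bounded_linear.suminf[OF cinner.bounded_linear_left] fcalc_summable) auto
    also have "\<dots> = (\<Sum>k. of_real (r ^ k) * b k)"
      by (simp add: cinner.sum_left cinner_scaleC_left b_def c_def sum_distrib_left mult.assoc)
    finally show "cinner (?F r) h = (\<Sum>k. of_real (r ^ k) * b k)" .
  qed simp
  ultimately have "((\<lambda>r. \<Sum>k. of_real (r ^ k) * b k) \<longlongrightarrow> 0) (at_left 1)"
    by (simp add: Lim_transform_eventually)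
  with lim show ?thesis
    using tendsto_unique trivial_limit_at_left_real by blast
qed

lemma Ca_mem:
  assumes "y \<in> UNIV \<otimes>\<^sub>s defect T" shows "Ca y \<in> UNIV \<otimes>\<^sub>s defect_star T"
proof (rule tensor_UNIV_memI)
  fix \<alpha>
  show "ell2_coeff (Ca y) \<alpha> \<in> defect_star T"
    using assms
  proof (induction \<alpha> arbitrary: y)
    case Nil
    then have "ell2_coeff y [] \<in> defect T" by (intro tensor_coeff_mem) simp_all
    then show ?case by (simp add: Ca_Nil hilbert_diff Ds_mem Ra_mem)
  next
    case (Cons i \<beta>)
    have "ell2_shift [i] y \<in> UNIV \<otimes>\<^sub>s defect T"
      using Cons.prems by (intro tensor_UNIV_memI) (simp_all add: tensor_coeff_mem[of "defect T" y UNIV])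
    from Cons.IH[OF this] show ?case
      by (simp flip: Ca_shift)
  qed
qed simp

end

section \<open>The constrained characteristic function\<close>

locale constrained_op = row_contraction_op T + toeplitz_ideal J
  for T :: "'n::finite \<Rightarrow> 'h::chilbert \<Rightarrow> 'h"
    and J :: "(('n, complex) fock \<Rightarrow> ('n, complex) fock) set" +
  assumes fcalc: "\<forall>\<phi>\<in>J. has_fcalc UNIV T \<phi> (\<lambda>_. 0)"
begin

abbreviation G where "G \<equiv> N \<otimes>\<^sub>s defect T"
abbreviation Gs where "Gs \<equiv> N \<otimes>\<^sub>s defect_star T"
abbreviation C where "C \<equiv> constrained_char_fun J T"

lemma G_UNIV: "y \<in> G \<Longrightarrow> y \<in> UNIV \<otimes>\<^sub>s defect T"
  and Gs_UNIV: "f \<in> Gs \<Longrightarrow> f \<in> UNIV \<otimes>\<^sub>s defect_star T"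
  using tensor_space_mono[of N UNIV "defect T"] tensor_space_mono[of N UNIV "defect_star T"] by auto

text \<open>The calculus gives orthogonality to the value of \<phi> at the vacuum. Composing \<phi>
  with a word of creation operators stays in \<open>J\<close> and covers \<phi> e_\<alpha>;
  continuity of \<phi> covers the rest. The slice moves the closure arguments to the scalar Fock
  space.\<close>

lemma cinner_M_poisson:
  assumes m: "m \<in> M" shows "cinner (m \<otimes>\<^sub>t d) (poisson h) = 0"
proof -
  have "cinner m (slice d (poisson h)) = 0"
  proof (rule cinner_eq_0_closure_span[OF _ m[unfolded M_space_def]])
    fix s assume "s \<in> {\<phi> f |\<phi> f. \<phi> \<in> J}"
    then obtain \<phi> f where s: "s = \<phi> f" "\<phi> \<in> J" by blast
    have adj: "cinner (\<phi> f) u = cinner f (adj UNIV UNIV \<phi> u)" for f u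
      by (intro cinner_adj[OF hilbert_UNIV hilbert_UNIV J_op[OF s(2)]]) simp_all
    have "cinner f (adj UNIV UNIV \<phi> (slice d (poisson h))) = 0"
    proof (rule cinner_eq_0_closure_span[of "range fock_basis"])
      fix e assume "e \<in> range (fock_basis :: 'n list \<Rightarrow> _)"
      then obtain \<alpha> :: "'n list" where e: "e = fock_basis \<alpha>" by blast
      have "\<phi> \<circ> word_op left_creation \<alpha> \<in> J"
        by (intro J_comp' s word_creation_nc_toeplitz)
      then have "cinner ((\<phi> \<circ> word_op left_creation \<alpha>) (fock_basis []) \<otimes>\<^sub>t d) (poisson h) = 0"
        by (intro cinner_poisson_fcalc) (use fcalc in blast)
      then show "cinner e (adj UNIV UNIV \<phi> (slice d (poisson h))) = 0"
        by (simp add: adj[symmetric] cinner_slice e word_creation_vacuum)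
    qed (simp add: closure_span_fock_basis)
    then show "cinner s (slice d (poisson h)) = 0"
      by (simp add: s adj)
  qed
  then show ?thesis by (simp add: cinner_slice)
qed

lemma poisson_mem_G: "poisson h \<in> G"
  by (rule N_tensor_memI[OF poisson_mem cinner_M_poisson])

text \<open>
  The slices of \<open>f \<mapsto> \<Theta>(f \<otimes> k)\<close> commute with the creation operators, hence with \<open>F\<^sub>n\<^sup>\<infinity>\<close>, so that they
  leave \<open>M\<close> invariant.
\<close>

lemma Ca_mem_Gs:
  assumes y: "y \<in> G" shows "Ca y \<in> Gs"
proof (rule N_tensor_memI[OF Ca_mem[OF G_UNIV[OF y]]])
  fix m and k :: "'h ^ 'n" assume m: "m \<in> M"
  have "cinner y (char_op (m \<otimes>\<^sub>t k)) = 0"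
  proof (rule tensor_orthI[OF _ y])
    fix x h assume x: "x \<in> N"
    have "slice h (char_op (m \<otimes>\<^sub>t k)) \<in> M"
    proof (rule M_commutant[OF _ _ m])
      show "bounded_op UNIV UNIV (\<lambda>f. slice h (char_op (f \<otimes>\<^sub>t k)))"
        by (rule bounded_op_comp[OF bounded_op_comp[OF bounded_op_tensor_left char_op_op] bounded_op_slice])
      show "slice h (char_op (creation i f \<otimes>\<^sub>t k)) = creation i (slice h (char_op (f \<otimes>\<^sub>t k)))" for i f
        by (simp add: creation_tensor[symmetric] char_op_creation slice_creation)
    qed
    from N_orth[OF x this] show "cinner (x \<otimes>\<^sub>t h) (char_op (m \<otimes>\<^sub>t k)) = 0"
      by (simp add: cinner_slice)
  qed
  then show "cinner (m \<otimes>\<^sub>t k) (Ca y) = 0"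
    by (simp add: cinner_char_op[symmetric] cinner_commute_0)
qed

lemma C_eq: "f \<in> Gs \<Longrightarrow> C f = proj G (char_op f)"
  by (simp add: constrained_char_fun_def char_fun_eq Gs_UNIV)

lemma C_op: "bounded_op Gs G C"
proof (rule bounded_op_cong[OF hilbert_tensor _ C_eq])
  show "bounded_op Gs G (\<lambda>f. proj G (char_op f))"
    by (rule bounded_op_subset[OF bounded_op_comp[OF char_op_op bounded_op_proj[OF hilbert_tensor]]])
      (simp_all add: proj_mem)
qed

lemma cinner_C: "f \<in> Gs \<Longrightarrow> y \<in> G \<Longrightarrow> cinner (C f) y = cinner f (Ca y)"
  by (simp add: C_eq cinner_proj[OF hilbert_tensor] cinner_char_op)

text \<open>Because \<open>Ca\<close> already maps \<open>G\<close> into \<open>Gs\<close>, the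
  adjoint of the compression is the restriction of \<open>Ca\<close>, without a projection.\<close>

lemma adj_C: "y \<in> G \<Longrightarrow> adj Gs G C y = Ca y"
  by (rule adj_eqI[OF hilbert_tensor hilbert_tensor C_op])
    (simp_all add: Ca_mem_Gs cinner_C)

lemma norm_C_le: "f \<in> Gs \<Longrightarrow> norm (C f) \<le> norm f"
  using norm_proj_le[OF hilbert_tensor, of N "defect T" "char_op f"] norm_char_op_le[of f]
  by (simp add: C_eq)

text \<open>Checked against y in \<open>G\<close>: \<open>Ca\<close> commutes with backward shifts
  and stays in \<open>Gs\<close>, so the projections disappear from the inner products.\<close>

lemma multi_analytic_C: "multi_analytic J (defect_star T) (defect T) C"
  unfolding multi_analytic_def
proof (intro conjI C_op allI ballI)
  fix i f assume f: "f \<in> Gs"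
  let ?p = "proj Gs (creation i f)"
  have p: "?p \<in> Gs" by (rule proj_mem) simp
  have Cf: "C f \<in> G" by (rule bounded_op_mem[OF C_op f])
  have "C ?p = proj G (creation i (C f))"
  proof (rule cinner_ext[OF hilbert_tensor bounded_op_mem[OF C_op p] proj_mem[OF hilbert_tensor]])
    fix y assume y: "y \<in> G"
    have "cinner (C ?p) y = cinner (creation i f) (Ca y)"
      by (simp add: cinner_C[OF p y] cinner_proj[OF hilbert_tensor Ca_mem_Gs[OF y]])
    also have "\<dots> = cinner (C f) (ell2_shift [i] y)"
      by (simp add: cinner_creation Ca_shift cinner_C[OF f N_tensor_shift[OF y]])
    also have "\<dots> = cinner (proj G (creation i (C f))) y"
      by (simp add: cinner_proj[OF hilbert_tensor y] cinner_creation)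
    finally show "cinner y (C ?p) = cinner y (proj G (creation i (C f)))"
      by (rule cinner_flip)
  qed
  then show "C (ampliation N (defect_star T) (constrained_creation J i) f)
      = ampliation N (defect T) (constrained_creation J i) (C f)"
    by (simp add: ampliation_constrained_creation f Cf)
qed

text \<open>By \<open>norm_Ka_Ca\<close> the quadratic form of the difference \<open>?E\<close>
  vanishes on \<open>G\<close>. It maps \<open>G\<close> to itself, where
  \<open>poisson_mem_G\<close> enters, so \<open>cinner_diagonal_0\<close> applies.\<close>

lemma poisson_Ka:
  assumes y: "y \<in> G" shows "poisson (Ka y) = y - C (Ca y)"
proof -
  let ?E = "\<lambda>y. y - C (Ca y) - poisson (Ka y)"
  have mem: "?E y \<in> G" if "y \<in> G" for y
    using that by (simp add: hilbert_diff poisson_mem_G bounded_op_mem[OF C_op] Ca_mem_Gs)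
  have "bounded_op G G ?E"
  proof (rule bounded_opI[where K=3])
    fix x y c assume x: "x \<in> G"
    show "?E x \<in> G" by (rule mem[OF x])
    show "?E (x + y) = ?E x + ?E y" if "y \<in> G"
      using x that by (simp add: bounded_op_add[OF Ca_op] bounded_op_add[OF C_op] bounded_op_add[OF Ka_op]
        bounded_op_add[OF poisson_op] Ca_mem_Gs)
    show "?E (c *\<^sub>C x) = c *\<^sub>C ?E x"
      using x by (simp add: bounded_op_scaleC[OF Ca_op] bounded_op_scaleC[OF C_op] bounded_op_scaleC[OF Ka_op]
        bounded_op_scaleC[OF poisson_op] Ca_mem_Gs scaleC.diff_right)
    have "norm (C (Ca x)) \<le> norm x"
      using norm_C_le[OF Ca_mem_Gs[OF x]] norm_Ca_le[of x] by simp
    moreover have "norm (poisson (Ka x)) \<le> norm x"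
      using norm_poisson_le[of "Ka x"] norm_Ka_le[of x] by simp
    moreover have "norm (?E x) \<le> norm x + norm (C (Ca x)) + norm (poisson (Ka x))"
      using norm_triangle_ineq4[of "x - C (Ca x)" "poisson (Ka x)"] norm_triangle_ineq4[of x "C (Ca x)"] by simp
    ultimately show "norm (?E x) \<le> 3 * norm x" by simp
  qed
  moreover have "cinner (?E x) x = 0" if x: "x \<in> G" for x
  proof -
    have "cinner (?E x) x = of_real ((norm x)\<^sup>2 - (norm (Ca x))\<^sup>2 - (norm (Ka x))\<^sup>2)"
      by (simp add: cinner.diff_left cinner_C[OF Ca_mem_Gs[OF x] x] cinner_poisson cinner_self)
    moreover have "(norm x)\<^sup>2 - (norm (Ca x))\<^sup>2 - (norm (Ka x))\<^sup>2 = 0"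
      using norm_Ka_Ca[of x] by linarith
    ultimately show ?thesis by (simp only: of_real_0)
  qed
  ultimately have "?E y = 0"
    using y by (intro cinner_diagonal_0[OF hilbert_tensor, of _ _ ?E]) auto
  then show ?thesis by (simp add: algebra_simps)
qed

end

section \<open>Unitary equivalence\<close>

context
  fixes Y :: "'b::chilbert set" and U :: "'a::chilbert \<Rightarrow> 'b"
  assumes U: "unitary_op UNIV Y U"
begin

lemma unitary_bounded: "bounded_op UNIV Y U"
  and unitary_cinner: "cinner (U x) (U y) = cinner x y"
  and unitary_mem: "U x \<in> Y"
  and unitary_surj: "z \<in> Y \<Longrightarrow> \<exists>x. z = U x"
  using U by (auto simp: unitary_op_def)

lemma unitary_norm: "norm (U x) = norm x"
proof -
  have "(norm (U x))\<^sup>2 = (norm x)\<^sup>2"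
    unfolding Re_cinner_self[symmetric] unitary_cinner ..
  then show ?thesis by (simp add: power2_eq_iff_nonneg)
qed

lemma unitary_inv: "inv_into UNIV U (U x) = x"
proof -
  have "norm (U (inv_into UNIV U (U x)) - U x) = norm (inv_into UNIV U (U x) - x)"
    unfolding bounded_op_diff[OF hilbert_UNIV unitary_bounded UNIV_I UNIV_I, symmetric]
    by (rule unitary_norm)
  moreover have "U (inv_into UNIV U (U x)) = U x"
    by (rule f_inv_into_f) simp
  ultimately show ?thesis by simp
qed

lemma bounded_op_transfer:
  assumes S: "bounded_op UNIV UNIV S" and P: "\<And>x. P (U x) = U (S x)"
  shows "bounded_op Y Y P"
proof -
  obtain K where K: "\<And>x. norm (S x) \<le> K * norm x"
    using bounded_op_bound[OF S] by auto
  show ?thesis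
  proof (rule bounded_opI[where K=K])
    fix y c assume "y \<in> Y"
    then obtain x where y: "y = U x" using unitary_surj by blast
    show "P y \<in> Y" unfolding y P by (rule unitary_mem)
    show "norm (P y) \<le> K * norm y" unfolding y P unitary_norm by (rule K)
    show "P (c *\<^sub>C y) = c *\<^sub>C P y"
      unfolding y P bounded_op_scaleC[OF unitary_bounded UNIV_I, symmetric] bounded_op_scaleC[OF S UNIV_I, symmetric] ..
    fix y' assume "y' \<in> Y"
    then obtain x' where y': "y' = U x'" using unitary_surj by blast
    show "P (y + y') = P y + P y'"
      unfolding y y' P bounded_op_add[OF unitary_bounded UNIV_I UNIV_I, symmetric]
        bounded_op_add[OF S UNIV_I UNIV_I, symmetric] ..
  qed
qed

lemma adj_transfer:
  assumes Y: "hilbert_subspace Y" and S: "bounded_op UNIV UNIV S" and P: "\<And>x. P (U x) = U (S x)"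
  shows "adj Y Y P (U x) = U (adj UNIV UNIV S x)"
proof (rule adj_eqI[OF Y Y bounded_op_transfer[OF S P] unitary_mem unitary_mem])
  fix z assume "z \<in> Y"
  then obtain w where z: "z = U w" using unitary_surj by blast
  show "cinner (P z) (U x) = cinner z (U (adj UNIV UNIV S x))"
    unfolding z P unitary_cinner
    by (intro cinner_adj[OF hilbert_UNIV hilbert_UNIV S]) simp_all
qed

end

context row_contraction_op
begin

context
  fixes Y :: "'b::chilbert set" and U :: "'h \<Rightarrow> 'b" and T' :: "'n \<Rightarrow> 'b \<Rightarrow> 'b"
  assumes Y: "hilbert_subspace Y" and U: "unitary_op UNIV Y U"
    and T': "\<And>i x. T' i (U x) = U (T i x)"
begin

lemma word_op_transfer: "word_op T' \<alpha> (U x) = U (word_op T \<alpha> x)"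
  by (induction \<alpha>) (simp_all add: word_op.simps T')

lemma T'_op: "bounded_op Y Y (T' i)"
  by (rule bounded_op_transfer[OF U T_op]) (rule T')

lemma adj_T': "adj Y Y (T' i) (U x) = U (Ta i x)"
  by (rule adj_transfer[OF U Y T_op]) (rule T')

lemma adj_word_transfer: "adj Y Y (word_op T' \<alpha>) (U x) = U (Tw \<alpha> x)"
  by (rule adj_transfer[OF U Y word_op_op]) (rule word_op_transfer)

lemma unitarily_equivalent_transfer: "unitarily_equivalent UNIV T Y T'"
  unfolding unitarily_equivalent_def by (intro exI[of _ U] conjI U allI ballI T'[symmetric])

lemma row_contraction_transfer: "row_contraction Y T'"
proof -
  let ?S = "\<lambda>x. x - (\<Sum>i\<in>UNIV. T i (Ta i x))" and ?P = "\<lambda>x. x - (\<Sum>i\<in>UNIV. T' i (adj Y Y (T' i) x))"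
  have S: "bounded_op UNIV UNIV ?S" "\<And>x. cinner (?S x) x \<in> \<real>\<^sub>\<ge>\<^sub>0"
    using row by (simp_all add: row_contraction_def positive_op_def)
  have P: "?P (U x) = U (?S x)" for x
    by (simp add: adj_T' T' bounded_op_diff[OF hilbert_UNIV unitary_bounded[OF U]]
        bounded_op_sum[OF hilbert_UNIV unitary_bounded[OF U]])
  have "cinner (?P y) y \<in> \<real>\<^sub>\<ge>\<^sub>0" if yY: "y \<in> Y" for y
  proof -
    obtain x where y: "y = U x" using unitary_surj[OF U yY] by blast
    show ?thesis unfolding y P unitary_cinner[OF U] by (rule S)
  qed
  moreover have "bounded_op Y Y ?P" by (rule bounded_op_transfer[OF U S(1)]) (rule P)
  ultimately show ?thesis
    by (simp add: row_contraction_def positive_op_def T'_op)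
qed

lemma cnc_transfer:
  assumes "cnc UNIV T" shows "cnc Y T'"
  unfolding cnc_def
proof
  assume "\<exists>h\<in>Y. h \<noteq> 0 \<and> (\<forall>k\<ge>1. (\<Sum>\<alpha> | length \<alpha> = k. (norm (adj Y Y (word_op T' \<alpha>) h))\<^sup>2) = (norm h)\<^sup>2)"
  then obtain y where y: "y \<in> Y" "y \<noteq> 0"
    and eq: "\<forall>k\<ge>1. (\<Sum>\<alpha> | length \<alpha> = k. (norm (adj Y Y (word_op T' \<alpha>) y))\<^sup>2) = (norm y)\<^sup>2" by blast
  obtain h where h: "y = U h" using unitary_surj[OF U y(1)] by blast
  have "\<forall>k\<ge>1. (\<Sum>\<alpha> | length \<alpha> = k. (norm (Tw \<alpha> h))\<^sup>2) = (norm h)\<^sup>2"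
    using eq unfolding h adj_word_transfer unitary_norm[OF U] .
  moreover have "h \<noteq> 0"
    using y(2) bounded_op_zero[OF hilbert_UNIV unitary_bounded[OF U]] by (auto simp: h)
  ultimately show False using assms unfolding cnc_def by blast
qed

lemma has_fcalc_transfer:
  fixes f :: "('n, complex) fock \<Rightarrow> ('n, complex) fock"
  assumes "has_fcalc UNIV T f (\<lambda>_. 0)" shows "has_fcalc Y T' f (\<lambda>_. 0)"
  unfolding has_fcalc_def
proof
  fix y assume "y \<in> Y"
  then obtain x where y: "y = U x" using unitary_surj[OF U] by blast
  let ?t = "\<lambda>(r :: real) k. \<Sum>\<alpha> | length \<alpha> = k. (of_real (r ^ length \<alpha>) * fourier_coeff f \<alpha>) *\<^sub>C word_op T \<alpha> x"
  note Ub = unitary_bounded[OF U] and UL = bounded_op_UNIV_linear[OF unitary_bounded[OF U]]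
  have "((\<lambda>r. \<Sum>k. ?t r k) \<longlongrightarrow> 0) (at_left 1)"
    using assms by (simp add: has_fcalc_def)
  from bounded_linear.tendsto[OF UL this]
  have "((\<lambda>r. U (\<Sum>k. ?t r k)) \<longlongrightarrow> 0) (at_left 1)"
    by (simp add: bounded_op_zero[OF hilbert_UNIV Ub])
  moreover have "\<forall>\<^sub>F r in at_left 1. U (\<Sum>k. ?t r k)
      = (\<Sum>k. \<Sum>\<alpha> | length \<alpha> = k. (of_real (r ^ length \<alpha>) * fourier_coeff f \<alpha>) *\<^sub>C word_op T' \<alpha> y)"
  proof (rule eventually_mono[OF eventually_at_left_real[of 0 1]])
    fix r :: real assume r: "r \<in> {0<..<1}"
    have "U (\<Sum>k. ?t r k) = (\<Sum>k. U (?t r k))"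
      using r by (intro bounded_linear.suminf[OF UL] fcalc_summable) auto
    then show "U (\<Sum>k. ?t r k)
      = (\<Sum>k. \<Sum>\<alpha> | length \<alpha> = k. (of_real (r ^ length \<alpha>) * fourier_coeff f \<alpha>) *\<^sub>C word_op T' \<alpha> y)"
      by (simp add: y word_op_transfer bounded_op_sum[OF hilbert_UNIV Ub]
          bounded_op_scaleC[OF Ub])
  qed simp
  ultimately show "((\<lambda>r. \<Sum>k. \<Sum>\<alpha> | length \<alpha> = k. (of_real (r ^ length \<alpha>) * fourier_coeff f \<alpha>) *\<^sub>C word_op T' \<alpha> y) \<longlongrightarrow> 0) (at_left 1)"
    by (rule Lim_transform_eventually)
qed

end

end

section \<open>The model\<close>

locale cnc_constrained_op = constrained_op T J
  for T :: "'n::finite \<Rightarrow> 'h::chilbert \<Rightarrow> 'h"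
    and J :: "(('n, complex) fock \<Rightarrow> ('n, complex) fock) set" +
  assumes cnc: "cnc UNIV T"
begin

abbreviation CD where "CD \<equiv> constrained_Delta J T"
abbreviation E where "E \<equiv> closure (CD ` Gs)"
abbreviation H where "H \<equiv> model_space J T"

lemma near_one_CD: "near_one Gs (\<lambda>f. f - adj Gs G C (C f))"
  by (rule near_one_defect[OF hilbert_tensor hilbert_tensor C_op norm_C_le])

lemmas CD_positive = op_sqrt_works(1)[OF hilbert_tensor near_one_CD, folded constrained_Delta_def]
lemmas CD_op = positive_op_bounded[OF hilbert_tensor CD_positive]
lemmas cinner_CD = positive_op_sym[OF hilbert_tensor CD_positive]
lemmas C_mem = bounded_op_mem[OF C_op]

lemma CD_CD: "f \<in> Gs \<Longrightarrow> CD (CD f) = f - Ca (C f)"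
  using op_sqrt_works(2)[OF hilbert_tensor near_one_CD, folded constrained_Delta_def]
  by (simp add: adj_C C_mem)

lemma hilbert_E: "hilbert_subspace E"
  by (intro hilbert_closure subspace_image[OF hilbert_tensor CD_op])

lemma hilbert_H: "hilbert_subspace H"
  unfolding model_space_def
  by (intro hilbert_ominus hilbert_Times hilbert_tensor hilbert_E)

lemma model_space_iff:
  "(u, v) \<in> H \<longleftrightarrow> u \<in> G \<and> v \<in> E \<and> (\<forall>f\<in>Gs. cinner u (C f) + cinner v (CD f) = 0)"
  by (auto simp: model_space_def ominus_def cinner_prod_def)

lemma model_spaceD:
  assumes "x \<in> H"
  shows "fst x \<in> G" "snd x \<in> E" "f \<in> Gs \<Longrightarrow> cinner (fst x) (C f) + cinner (snd x) (CD f) = 0"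
proof -
  have "(fst x, snd x) \<in> H" using assms by simp
  then show "fst x \<in> G" "snd x \<in> E" "f \<in> Gs \<Longrightarrow> cinner (fst x) (C f) + cinner (snd x) (CD f) = 0"
    unfolding model_space_iff by blast+
qed

text \<open>Orthogonality to all pairs of \<open>C f\<close> and \<open>CD f\<close> then says that
  the second entry is orthogonal to the range of \<open>CD\<close>, in whose closure it
  lies.\<close>

lemma fst_eq_0:
  assumes x: "x \<in> H" and 0: "fst x = 0" shows "x = 0"
proof -
  have v: "snd x \<in> E" "\<forall>f\<in>Gs. cinner (snd x) (CD f) = 0"
    using model_spaceD(2,3)[OF x] by (simp_all add: 0)
  have "cinner (snd x) (snd x) = 0"
  proof (rule cinner_eq_0_closure[OF _ v(1)])
    fix w assume "w \<in> CD ` Gs"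
    then have "cinner (snd x) w = 0" using v(2) by blast
    then show "cinner w (snd x) = 0" by (simp add: cinner_commute_0)
  qed
  then show ?thesis using 0 by (simp add: cinner_self prod_eq_iff)
qed

lemma inj_on_fst: "inj_on fst H"
proof (rule inj_onI)
  fix x y assume xy: "x \<in> H" "y \<in> H" "fst x = fst y"
  then have "x - y = 0"
    by (intro fst_eq_0 hilbert_diff[OF hilbert_H]) simp_all
  then show "x = y" by simp
qed

text \<open>The compression to the model space of the embedding \<open>g \<mapsto> g \<oplus> 0\<close>.\<close>

definition model_embed :: "('n, 'h) fock \<Rightarrow> ('n, 'h) fock \<times> ('n, 'h ^ 'n) fock" where
  "model_embed g = (g - C (Ca g), - CD (Ca g))"

text \<open>The formula is (g, 0) - V V' (g, 0) for the isometry V f = (\<open>C f\<close>,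
  \<open>CD f\<close>) with adjoint V', because V' (g, 0) = \<open>Ca g\<close>. Orthogonality to
  the range of V comes from \<open>CD_CD\<close>.\<close>

lemma model_embed_mem:
  assumes g: "g \<in> G" shows "model_embed g \<in> H"
  unfolding model_embed_def model_space_iff
proof (intro conjI ballI)
  have Cg: "Ca g \<in> Gs" by (rule Ca_mem_Gs[OF g])
  show "g - C (Ca g) \<in> G"
    by (intro hilbert_diff g C_mem Cg hilbert_tensor)
  have "CD (Ca g) \<in> E" by (rule subsetD[OF closure_subset imageI[OF Cg]])
  then show "- CD (Ca g) \<in> E" by (rule hilbert_neg[OF hilbert_E])
  fix f assume f: "f \<in> Gs"
  have "cinner g (C f) = cinner (Ca g) f"
    by (rule cinner_flip[OF cinner_C[OF f g]])
  moreover have "cinner (CD (Ca g)) (CD f) = cinner (Ca g) f - cinner (C (Ca g)) (C f)"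
    by (simp add: cinner_CD[OF Cg bounded_op_mem[OF CD_op f]] CD_CD[OF f] cinner.diff_right
        cinner_C[OF Cg C_mem[OF f]])
  ultimately show "cinner (g - C (Ca g)) (C f) + cinner (- CD (Ca g)) (CD f) = 0"
    by (simp add: cinner.diff_left cinner.minus_left)
qed

lemma cinner_model_embed:
  assumes g: "g \<in> G" and x: "x \<in> H"
  shows "cinner (model_embed g) x = cinner g (fst x)"
proof -
  have "cinner (fst x) (C (Ca g)) + cinner (snd x) (CD (Ca g)) = 0"
    by (rule model_spaceD(3)[OF x Ca_mem_Gs[OF g]])
  from arg_cong[OF this, of cnj]
  have "cinner (C (Ca g)) (fst x) + cinner (CD (Ca g)) (snd x) = 0"
    by (simp add: cinner_commute[of "fst x"] cinner_commute[of "snd x"])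
  then show ?thesis
    by (simp add: model_embed_def cinner_prod_def cinner.diff_left cinner.minus_left algebra_simps)
qed

text \<open>By \<open>poisson_Ka\<close> the first entry of \<open>model_embed g'\<close> is
  \<open>poisson (Ka g')\<close>, and \<open>cinner_model_embed\<close> sees only that
  entry.\<close>

lemma cinner_model_embed_embed:
  assumes "g \<in> G" "g' \<in> G"
  shows "cinner (model_embed g) (model_embed g') = cinner (Ka g) (Ka g')"
proof -
  have "fst (model_embed g') = poisson (Ka g')"
    by (simp add: model_embed_def poisson_Ka assms)
  then show ?thesis
    by (simp add: cinner_model_embed model_embed_mem assms cinner_poisson')
qed

lemma model_embed_op: "bounded_op G H model_embed"
proof (rule bounded_opI[where K=1])
  fix x y c assume x: "x \<in> G"
  show "model_embed x \<in> H" by (rule model_embed_mem[OF x])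
  have "(norm (model_embed x))\<^sup>2 = (norm (Ka x))\<^sup>2"
    unfolding Re_cinner_self[symmetric] cinner_model_embed_embed[OF x x] ..
  then have "norm (model_embed x) = norm (Ka x)"
    by (simp add: power2_eq_iff_nonneg)
  then show "norm (model_embed x) \<le> 1 * norm x" using norm_Ka_le by simp
  show "model_embed (c *\<^sub>C x) = c *\<^sub>C model_embed x"
    using x by (simp add: model_embed_def scaleC_prod_def bounded_op_scaleC[OF Ca_op] bounded_op_scaleC[OF C_op]
      bounded_op_scaleC[OF CD_op] Ca_mem_Gs scaleC.diff_right scaleC.minus_right)
  show "model_embed (x + y) = model_embed x + model_embed y" if "y \<in> G"
    using x that by (simp add: model_embed_def bounded_op_add[OF Ca_op] bounded_op_add[OF C_op]
      bounded_op_add[OF CD_op] Ca_mem_Gs)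
qed

section \<open>The unitary operator onto the model space\<close>

lemma poisson_inj': "poisson h = 0 \<Longrightarrow> h = 0"
  by (rule poisson_inj[OF cnc])

text \<open>\<open>poisson h\<close> itself lies in \<open>G\<close>; taking it as \<open>g\<close>
  shows that its norm is 0.\<close>

lemma poisson_orth_0:
  assumes "\<And>g. g \<in> G \<Longrightarrow> cinner (Ka g) h = 0" shows "h = 0"
proof (rule poisson_inj')
  have "cinner (poisson h) (poisson h) = 0"
    using assms[OF poisson_mem_G[of h]] by (simp add: cinner_poisson')
  then show "poisson h = 0" by (simp add: cinner_self)
qed

lemma Ka_op_G: "bounded_op G UNIV Ka"
  by (rule bounded_op_subset[OF Ka_op]) simp_all

lemma closure_Ka: "closure (Ka ` G) = UNIV"
proof (rule proj_closure_eqI[OF hilbert_UNIV])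
  show "complex_vector.subspace (Ka ` G)"
    by (rule subspace_image[OF hilbert_tensor Ka_op_G])
  fix x assume "\<And>s. s \<in> Ka ` G \<Longrightarrow> cinner s x = 0"
  then show "x = 0" by (intro poisson_orth_0) blast
qed simp

lemma closure_model_embed: "closure (model_embed ` G) = H"
proof (rule proj_closure_eqI[OF hilbert_H])
  show "complex_vector.subspace (model_embed ` G)"
    by (rule subspace_image[OF hilbert_tensor model_embed_op])
  fix x assume x: "x \<in> H" and 0: "\<And>s. s \<in> model_embed ` G \<Longrightarrow> cinner s x = 0"
  have "cinner (model_embed (fst x)) x = 0"
    using 0 model_spaceD(1)[OF x] by blast
  then have "fst x = 0"
    unfolding cinner_model_embed[OF model_spaceD(1)[OF x] x] by (simp add: cinner_self)
  with x show "x = 0" by (rule fst_eq_0)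
qed (auto simp: model_embed_mem)

text \<open>\<open>U\<close> sends \<open>Ka g\<close> to \<open>model_embed g\<close>. Pairing
  \<open>U h\<close> with the latter detects its first entry on one side and
  \<open>poisson h\<close> on the other.\<close>

lemma model_unitary:
  obtains U where "unitary_op UNIV H U" "\<And>h. fst (U h) = poisson h"
proof -
  obtain U where U: "unitary_op UNIV H U"
    "\<And>h g. g \<in> G \<Longrightarrow> cinner (model_embed g) (U h) = cinner (Ka g) h"
    using unitary_from_dense_ranges[OF hilbert_UNIV hilbert_H hilbert_tensor
      Ka_op_G model_embed_op cinner_model_embed_embed closure_Ka closure_model_embed] by auto
  have "fst (U h) = poisson h" for h
  proof (rule cinner_ext[OF hilbert_tensor])
    show UH: "fst (U h) \<in> G" by (rule model_spaceD(1)[OF unitary_mem[OF U(1)]])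
    fix g assume g: "g \<in> G"
    show "cinner g (fst (U h)) = cinner g (poisson h)"
      unfolding cinner_model_embed[OF g unitary_mem[OF U(1)], symmetric] U(2)[OF g] by (simp add: cinner_poisson')
  qed (rule poisson_mem_G)
  with U(1) show ?thesis by (rule that)
qed

lemma model_part:
  "\<exists>TT. (\<forall>i. bounded_op H H (TT i) \<and> model_relation J T i (TT i) \<and>
            (\<forall>A. bounded_op H H A \<and> model_relation J T i A \<longrightarrow> (\<forall>x\<in>H. A x = TT i x))) \<and>
        constrained_row_contraction J H TT \<and> unitarily_equivalent UNIV T H TT"
proof -
  obtain U where U: "unitary_op UNIV H U" "\<And>h. fst (U h) = poisson h"
    by (rule model_unitary) blast
  define TT where "TT i y = U (T i (inv_into UNIV U y))" for i y
  have TT: "TT i (U x) = U (T i x)" for i x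
    by (simp add: TT_def unitary_inv[OF U(1)])
  note hH = hilbert_H
  have op: "bounded_op H H (TT i)" for i
    by (rule bounded_op_transfer[OF U(1) T_op]) (rule TT)
  have adj_TT: "adj H H (TT i) (U x) = U (Ta i x)" for i x
    by (rule adj_transfer[OF U(1) hH T_op]) (rule TT)
  \<comment> \<open>At x = \<open>U h\<close> the relation says that the first entry of
    \<open>U (Ta i h)\<close>, which is \<open>poisson (Ta i h)\<close>, is the backward shift of
    \<open>poisson h\<close>.\<close>
  have rel: "model_relation J T i (TT i)" for i
    unfolding model_relation_def
  proof
    fix x assume "x \<in> H"
    then obtain h where x: "x = U h" using unitary_surj[OF U(1)] by blast
    show "fst (adj H H (TT i) x) = ampliation N (defect T) (adj N N (constrained_creation J i)) (fst x)"
      unfolding x adj_TT U(2)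
        ampliation_adj_constrained_creation[OF poisson_mem_G] shift_poisson ..
  qed
  \<comment> \<open>The first entry determines a vector of the model space, so the relation fixes
    the adjoint of \<open>A\<close>, and \<open>A\<close> is the adjoint of its adjoint.\<close>
  have uniq: "A x = TT i x" if A: "bounded_op H H A" "model_relation J T i A" and x: "x \<in> H" for A i x
  proof -
    have adj_eq: "adj H H A y = adj H H (TT i) y" if y: "y \<in> H" for y
    proof (rule inj_onD[OF inj_on_fst])
      show "fst (adj H H A y) = fst (adj H H (TT i) y)"
        using A(2) rel y by (simp add: model_relation_def)
    qed (use y bounded_op_mem[OF bounded_op_adj[OF hH hH A(1)]] bounded_op_mem[OF bounded_op_adj[OF hH hH op]] in auto)
    have "A x = adj H H (adj H H A) x"
      by (rule adj_adj[OF hH hH A(1) x, symmetric])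
    also have "\<dots> = TT i x"
    proof (rule adj_eqI[OF hH hH bounded_op_adj[OF hH hH A(1)] x bounded_op_mem[OF op x]])
      show "cinner (adj H H A y) x = cinner y (TT i x)" if y: "y \<in> H" for y
        unfolding adj_eq[OF y] by (rule cinner_adj'[OF hH hH op x y, symmetric])
    qed
    finally show ?thesis .
  qed
  have "constrained_row_contraction J H TT"
    unfolding constrained_row_contraction_def
    using row_contraction_transfer[where Y=H and U=U and T'=TT, OF hH U(1) TT] cnc_transfer[where Y=H and U=U and T'=TT, OF hH U(1) TT cnc]
      has_fcalc_transfer[where Y=H and U=U and T'=TT, OF hH U(1) TT] fcalc by blast
  moreover have "unitarily_equivalent UNIV T H TT"
    by (rule unitarily_equivalent_transfer[where Y=H and U=U and T'=TT, OF hH U(1) TT])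
  ultimately show ?thesis using op rel uniq by blast
qed

section \<open>Pure row contractions and inner characteristic functions\<close>

text \<open>\<open>Ka\<close> after \<open>poisson\<close> is a contraction whose form at
  \<open>h\<close> attains the squared norm of \<open>h\<close>; expanding the norm of the
  difference leaves 0.\<close>

lemma pure_Ka_poisson:
  assumes "pure UNIV T" shows "Ka (poisson h) = h"
proof -
  have "Re (cinner (Ka (poisson h)) h) = (norm h)\<^sup>2"
    using assms by (simp add: cinner_poisson'[symmetric] Re_cinner_self pure_iff_poisson)
  moreover have "norm (Ka (poisson h)) \<le> norm h"
    using norm_Ka_le[of "poisson h"] norm_poisson_le[of h] by simp
  then have "(norm (Ka (poisson h)))\<^sup>2 \<le> (norm h)\<^sup>2" by (intro power_mono) simp_all
  ultimately have "(norm (Ka (poisson h) - h))\<^sup>2 \<le> 0"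
    by (simp add: norm_diff_square)
  then show ?thesis by simp
qed

text \<open>In \<open>norm_Ka_Ca\<close> at \<open>poisson h\<close> the first term already exhausts
  the right side.\<close>

lemma pure_Ca_poisson:
  assumes "pure UNIV T" shows "Ca (poisson h) = 0"
  using norm_Ka_Ca[of "poisson h"] assms by (simp add: pure_Ka_poisson pure_iff_poisson)

text \<open>\<open>Ca\<close> kills the range of \<open>poisson\<close>, so \<open>Ka\<close> kills
  the range of \<open>C\<close> and \<open>poisson_Ka\<close> gives C = C Ca C. Thus x -
  \<open>Ca (C x)\<close> lies in the kernel of \<open>C\<close>, to which \<open>x\<close> is
  orthogonal.\<close>

lemma pure_imp_partial_isometry:
  assumes pure: "pure UNIV T" shows "partial_isometry Gs G C"
  unfolding partial_isometry_def
proof (intro conjI C_op ballI)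
  fix x assume "x \<in> Gs \<ominus>\<^sub>H {z \<in> Gs. C z = 0}"
  then have x: "x \<in> Gs" and orth: "\<And>z. z \<in> Gs \<Longrightarrow> C z = 0 \<Longrightarrow> cinner x z = 0"
    by (auto simp: ominus_def)
  note Cx = C_mem[OF x]
  have "Ka (C x) = 0"
  proof (rule cinner_ext[OF hilbert_UNIV])
    fix h
    have "cinner h (Ka (C x)) = cinner (poisson h) (C x)" by (simp add: cinner_poisson)
    also have "\<dots> = cinner (Ca (poisson h)) x"
      by (rule cinner_flip[OF cinner_C[OF x poisson_mem_G]])
    finally show "cinner h (Ka (C x)) = cinner h 0"
      by (simp add: pure_Ca_poisson[OF pure])
  qed simp_all
  then have "C x = C (Ca (C x))"
    using poisson_Ka[OF Cx] bounded_op_zero[OF hilbert_UNIV poisson_op] by simp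
  then have "C (x - Ca (C x)) = 0"
    by (simp add: bounded_op_diff[OF hilbert_tensor C_op x Ca_mem_Gs[OF Cx]])
  then have "cinner x (x - Ca (C x)) = 0"
    using x Ca_mem_Gs[OF Cx] by (intro orth hilbert_diff hilbert_tensor)
  then have "cinner x x = cinner (C x) (C x)"
    by (simp add: cinner.diff_right cinner_C[OF x Cx])
  from arg_cong[OF this, of Re] show "norm (C x) = norm x"
    by (simp add: Re_cinner_self power2_eq_iff_nonneg)
qed

text \<open>\<open>Ca\<close> maps \<open>G\<close> into the complement of the kernel of
  \<open>C\<close>, where \<open>C\<close> is isometric, so Ca C Ca = Ca there. Then
  \<open>Ca\<close> vanishes at \<open>poisson (Ka g)\<close>, which makes poisson Ka idempotent;
  injectivity of \<open>poisson\<close> and \<open>poisson_orth_0\<close> turn this into Ka poisson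
  = I.\<close>

lemma partial_isometry_imp_pure:
  assumes pi: "partial_isometry Gs G C" shows "pure UNIV T"
proof -
  have CaCCa: "Ca (C (Ca g)) = Ca g" if g: "g \<in> G" for g
  proof -
    let ?x = "Ca g"
    have x: "?x \<in> Gs" by (rule Ca_mem_Gs[OF g])
    have "cinner ?x z = 0" if "z \<in> Gs" "C z = 0" for z
    proof -
      have "cinner z ?x = 0" using cinner_C[OF that(1) g] that(2) by simp
      then show ?thesis by (simp add: cinner_commute_0)
    qed
    then have eq: "norm (C ?x) = norm ?x"
      using pi x by (auto simp: partial_isometry_def ominus_def)
    have "Re (cinner (Ca (C ?x)) ?x) = (norm ?x)\<^sup>2"
      using cinner_flip[OF cinner_C[OF x C_mem[OF x]], symmetric] by (simp add: Re_cinner_self eq)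
    moreover have "(norm (Ca (C ?x)))\<^sup>2 \<le> (norm ?x)\<^sup>2"
      using norm_Ca_le[of "C ?x"] by (intro power_mono) (simp_all add: eq)
    ultimately have "(norm (Ca (C ?x) - ?x))\<^sup>2 \<le> 0"
      by (simp add: norm_diff_square)
    then show ?thesis by simp
  qed
  have KaK: "Ka (poisson (Ka g)) = Ka g" if g: "g \<in> G" for g
  proof -
    note Q = C_mem[OF Ca_mem_Gs[OF g]]
    have "Ca (poisson (Ka g)) = 0"
      unfolding poisson_Ka[OF g] by (simp add: bounded_op_diff[OF hilbert_UNIV Ca_op] CaCCa[OF g])
    then have "poisson (Ka (poisson (Ka g))) = poisson (Ka g)"
      using poisson_Ka[OF poisson_mem_G[of "Ka g"]] bounded_op_zero[OF hilbert_tensor C_op] by simp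
    then have "poisson (Ka (poisson (Ka g)) - Ka g) = 0"
      by (simp add: bounded_op_diff[OF hilbert_UNIV poisson_op])
    from poisson_inj'[OF this] show ?thesis by simp
  qed
  have "Ka (poisson h) - h = 0" for h
  proof (rule poisson_orth_0)
    fix g assume g: "g \<in> G"
    have "cinner (Ka g) (Ka (poisson h)) = cinner (Ka (poisson (Ka g))) h"
      by (simp add: cinner_poisson[symmetric] cinner_poisson'[symmetric])
    then show "cinner (Ka g) (Ka (poisson h) - h) = 0"
      by (simp add: KaK[OF g] cinner.diff_right)
  qed
  then have KaK_id: "Ka (poisson h) = h" for h by simp
  have "(norm (poisson h))\<^sup>2 = (norm h)\<^sup>2" for h
  proof -
    have "cinner (poisson h) (poisson h) = cinner h h"
      by (simp add: cinner_poisson KaK_id)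
    from arg_cong[OF this, of Re] show ?thesis by (simp only: Re_cinner_self)
  qed
  then show ?thesis by (simp add: pure_iff_poisson power2_eq_iff_nonneg)
qed

lemma pure_iff_inner: "pure UNIV T \<longleftrightarrow> inner_multi_analytic J (defect_star T) (defect T) C"
  using pure_imp_partial_isometry partial_isometry_imp_pure multi_analytic_C
  unfolding inner_multi_analytic_def by blast

text \<open>For pure \<open>T\<close> the kernel is isometric with range \<open>P\<close>, so it
  serves directly as the unitary.\<close>

lemma pure_model:
  assumes pure: "pure UNIV T" and P: "P = pure_model_space J T"
    and B: "B = (\<lambda>i x. proj P (ampliation N (defect T) (constrained_creation J i) x))"
  shows "row_contraction P B" "unitarily_equivalent UNIV T P B"
proof -
  have hP: "hilbert_subspace P"
    unfolding P pure_model_space_def by (intro hilbert_ominus hilbert_tensor)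
  have P_iff: "y \<in> P \<longleftrightarrow> y \<in> G \<and> (\<forall>f\<in>Gs. cinner y (C f) = 0)" for y
    by (auto simp: P pure_model_space_def ominus_def)
  have mem: "poisson h \<in> P" for h
    unfolding P_iff
  proof (intro conjI ballI poisson_mem_G)
    fix f assume f: "f \<in> Gs"
    have "cinner (poisson h) (C f) = cinner (Ca (poisson h)) f"
      by (rule cinner_flip[OF cinner_C[OF f poisson_mem_G]])
    then show "cinner (poisson h) (C f) = 0" by (simp add: pure_Ca_poisson[OF pure])
  qed
  \<comment> \<open>Orthogonality to the range of \<open>C\<close> forces \<open>Ca y = 0\<close>,
    and \<open>poisson_Ka\<close> then exhibits \<open>y\<close> as a value of
    \<open>poisson\<close>.\<close>
  have surj: "poisson (Ka y) = y" if y: "y \<in> P" for y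
  proof -
    have yG: "y \<in> G" using y by (simp add: P_iff)
    have "cinner y (C (Ca y)) = 0" using y Ca_mem_Gs[OF yG] by (simp add: P_iff)
    then have "cinner (C (Ca y)) y = 0" by (simp add: cinner_commute_0)
    then have "Ca y = 0" by (simp add: cinner_C[OF Ca_mem_Gs[OF yG] yG] cinner_self)
    then show ?thesis
      using poisson_Ka[OF yG] bounded_op_zero[OF hilbert_tensor C_op] by simp
  qed
  have U: "unitary_op UNIV P poisson"
    unfolding unitary_op_def
  proof (intro conjI ballI)
    show "bounded_op UNIV P poisson"
      by (rule bounded_op_subset[OF poisson_op]) (simp_all add: mem)
    show "range poisson = P"
    proof (intro subset_antisym subsetI)
      fix y assume "y \<in> P"
      then show "y \<in> range poisson" using surj by (metis rangeI)
    qed (use mem in auto)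
    show "cinner (poisson x) (poisson y) = cinner x y" for x y
      by (simp add: cinner_poisson pure_Ka_poisson[OF pure])
  qed
  \<comment> \<open>Against y in \<open>P\<close> both projections drop out; y =
    \<open>poisson (Ka y)\<close> turns the backward shift into \<open>Ta i\<close>, which moves
    across as \<open>T i\<close>.\<close>
  have T': "B i (poisson x) = poisson (T i x)" for i x
  proof (rule cinner_ext[OF hP])
    show "B i (poisson x) \<in> P" unfolding B by (rule proj_mem[OF hP])
    fix y assume y: "y \<in> P"
    have yG: "y \<in> G" using y by (simp add: P_iff)
    have "cinner y (B i (poisson x)) = cinner y (creation i (poisson x))"
      by (simp add: B cinner_proj'[OF hP y] ampliation_constrained_creation[OF poisson_mem_G]
          cinner_proj'[OF hilbert_tensor yG])
    also have "\<dots> = cinner (ell2_shift [i] y) (poisson x)"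
      by (rule cinner_flip[OF cinner_creation])
    also have "ell2_shift [i] y = poisson (Ta i (Ka y))"
      by (subst surj[OF y, symmetric]) (rule shift_poisson)
    also have "cinner (poisson (Ta i (Ka y))) (poisson x) = cinner (Ka y) (T i x)"
      by (simp add: cinner_poisson pure_Ka_poisson[OF pure] cinner_T')
    finally show "cinner y (B i (poisson x)) = cinner y (poisson (T i x))"
      by (simp add: cinner_poisson')
  qed (rule mem)
  show "row_contraction P B" by (rule row_contraction_transfer[where Y=P and U=poisson and T'=B, OF hP U T'])
  show "unitarily_equivalent UNIV T P B" by (rule unitarily_equivalent_transfer[where Y=P and U=poisson and T'=B, OF hP U T'])
qed

end

theorem theorem2p2:
  fixes J :: "(('n::finite, complex) fock \<Rightarrow> ('n, complex) fock) set"
    and T :: "'n \<Rightarrow> 'h::chilbert \<Rightarrow> 'h"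
  assumes "wot_closed_ideal J" and "J \<noteq> nc_toeplitz"
    and "row_contraction UNIV T" and "cnc UNIV T"
    and "\<forall>\<phi>\<in>J. has_fcalc UNIV T \<phi> (\<lambda>_. 0)"
  shows
    "inj_on fst (model_space J T) \<and>
     (\<exists>TT. (\<forall>i. bounded_op (model_space J T) (model_space J T) (TT i) \<and>
                model_relation J T i (TT i) \<and>
                (\<forall>A. bounded_op (model_space J T) (model_space J T) A \<and> model_relation J T i A
                      \<longrightarrow> (\<forall>x\<in>model_space J T. A x = TT i x))) \<and>
           constrained_row_contraction J (model_space J T) TT \<and>
           unitarily_equivalent UNIV T (model_space J T) TT) \<and>
     (pure UNIV T \<longleftrightarrow>
        inner_multi_analytic J (defect_star T) (defect T) (constrained_char_fun J T)) \<and>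
     (pure UNIV T \<longrightarrow>
        (let H = pure_model_space J T;
             C = (\<lambda>i x. proj H (ampliation (N_space J) (defect T) (constrained_creation J i) x))
         in row_contraction H C \<and> unitarily_equivalent UNIV T H C))"
proof -
  interpret cnc_constrained_op T J
    by unfold_locales (use assms in auto)
  show ?thesis
    unfolding Let_def
    by (intro conjI impI inj_on_fst model_part pure_iff_inner pure_model[OF _ refl refl])
qed

end
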